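(* Unless $\mathrm{P}=\mathrm{NP}$, the Maximum Reachability Trip Temporalisation problem (mrtt) cannot be approximated within a factor less than $\frac{\sqrt{n}}{12}$ ($n$ the number of nodes), even if the input trip network is strongly temporalisable; i.e. there is no polynomial-time algorithm that, on every strongly temporalisable input trip network with $n$ nodes, returns a temporalisation whose $\tau$-reachability is at least $1/\rho$ times the optimum for some approximation ratio $\rho<\sqrt{n}/12$.
   Context: A weighted multidigraph $D=(V,E)$ has a finite node set $V$ and a finite multiset $E$ of edges $(u,v,w)$ with weight $w>0$. A trip network is a pair $(D,\mathbb{T})$ where $\mathbb{T}$ is a finite multiset of walks in $D$ (trips); every node and edge of $D$ appears in some trip. A temporalisation $\tau$ assigns a real starting time $\tau(T)$ to each trip. For a trip $T=e_1,\dots,e_k$ with $e_i=(u_i,v_i,w_i)$, it induces temporal edges $(u_i,v_i,\tau(T)+\sum_{j<i}w_j,w_i)$ (tail, head, starting time, travel time). The induced temporal graph $G[D,\mathbb{T},\tau]$ has node set $V$ and all temporal edges induced by all trips. A temporal path from $u$ to $v$ is a sequence of consecutive temporal edges from $u$ to $v$ in which each edge's starting time is at least the arrival time (starting time plus travel time) of the previous one; $v$ is $\tau$-reachable from $u$ if such a path exists (every node reaches itself). The $\tau$-reachability of the trip network is the number of ordered pairs $(u,v)$ with $v$ $\tau$-reachable from $u$. mrtt: given a trip network, find a temporalisation maximising its $\tau$-reachability. A trip network is strongly temporalisable if for every two nodes $s,t$ there exists a temporalisation $\tau$ such that $t$ is $\tau$-reachable from $s$. *)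

theory Defs
  imports Complex_Main "HOL-Library.Multiset" "HOL-Computational_Algebra.Polynomial"
begin

section \<open>Trip networks\<close>

type_synonym 'v edge = "'v \<times> 'v \<times> real"

fun tail :: "'v \<times> 'v \<times> 'w \<Rightarrow> 'v" where "tail (u, v, w) = u"
fun head :: "'v \<times> 'v \<times> 'w \<Rightarrow> 'v" where "head (u, v, w) = v"
fun weight :: "'v \<times> 'v \<times> 'w \<Rightarrow> 'w" where "weight (u, v, w) = w"

text \<open>
  The multiset of trips is given by an enumeration, so that a temporalisation, which maps trip
  indices to starting times, can start two copies of the same walk at different times.
\<close>

record 'v trip_network =
  nodes :: "'v set"
  edges :: "'v edge multiset"
  trips :: "'v edge list list"

definition walk :: "'v edge multiset \<Rightarrow> 'v edge list \<Rightarrow> bool" where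
  "walk E T \<longleftrightarrow> T \<noteq> [] \<and> set T \<subseteq> set_mset E \<and> successively (\<lambda>e f. head e = tail f) T"

definition trip_network :: "'v trip_network \<Rightarrow> bool" where
  "trip_network N \<longleftrightarrow>
     finite (nodes N) \<and>
     (\<forall>(u, v, w) \<in> set_mset (edges N). u \<in> nodes N \<and> v \<in> nodes N \<and> w > 0) \<and>
     (\<forall>T \<in> set (trips N). walk (edges N) T) \<and>
     (\<forall>e \<in> set_mset (edges N). \<exists>T \<in> set (trips N). e \<in> set T) \<and>
     (\<forall>x \<in> nodes N. \<exists>T \<in> set (trips N). \<exists>e \<in> set T. x = tail e \<or> x = head e)"

type_synonym temporalisation = "nat \<Rightarrow> real"

text \<open>Temporal edges are tuples (tail, head, starting time, travel time).\<close>

type_synonym 'v temporal_edge = "'v \<times> 'v \<times> real \<times> real"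

definition temporal_edges :: "'v trip_network \<Rightarrow> temporalisation \<Rightarrow> 'v temporal_edge set" where
  "temporal_edges N \<tau> =
     {(tail (T ! j), head (T ! j), \<tau> i + (\<Sum>l<j. weight (T ! l)), weight (T ! j)) | i j T.
        i < length (trips N) \<and> T = trips N ! i \<and> j < length T}"

definition temporal_path ::
    "'v temporal_edge set \<Rightarrow> 'v \<Rightarrow> 'v temporal_edge list \<Rightarrow> 'v \<Rightarrow> bool" where
  "temporal_path A u P v \<longleftrightarrow>
     P \<noteq> [] \<and> set P \<subseteq> A \<and> fst (hd P) = u \<and> fst (snd (last P)) = v \<and>
     successively (\<lambda>(a, b, t, d) (a', b', t', d'). b = a' \<and> t + d \<le> t') P"

definition reachable :: "'v trip_network \<Rightarrow> temporalisation \<Rightarrow> 'v \<Rightarrow> 'v \<Rightarrow> bool" where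
  "reachable N \<tau> u v \<longleftrightarrow> u = v \<or> (\<exists>P. temporal_path (temporal_edges N \<tau>) u P v)"

definition reachability :: "'v trip_network \<Rightarrow> temporalisation \<Rightarrow> nat" where
  "reachability N \<tau> = card {(u, v). u \<in> nodes N \<and> v \<in> nodes N \<and> reachable N \<tau> u v}"

definition max_reachability :: "'v trip_network \<Rightarrow> nat" where
  "max_reachability N = Max (range (reachability N))"

lemma finite_range_reachability:
  assumes "finite (nodes N)"
  shows "finite (range (reachability N))"
proof -
  have "reachability N \<tau> \<le> card (nodes N \<times> nodes N)" for \<tau>
    unfolding reachability_def by (rule card_mono) (use assms in auto)
  then have "range (reachability N) \<subseteq> {..card (nodes N \<times> nodes N)}"
    by blast
  then show ?thesis
    by (rule finite_subset) simp
qed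

definition strongly_temporalisable :: "'v trip_network \<Rightarrow> bool" where
  "strongly_temporalisable N \<longleftrightarrow> (\<forall>s \<in> nodes N. \<forall>t \<in> nodes N. \<exists>\<tau>. reachable N \<tau> s t)"


section \<open>Polynomial time, P and NP\<close>

text \<open>
  Deterministic Turing machines with finitely many two-way infinite tapes.  The running states are
  the numbers below \<open>num_states\<close>, with initial state 0; the state \<open>num_states\<close> is the halting
  state.  The tape symbols are the numbers below \<open>num_symbols\<close>: 0 is the blank, 1 and 2 represent
  the bits \<open>False\<close> and \<open>True\<close>.  The transition function receives the state and the scanned
  symbols; it returns the next state and, for each tape, the symbol to write and the displacement
  of the head.
\<close>

record tm =
  num_tapes :: nat
  num_symbols :: nat
  num_states :: nat
  delta :: "nat \<Rightarrow> nat list \<Rightarrow> nat \<times> (nat \<times> int) list"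

definition turing_machine :: "tm \<Rightarrow> bool" where
  "turing_machine M \<longleftrightarrow>
     num_tapes M \<ge> 1 \<and> num_symbols M \<ge> 3 \<and>
     (\<forall>q < num_states M. \<forall>ss. length ss = num_tapes M \<and> set ss \<subseteq> {..<num_symbols M} \<longrightarrow>
        (case delta M q ss of (q', as) \<Rightarrow>
           q' \<le> num_states M \<and> length as = num_tapes M \<and>
           (\<forall>(a, d) \<in> set as. a < num_symbols M \<and> d \<in> {-1, 0, 1})))"

text \<open>A tape is a pair of the head position and the contents.\<close>

type_synonym tape = "int \<times> (int \<Rightarrow> nat)"
type_synonym config = "nat \<times> tape list"

definition word_tape :: "bool list \<Rightarrow> int \<Rightarrow> nat" where
  "word_tape x i =
     (if 0 \<le> i \<and> i < int (length x) then (if x ! nat i then 2 else 1) else 0)"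

definition initial :: "tm \<Rightarrow> bool list \<Rightarrow> config" where
  "initial M x = (0, (0, word_tape x) # replicate (num_tapes M - 1) (0, \<lambda>_. 0))"

fun step :: "tm \<Rightarrow> config \<Rightarrow> config" where
  "step M (q, ts) =
     (if q = num_states M then (q, ts)
      else case delta M q (map (\<lambda>(h, c). c h) ts) of (q', as) \<Rightarrow>
        (q', map2 (\<lambda>(a, d) (h, c). (h + d, c(h := a))) as ts))"

text \<open>
  On input \<open>x\<close>, machine \<open>M\<close> has halted after \<open>t\<close> steps with output \<open>y\<close>, which is the word on the
  first tape that starts at cell 0 and is terminated by a blank.
\<close>

definition halts_with :: "tm \<Rightarrow> bool list \<Rightarrow> nat \<Rightarrow> bool list \<Rightarrow> bool" where
  "halts_with M x t y \<longleftrightarrow>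
     (case (step M ^^ t) (initial M x) of (q, ts) \<Rightarrow>
        q = num_states M \<and> (\<forall>i \<in> {0..int (length y)}. snd (hd ts) i = word_tape y i))"

text \<open>
  Neither the time bound nor the specification is imposed on words that do not encode an element
  of \<open>D\<close>.
\<close>

definition poly_time_solvable ::
    "('a \<Rightarrow> bool list) \<Rightarrow> 'a set \<Rightarrow> ('a \<Rightarrow> bool list \<Rightarrow> bool) \<Rightarrow> bool" where
  "poly_time_solvable enc D R \<longleftrightarrow>
     (\<exists>M (p :: nat poly). turing_machine M \<and>
        (\<forall>a \<in> D. \<exists>t y. t \<le> poly p (length (enc a)) \<and> halts_with M (enc a) t y \<and> R a y))"

definition class_P :: "bool list set set" where
  "class_P = {L. poly_time_solvable (\<lambda>x. x) UNIV (\<lambda>x y. y = [x \<in> L])}"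

text \<open>
  Self-delimiting codes: an element of a list is announced by \<open>True\<close>, the end by \<open>False\<close>.
\<close>

definition enc_list :: "('a \<Rightarrow> bool list) \<Rightarrow> 'a list \<Rightarrow> bool list" where
  "enc_list enc xs = concat (map (\<lambda>x. True # enc x) xs) @ [False]"

definition enc_word :: "bool list \<Rightarrow> bool list" where
  "enc_word = enc_list (\<lambda>b. [b])"

definition enc_pair :: "bool list \<Rightarrow> bool list \<Rightarrow> bool list" where
  "enc_pair x y = enc_word x @ y"

definition class_NP :: "bool list set set" where
  "class_NP = {L. \<exists>V \<in> class_P. \<exists>p :: nat poly. \<forall>x.
     x \<in> L \<longleftrightarrow> (\<exists>y. length y \<le> poly p (length x) \<and> enc_pair x y \<in> V)}"


section \<open>The problem mrtt\<close>

text \<open>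
  An input consists of the number \<open>n\<close> of nodes, which are numbered from 0 to \<open>n - 1\<close>, the edges
  and the trips.  Weights in inputs and starting times in outputs are rational; numbers are
  written in binary (least significant bit first) and rationals as reduced fractions.
\<close>

type_synonym mrtt_input = "nat \<times> (nat \<times> nat \<times> rat) list \<times> (nat \<times> nat \<times> rat) list list"

fun real_edge :: "nat \<times> nat \<times> rat \<Rightarrow> nat edge" where
  "real_edge (u, v, w) = (u, v, real_of_rat w)"

fun network_of :: "mrtt_input \<Rightarrow> nat trip_network" where
  "network_of (n, es, Ts) =
     \<lparr>nodes = {..<n}, edges = mset (map real_edge es), trips = map (map real_edge) Ts\<rparr>"

fun binary :: "nat \<Rightarrow> bool list" where
  "binary n = (if n = 0 then [] else odd n # binary (n div 2))"

declare binary.simps [simp del]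

definition enc_nat :: "nat \<Rightarrow> bool list" where
  "enc_nat n = enc_word (binary n)"

definition enc_int :: "int \<Rightarrow> bool list" where
  "enc_int k = (k < 0) # enc_nat (nat \<bar>k\<bar>)"

definition enc_rat :: "rat \<Rightarrow> bool list" where
  "enc_rat r = (case quotient_of r of (a, b) \<Rightarrow> enc_int a @ enc_int b)"

fun enc_edge :: "nat \<times> nat \<times> rat \<Rightarrow> bool list" where
  "enc_edge (u, v, w) = enc_nat u @ enc_nat v @ enc_rat w"

fun enc_input :: "mrtt_input \<Rightarrow> bool list" where
  "enc_input (n, es, Ts) =
     enc_nat n @ enc_list enc_edge es @ enc_list (enc_list enc_edge) Ts"

definition enc_output :: "rat list \<Rightarrow> bool list" where
  "enc_output = enc_list enc_rat"

definition prefix_free :: "('a \<Rightarrow> bool list) \<Rightarrow> bool" where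
  "prefix_free enc \<longleftrightarrow> (\<forall>x y u v. enc x @ u = enc y @ v \<longrightarrow> x = y \<and> u = v)"

lemma prefix_freeD: "prefix_free enc \<Longrightarrow> enc x @ u = enc y @ v \<longleftrightarrow> x = y \<and> u = v"
  unfolding prefix_free_def by blast

lemma prefix_free_enc_list:
  assumes "prefix_free enc"
  shows "prefix_free (enc_list enc)"
proof -
  have "enc_list enc xs @ u = enc_list enc ys @ v \<Longrightarrow> xs = ys \<and> u = v" for xs ys u v
  proof (induction xs arbitrary: ys)
    case Nil
    then show ?case by (cases ys) (auto simp: enc_list_def)
  next
    case (Cons x xs)
    then obtain y ys' where ys: "ys = y # ys'"
      by (cases ys) (auto simp: enc_list_def)
    with Cons.prems have "enc x @ (enc_list enc xs @ u) = enc y @ (enc_list enc ys' @ v)"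
      by (simp add: enc_list_def)
    then show ?case using Cons.IH ys by (simp add: prefix_freeD [OF assms])
  qed
  then show ?thesis unfolding prefix_free_def by blast
qed

lemma inj_binary: "binary m = binary n \<Longrightarrow> m = n"
proof (induction m arbitrary: n rule: binary.induct)
  case (1 m)
  show ?case
  proof (cases "m = 0 \<or> n = 0")
    case True
    then show ?thesis using "1.prems"
      by (subst (asm) (1 2) binary.simps) (auto split: if_splits)
  next
    case False
    with "1.prems" have "odd m = odd n" "binary (m div 2) = binary (n div 2)"
      by (subst (asm) (1 2) binary.simps; simp)+
    moreover from this False have "m div 2 = n div 2" using "1.IH" by blast
    ultimately show ?thesis
      by (metis even_two_times_div_two odd_two_times_div_two_succ)
  qed
qed

lemma prefix_free_enc_word: "prefix_free enc_word"
  unfolding enc_word_def by (rule prefix_free_enc_list) (simp add: prefix_free_def)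

lemma prefix_free_enc_nat: "prefix_free enc_nat"
  using inj_binary by (auto simp: prefix_free_def enc_nat_def prefix_freeD [OF prefix_free_enc_word])

lemma prefix_free_enc_int: "prefix_free enc_int"
  by (auto simp: prefix_free_def enc_int_def prefix_freeD [OF prefix_free_enc_nat])

lemma prefix_free_enc_rat: "prefix_free enc_rat"
  using quotient_of_inject
  by (auto simp: prefix_free_def enc_rat_def prefix_freeD [OF prefix_free_enc_int]
      split: prod.splits)

lemma prefix_free_enc_edge: "prefix_free enc_edge"
  by (auto simp: prefix_free_def prefix_freeD [OF prefix_free_enc_nat]
      prefix_freeD [OF prefix_free_enc_rat])

lemma inj_enc_input: "inj enc_input"
proof (rule injI)
  fix I J :: mrtt_input
  assume eq: "enc_input I = enc_input J"
  obtain n es Ts where I: "I = (n, es, Ts)" by (cases I)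
  obtain m fs Us where J: "J = (m, fs, Us)" by (cases J)
  have edges: "prefix_free (enc_list enc_edge)"
    by (intro prefix_free_enc_list prefix_free_enc_edge)
  have trips: "prefix_free (enc_list (enc_list enc_edge))"
    by (intro prefix_free_enc_list edges)
  show "I = J" using eq prefix_freeD [OF trips, of Ts "[]" Us "[]"]
    by (simp add: I J prefix_freeD [OF prefix_free_enc_nat] prefix_freeD [OF edges])
qed

lemma inj_enc_output: "inj enc_output"
  using prefix_freeD [OF prefix_free_enc_list [OF prefix_free_enc_rat], of _ "[]" _ "[]"]
  by (auto simp: inj_def enc_output_def)

definition mrtt_approximable :: "(nat trip_network \<Rightarrow> bool) \<Rightarrow> (nat \<Rightarrow> real) \<Rightarrow> bool" where
  "mrtt_approximable C \<rho> \<longleftrightarrow>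
     poly_time_solvable enc_input {I. trip_network (network_of I) \<and> C (network_of I)}
       (\<lambda>I y. let N = network_of I in
          \<exists>ts. y = enc_output ts \<and> length ts = length (trips N) \<and>
               real (reachability N (\<lambda>i. real_of_rat (ts ! i)))
                 \<ge> 1 / \<rho> (card (nodes N)) * real (max_reachability N))"

end

theory Submission
  imports Defs
begin

text \<open>
  An accepting computation of a polynomially bounded verifier is a choice of one option in each of
  polynomially many layers subject to conflicts between pairs of options. Layered choices are turned
  into a trip network with unit weights in which a path from a source through all layers, where two
  conflicting options share a trip that runs through the later one first, exists for some
  temporalisation if and only if a choice without conflicts exists. At the end of the layers a trip
  fans out to \<open>m\<close> hubs with \<open>m\<close> leaves each. Since every node can return to the source, a choice
  makes all pairs of the \<open>m\<^sup>2\<close> leaves reachable, while without it every leaf reaches only the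
  leaves of one hub after the source has been passed: \<open>m\<^sup>4\<close> against \<open>O(m\<^sup>3)\<close> pairs on
  about \<open>m\<^sup>2\<close> nodes.

  The trips of the first layers encode the bits of the witness by the order of their starting times.
  So the witness is read off a good temporalisation and can be tested with the verifier, which decides
  the language in polynomial time.
\<close>

section \<open>A structured language for Turing machines\<close>

text \<open>No NP-complete problem is presupposed: the reduction starts from the definition of NP,
  and most of the work shows on concrete Turing machines that building the instance and evaluating
  the answer take polynomial time. The approximation algorithm is a black box, called as a
  subroutine only on inputs for which it promises something. Strong temporalisability is the
  obstacle. No hub may be cut off for good, so without a choice the locks leave the way to one hub
  open, and which one depends on the temporalisation. The layers must stay reachable too; hence they
  can also be entered from \<open>V 0\<close>, but only after \<open>TF\<close> has ended. The
  reachability of the answer is never computed; checking the extracted witness replaces this and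
  makes any answer harmless for words outside the language. Origin of 12: with \<open>m\<close> a
  hundred times the part of the inner nodes that does not grow with \<open>m\<close>, there are 4.01
  m nodes besides the leaves. A temporalisation whose locks spell no choice has at most 9.1 m^3
  reachable pairs and \<rho> is at most 1.1 m / 12, while the optimum is at least m^4; since 9.1 *
  1.1 = 10.01 < 12, this is a contradiction.\<close>

type_synonym store = "nat \<Rightarrow> tape"

definition scan :: "store \<Rightarrow> nat \<Rightarrow> nat" where
  "scan S i = snd (S i) (fst (S i))"

text \<open>An \<open>Act\<close> is one step on all tapes at once, depending on all scanned
  symbols. This is what the simulation of a machine with several tapes takes; tests look at a single
  tape.\<close>

datatype com =
  Act "(nat \<Rightarrow> nat) \<Rightarrow> nat \<Rightarrow> nat \<times> int"
| Seq com com
| Cond nat "nat set" com com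
| While nat "nat set" com

definition perform :: "(nat \<Rightarrow> nat \<times> int) \<Rightarrow> store \<Rightarrow> store" where
  "perform g S i = (fst (S i) + snd (g i), (snd (S i))(fst (S i) := fst (g i)))"

inductive run :: "com \<Rightarrow> store \<Rightarrow> nat \<Rightarrow> store \<Rightarrow> bool" where
  run_Act: "run (Act f) S 1 (perform (f (scan S)) S)"
| run_Seq: "run c S t S' \<Longrightarrow> run d S' u S'' \<Longrightarrow> run (Seq c d) S (t + u) S''"
| run_CondT: "scan S i \<in> X \<Longrightarrow> run c S t S' \<Longrightarrow> run (Cond i X c d) S (Suc t) S'"
| run_CondF: "scan S i \<notin> X \<Longrightarrow> run d S t S' \<Longrightarrow> run (Cond i X c d) S (Suc t) S'"
| run_WhileF: "scan S i \<notin> X \<Longrightarrow> run (While i X c) S 1 S"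
| run_WhileT: "scan S i \<in> X \<Longrightarrow> run c S t S' \<Longrightarrow> run (While i X c) S' u S'' \<Longrightarrow>
    run (While i X c) S (Suc (t + u)) S''"

fun csize :: "com \<Rightarrow> nat" where
  "csize (Act f) = 1"
| "csize (Seq c d) = csize c + csize d"
| "csize (Cond i X c d) = Suc (csize c + csize d)"
| "csize (While i X c) = Suc (csize c)"

lemma csize_pos: "0 < csize c"
  by (induction c) auto

definition stay :: "(nat \<Rightarrow> nat) \<Rightarrow> nat \<Rightarrow> nat \<times> int" where
  "stay r i = (r i, 0)"

lemma perform_stay [simp]: "perform (stay (scan S)) S = S"
  by (simp add: perform_def stay_def scan_def fun_eq_iff)

text \<open>The command occupies the states from \<open>b\<close> to \<open>b + csize c - 1\<close>
  and leaves to state \<open>e\<close>. A test is a step of its own, which writes back the scanned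
  symbols.\<close>

fun trans :: "com \<Rightarrow> nat \<Rightarrow> nat \<Rightarrow> nat \<Rightarrow> (nat \<Rightarrow> nat) \<Rightarrow> nat \<times> (nat \<Rightarrow> nat \<times> int)" where
  "trans (Act f) b e q r = (e, f r)"
| "trans (Seq c d) b e q r =
     (if q < b + csize c then trans c b (b + csize c) q r else trans d (b + csize c) e q r)"
| "trans (Cond i X c d) b e q r =
     (if q = b then (if r i \<in> X then b + 1 else b + 1 + csize c, stay r)
      else if q < b + 1 + csize c then trans c (b + 1) e q r
      else trans d (b + 1 + csize c) e q r)"
| "trans (While i X c) b e q r =
     (if q = b then (if r i \<in> X then b + 1 else e, stay r) else trans c (b + 1) b q r)"

definition cstep ::
  "(nat \<Rightarrow> (nat \<Rightarrow> nat) \<Rightarrow> nat \<times> (nat \<Rightarrow> nat \<times> int)) \<Rightarrow> nat \<Rightarrow> nat \<times> store \<Rightarrow> nat \<times> store" where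
  "cstep \<delta> h = (\<lambda>(q, S). if q = h then (q, S)
     else (fst (\<delta> q (scan S)), perform (snd (\<delta> q (scan S))) S))"

text \<open>Only the states that belong to \<open>c\<close> have to follow
  \<open>trans c b e\<close>, so the statement applies to a part of a larger program. A loop is the
  case where the exit of the body is the entry of the loop.\<close>

lemma run_cstep:
  assumes "run c S t S'" "b + csize c \<le> h"
    and "\<And>q r. b \<le> q \<Longrightarrow> q < b + csize c \<Longrightarrow> \<delta> q r = trans c b e q r"
  shows "(cstep \<delta> h ^^ t) (b, S) = (e, S')"
  using assms
proof (induction arbitrary: b e rule: run.induct)
  case (run_Act f S)
  then show ?case by (simp add: cstep_def)
next
  case (run_Seq c S t S' d u S'')
  have "(cstep \<delta> h ^^ t) (b, S) = (b + csize c, S')"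
    using run_Seq.prems csize_pos[of d] by (intro run_Seq.IH(1)) auto
  moreover have "(cstep \<delta> h ^^ u) (b + csize c, S') = (e, S'')"
    using run_Seq.prems by (intro run_Seq.IH(2)) auto
  ultimately show ?case
    by (simp add: funpow_add[of u t, unfolded add.commute[of u t]])
next
  case (run_CondT S i X c t S' d)
  have "cstep \<delta> h (b, S) = (b + 1, S)"
    using run_CondT by (simp add: cstep_def)
  moreover have "(cstep \<delta> h ^^ t) (b + 1, S) = (e, S')"
    using run_CondT.prems by (intro run_CondT.IH) auto
  ultimately show ?case by (simp add: funpow_swap1[symmetric] del: funpow.simps add:
    funpow_Suc_right)
next
  case (run_CondF S i X d t S' c)
  have "cstep \<delta> h (b, S) = (b + 1 + csize c, S)"
    using run_CondF by (simp add: cstep_def)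
  moreover have "(cstep \<delta> h ^^ t) (b + 1 + csize c, S) = (e, S')"
    using run_CondF.prems by (intro run_CondF.IH) auto
  ultimately show ?case by (simp del: funpow.simps add: funpow_Suc_right)
next
  case (run_WhileF S i X c)
  then show ?case by (simp add: cstep_def)
next
  case (run_WhileT S i X c t S' u S'')
  have 1: "cstep \<delta> h (b, S) = (b + 1, S)"
    using run_WhileT by (simp add: cstep_def)
  have 2: "(cstep \<delta> h ^^ t) (b + 1, S) = (b, S')"
    using run_WhileT.prems by (intro run_WhileT.IH(1)) auto
  have 3: "(cstep \<delta> h ^^ u) (b, S') = (e, S'')"
    using run_WhileT.prems by (intro run_WhileT.IH(2)) auto
  have "(cstep \<delta> h ^^ Suc (t + u)) (b, S) = (cstep \<delta> h ^^ (u + t)) (cstep \<delta> h (b, S))"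
    by (simp del: funpow.simps add: funpow_Suc_right add.commute)
  then show ?case using 1 2 3 by (simp only: funpow_add comp_apply)
qed

text \<open>Writing back the scanned symbol is allowed even if it lies outside the alphabet
  \<open>A\<close>. A command therefore stays well-formed over a larger alphabet and may run beside
  tapes with foreign symbols.\<close>

fun wf_com :: "nat \<Rightarrow> nat \<Rightarrow> com \<Rightarrow> bool" where
  "wf_com K A (Act f) \<longleftrightarrow>
     (\<forall>r r'. (\<forall>i<K. r i = r' i) \<longrightarrow> (\<forall>j<K. f r j = f r' j)) \<and>
     (\<forall>r j. (fst (f r j) < A \<or> fst (f r j) = r j) \<and> snd (f r j) \<in> {-1, 0, 1} \<and>
        (j \<ge> K \<longrightarrow> f r j = (r j, 0)))"
| "wf_com K A (Seq c d) \<longleftrightarrow> wf_com K A c \<and> wf_com K A d"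
| "wf_com K A (Cond i X c d) \<longleftrightarrow> i < K \<and> wf_com K A c \<and> wf_com K A d"
| "wf_com K A (While i X c) \<longleftrightarrow> i < K \<and> wf_com K A c"

lemma wf_com_mono:
  assumes "wf_com K A c" "K \<le> K'" "A \<le> A'"
  shows "wf_com K' A' c"
  using assms
proof (induction c)
  case (Act f)
  have "f r j = f r' j" if "\<forall>i<K'. r i = r' i" "j < K'" for r r' j
  proof (cases "j < K")
    case True
    then show ?thesis using Act.prems that by auto
  next
    case False
    then have "f r j = (r j, 0)" "f r' j = (r' j, 0)" using Act.prems by auto
    then show ?thesis using that by simp
  qed
  moreover have "fst (f r j) < A' \<or> fst (f r j) = r j" for r j
  proof -
    have "fst (f r j) < A \<or> fst (f r j) = r j" using Act.prems(1) by simp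
    then show ?thesis using Act.prems(3) by linarith
  qed
  ultimately show ?case using Act.prems by auto
qed auto

lemma trans_cong:
  assumes "wf_com K A c" "\<forall>i<K. r i = r' i"
  shows "fst (trans c b e q r) = fst (trans c b e q r') \<and>
    (\<forall>j<K. snd (trans c b e q r) j = snd (trans c b e q r') j)"
  using assms by (induction c arbitrary: b e) (auto simp: stay_def)

lemma trans_valid:
  assumes "wf_com K A c" "b \<le> q" "q < b + csize c"
  shows "(fst (trans c b e q r) = e \<or> (b \<le> fst (trans c b e q r) \<and>
    fst (trans c b e q r) < b + csize c)) \<and>
    (\<forall>j. (fst (snd (trans c b e q r) j) < A \<or> fst (snd (trans c b e q r) j) = r j) \<and>
      snd (snd (trans c b e q r) j) \<in> {-1, 0, 1})"
  using assms
proof (induction c arbitrary: b e)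
  case (Seq c d)
  show ?case
  proof (cases "q < b + csize c")
    case True
    have "wf_com K A c" "b \<le> q" using Seq.prems by auto
    from Seq.IH(1)[OF this True, of "b + csize c"] show ?thesis
      using True csize_pos[of d] by auto
  next
    case False
    have "wf_com K A d" "b + csize c \<le> q" "q < b + csize c + csize d" using Seq.prems False by auto
    from Seq.IH(2)[OF this, of e] show ?thesis using False by auto
  qed
next
  case (Cond i X c d)
  consider "q = b" | "b + 1 \<le> q" "q < b + 1 + csize c" | "b + 1 + csize c \<le> q"
    using Cond.prems by linarith
  then show ?case
  proof cases
    case 1
    then show ?thesis using csize_pos[of c] csize_pos[of d] by (auto simp: stay_def)
  next
    case 2
    have "wf_com K A c" using Cond.prems by auto
    from Cond.IH(1)[OF this 2, of e] show ?thesis using 2 by auto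
  next
    case 3
    have "wf_com K A d" "q < b + 1 + csize c + csize d" using Cond.prems by auto
    from Cond.IH(2)[OF this(1) 3 this(2), of e] show ?thesis using 3 by auto
  qed
next
  case (While i X c)
  show ?case
  proof (cases "q = b")
    case True
    then show ?thesis using csize_pos[of c] by (auto simp: stay_def)
  next
    case False
    have "wf_com K A c" "b + 1 \<le> q" "q < b + 1 + csize c" using While.prems False by auto
    from While.IH[OF this, of b] show ?thesis using False by auto
  qed
qed auto

section \<open>Commands as Turing machines\<close>

definition machine :: "nat \<Rightarrow> nat \<Rightarrow> com \<Rightarrow> tm" where
  "machine K A c = \<lparr>num_tapes = K, num_symbols = A, num_states = csize c,
     delta = (\<lambda>q ss. case trans c 0 (csize c) q (\<lambda>i. if i < K then ss ! i else 0) of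
       (q', g) \<Rightarrow> (q', map g [0..<K]))\<rparr>"

lemma turing_machine_machine:
  assumes "wf_com K A c" "1 \<le> K" "3 \<le> A"
  shows "turing_machine (machine K A c)"
proof -
  have "case delta (machine K A c) q ss of (q', as) \<Rightarrow>
      q' \<le> csize c \<and> length as = K \<and> (\<forall>(a, d) \<in> set as. a < A \<and> d \<in> {-1, 0, 1})"
    if "q < csize c" "length ss = K" "set ss \<subseteq> {..<A}" for q ss
  proof -
    let ?r = "\<lambda>i. if i < K then ss ! i else 0"
    have r: "?r i < A" for i using that assms(3) by (auto simp: subset_iff)
    obtain q' g where qg: "trans c 0 (csize c) q ?r = (q', g)" by fastforce
    have "q' = csize c \<or> q' < csize c"
      "\<And>j. (fst (g j) < A \<or> fst (g j) = ?r j) \<and> snd (g j) \<in> {-1, 0, 1}"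
      using trans_valid[OF assms(1), of 0 q "csize c" ?r] that(1) unfolding qg by auto
    then have "q' \<le> csize c" "\<And>j. fst (g j) < A \<and> snd (g j) \<in> {-1, 0, 1}"
      using r by fastforce+
    then show ?thesis by (simp add: machine_def qg case_prod_beta)
  qed
  then show ?thesis using assms by (simp add: turing_machine_def machine_def)
qed

lemma step_machine:
  assumes "wf_com K A c" "cstep (trans c 0 (csize c)) (csize c) (q, S) = (q', S')"
  shows "step (machine K A c) (q, map S [0..<K]) = (q', map S' [0..<K])"
proof (cases "q = csize c")
  case True
  then show ?thesis using assms(2) by (simp add: cstep_def machine_def)
next
  case False
  let ?r = "\<lambda>i. if i < K then map (scan S) [0..<K] ! i else 0"
  let ?t = "trans c 0 (csize c) q"
  have "\<forall>i<K. ?r i = scan S i" by simp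
  from trans_cong[OF assms(1) this]
  have eq: "fst (?t ?r) = fst (?t (scan S))" "\<forall>j<K. snd (?t ?r) j = snd (?t (scan S)) j" by blast+
  have read: "map (\<lambda>(h, c). c h) (map S [0..<K]) = map (scan S) [0..<K]"
    by (simp add: scan_def case_prod_beta)
  have st: "q' = fst (?t (scan S))" "S' = perform (snd (?t (scan S))) S"
    using assms(2) False by (auto simp: cstep_def)
  have "step (machine K A c) (q, map S [0..<K]) = (fst (?t ?r),
      map2 (\<lambda>(a, d) (h, c). (h + d, c(h := a))) (map (snd (?t ?r)) [0..<K]) (map S [0..<K]))"
    using False by (simp add: machine_def read case_prod_beta del: map_map)
  also have "\<dots> = (q', map S' [0..<K])"
    using eq st by (auto intro!: nth_equalityI simp: perform_def case_prod_beta)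
  finally show ?thesis .
qed

lemma steps_machine:
  assumes "wf_com K A c" "(cstep (trans c 0 (csize c)) (csize c) ^^ t) (q, S) = (q', S')"
  shows "(step (machine K A c) ^^ t) (q, map S [0..<K]) = (q', map S' [0..<K])"
  using assms(2)
proof (induction t arbitrary: q' S')
  case (Suc t)
  obtain q1 S1 where 1: "(cstep (trans c 0 (csize c)) (csize c) ^^ t) (q, S) = (q1, S1)"
    by fastforce
  then show ?case using Suc step_machine[OF assms(1), of q1 S1 q' S'] by simp
qed simp

lemma run_machine:
  assumes "wf_com K A c" "run c S t S'"
  shows "(step (machine K A c) ^^ t) (0, map S [0..<K]) = (csize c, map S' [0..<K])"
  using run_cstep[OF assms(2), of 0 "csize c"] steps_machine[OF assms(1)] by simp


section \<open>Word registers\<close>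

text \<open>The head stands on the first letter and the word is surrounded by blanks, so a word is a
  stack whose top is under the head.\<close>

definition wtape :: "int \<Rightarrow> bool list \<Rightarrow> tape" where
  "wtape h w = (h, \<lambda>j. word_tape w (j - h))"

text \<open>The head position is forgotten because pushing and popping let it drift. Wherever a word
  has to start at a given cell, this must be repaired by other means.\<close>

definition is_word :: "store \<Rightarrow> nat \<Rightarrow> bool list \<Rightarrow> bool" where
  "is_word S i w \<longleftrightarrow> (\<exists>h. S i = wtape h w)"

definition bsym :: "bool \<Rightarrow> nat" where "bsym b = (if b then 2 else 1)"

fun sym :: "bool list \<Rightarrow> nat" where
  "sym [] = 0"
| "sym (b # w) = bsym b"

lemma bsym_simps [simp]: "bsym True = 2" "bsym False = 1"
  by (simp_all add: bsym_def)

lemma word_tape_Nil [simp]: "word_tape [] i = 0"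
  by (simp add: word_tape_def)

lemma word_tape_Cons: "word_tape (b # w) i = (if i = 0 then bsym b else word_tape w (i - 1))"
  by (auto simp: word_tape_def bsym_def nth_Cons' nat_diff_distrib)

lemma word_tape_neg [simp]: "i < 0 \<Longrightarrow> word_tape w i = 0"
  by (simp add: word_tape_def)

lemma word_tape_0 [simp]: "word_tape w 0 = sym w"
  by (cases w) (simp_all add: word_tape_Cons)

lemma scan_is_word: "is_word S i w \<Longrightarrow> scan S i = sym w"
  by (auto simp: is_word_def scan_def wtape_def)

text \<open>A Hoare triple for total correctness with a time bound and a frame condition: the tapes
  in \<open>V\<close> are known to hold words, all others may hold anything and are left
  alone.\<close>

definition wdo :: "nat set \<Rightarrow> com \<Rightarrow> (nat \<Rightarrow> bool list) \<Rightarrow> nat \<Rightarrow> (nat \<Rightarrow> bool list) \<Rightarrow> bool" where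
  "wdo V c \<sigma> n \<sigma>' \<longleftrightarrow> (\<forall>S. (\<forall>i\<in>V. is_word S i (\<sigma> i)) \<longrightarrow>
     (\<exists>t\<le>n. \<exists>S'. run c S t S' \<and> (\<forall>i\<in>V. is_word S' i (\<sigma>' i)) \<and> (\<forall>i. i \<notin> V \<longrightarrow> S' i = S i)))"

lemma wdoE:
  assumes "wdo V c \<sigma> n \<sigma>'" "\<forall>i\<in>V. is_word S i (\<sigma> i)"
  obtains t S' where "t \<le> n" "run c S t S'" "\<forall>i\<in>V. is_word S' i (\<sigma>' i)" "\<forall>i. i \<notin> V \<longrightarrow> S' i = S i"
  using assms unfolding wdo_def by blast

lemma wdo_mono: "wdo V c \<sigma> n \<sigma>' \<Longrightarrow> n \<le> m \<Longrightarrow> wdo V c \<sigma> m \<sigma>'"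
  unfolding wdo_def by (elim all_forward imp_forward exE conjE) (auto intro: order_trans)

lemma wdo_Seq:
  assumes "wdo V c \<sigma> n \<sigma>'" "wdo V d \<sigma>' m \<sigma>''" "n + m \<le> k"
  shows "wdo V (Seq c d) \<sigma> k \<sigma>''"
  unfolding wdo_def
proof (intro allI impI)
  fix S assume "\<forall>i\<in>V. is_word S i (\<sigma> i)"
  from assms(1) this obtain t S' where 1: "t \<le> n" "run c S t S'" "\<forall>i\<in>V. is_word S' i (\<sigma>' i)"
    "\<forall>i. i \<notin> V \<longrightarrow> S' i = S i" by (rule wdoE)
  from assms(2) 1(3) obtain u S'' where 2: "u \<le> m" "run d S' u S''" "\<forall>i\<in>V. is_word S'' i (\<sigma>'' i)"
    "\<forall>i. i \<notin> V \<longrightarrow> S'' i = S' i" by (rule wdoE)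
  have "run (Seq c d) S (t + u) S''" using 1 2 by (intro run_Seq)
  moreover have "t + u \<le> k" using 1 2 assms(3) by linarith
  ultimately show "\<exists>t\<le>k. \<exists>S''. run (Seq c d) S t S'' \<and> (\<forall>i\<in>V. is_word S'' i (\<sigma>'' i)) \<and>
      (\<forall>i. i \<notin> V \<longrightarrow> S'' i = S i)"
    using 1(4) 2(3,4) by (intro exI[of _ "t + u"]) auto
qed

lemma wdo_Cond:
  assumes "i \<in> V" "sym (\<sigma> i) \<in> X \<Longrightarrow> wdo V c \<sigma> n \<sigma>'" "sym (\<sigma> i) \<notin> X \<Longrightarrow> wdo V d \<sigma> n \<sigma>'" "Suc n \<le> k"
  shows "wdo V (Cond i X c d) \<sigma> k \<sigma>'"
  unfolding wdo_def
proof (intro allI impI)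
  fix S assume S: "\<forall>i\<in>V. is_word S i (\<sigma> i)"
  then have sc: "scan S i = sym (\<sigma> i)" using assms(1) scan_is_word by blast
  have "\<exists>t\<le>n. \<exists>S'. run (Cond i X c d) S (Suc t) S' \<and> (\<forall>i\<in>V. is_word S' i (\<sigma>' i)) \<and>
      (\<forall>i. i \<notin> V \<longrightarrow> S' i = S i)"
  proof (cases "sym (\<sigma> i) \<in> X")
    case True
    from assms(2)[OF True] S obtain t S' where "t \<le> n" "run c S t S'" "\<forall>i\<in>V. is_word S' i (\<sigma>' i)"
      "\<forall>i. i \<notin> V \<longrightarrow> S' i = S i" by (rule wdoE)
    then show ?thesis using True sc run_CondT by metis
  next
    case False
    from assms(3)[OF False] S obtain t S' where "t \<le> n" "run d S t S'" "\<forall>i\<in>V. is_word S' i (\<sigma>' i)"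
      "\<forall>i. i \<notin> V \<longrightarrow> S' i = S i" by (rule wdoE)
    then show ?thesis using False sc run_CondF by metis
  qed
  then show "\<exists>t\<le>k. \<exists>S'. run (Cond i X c d) S t S' \<and> (\<forall>i\<in>V. is_word S' i (\<sigma>' i)) \<and>
      (\<forall>i. i \<notin> V \<longrightarrow> S' i = S i)" using assms(4) by (meson Suc_le_mono order_trans)
qed

lemma wdo_WhileF:
  assumes "i \<in> V" "sym (\<sigma> i) \<notin> X" "1 \<le> k"
  shows "wdo V (While i X c) \<sigma> k \<sigma>"
  unfolding wdo_def
proof (intro allI impI)
  fix S assume S: "\<forall>i\<in>V. is_word S i (\<sigma> i)"
  then have "scan S i \<notin> X" using assms(1,2) scan_is_word by metis
  then have "run (While i X c) S 1 S" by (rule run_WhileF)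
  then show "\<exists>t\<le>k. \<exists>S'. run (While i X c) S t S' \<and> (\<forall>i\<in>V. is_word S' i (\<sigma> i)) \<and>
      (\<forall>i. i \<notin> V \<longrightarrow> S' i = S i)"
    using S assms(3) by (intro exI[of _ 1] conjI exI[of _ S]) auto
qed

lemma wdo_WhileT:
  assumes "i \<in> V" "sym (\<sigma> i) \<in> X" "wdo V c \<sigma> n \<sigma>'" "wdo V (While i X c) \<sigma>' m \<sigma>''" "Suc (n + m) \<le> k"
  shows "wdo V (While i X c) \<sigma> k \<sigma>''"
  unfolding wdo_def
proof (intro allI impI)
  fix S assume S: "\<forall>i\<in>V. is_word S i (\<sigma> i)"
  then have sc: "scan S i \<in> X" using assms(1,2) scan_is_word by metis
  from assms(3) S obtain t S' where 1: "t \<le> n" "run c S t S'" "\<forall>i\<in>V. is_word S' i (\<sigma>' i)"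
    "\<forall>i. i \<notin> V \<longrightarrow> S' i = S i" by (rule wdoE)
  from assms(4) 1(3) obtain u S'' where 2: "u \<le> m" "run (While i X c) S' u S''"
    "\<forall>i\<in>V. is_word S'' i (\<sigma>'' i)" "\<forall>i. i \<notin> V \<longrightarrow> S'' i = S' i" by (rule wdoE)
  have "run (While i X c) S (Suc (t + u)) S''" using sc 1 2 by (intro run_WhileT)
  moreover have "Suc (t + u) \<le> k" using 1 2 assms(5) by linarith
  ultimately show "\<exists>t\<le>k. \<exists>S''. run (While i X c) S t S'' \<and> (\<forall>i\<in>V. is_word S'' i (\<sigma>'' i)) \<and>
      (\<forall>i. i \<notin> V \<longrightarrow> S'' i = S i)"
    using 1(4) 2(3,4) by (intro exI[of _ "Suc (t + u)"]) auto
qed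

definition act1 :: "nat \<Rightarrow> (nat \<Rightarrow> nat \<times> int) \<Rightarrow> com" where
  "act1 i f = Act (\<lambda>r j. if j = i then f (r j) else (r j, 0))"

text \<open>Two steps are taken because a machine step writes before it moves.\<close>

definition push :: "nat \<Rightarrow> bool \<Rightarrow> com" where
  "push i b = Seq (act1 i (\<lambda>a. (a, -1))) (act1 i (\<lambda>a. (bsym b, 0)))"

text \<open>The head does not move on a blank, so that popping the empty word agrees with
  \<open>tl [] = []\<close>.\<close>

definition pop :: "nat \<Rightarrow> com" where
  "pop i = act1 i (\<lambda>a. if a = 0 then (a, 0) else (0, 1))"

lemma run_act1:
  "S' = S(i := (fst (S i) + snd (f (scan S i)), (snd (S i))(fst (S i) := fst (f (scan S i))))) \<Longrightarrow>
   run (act1 i f) S 1 S'"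
proof -
  assume "S' = S(i := (fst (S i) + snd (f (scan S i)),
    (snd (S i))(fst (S i) := fst (f (scan S i)))))"
  then have "S' = perform ((\<lambda>r j. if j = i then f (r j) else (r j, 0)) (scan S)) S"
    by (auto simp: perform_def scan_def fun_eq_iff)
  then show ?thesis unfolding act1_def
    using run_Act[of "\<lambda>r j. if j = i then f (r j) else (r j, 0)" S] by simp
qed

lemma wdo_push:
  assumes "i \<in> V"
  shows "wdo V (push i b) \<sigma> 2 (\<sigma>(i := b # \<sigma> i))"
  unfolding wdo_def
proof (intro allI impI)
  fix S assume S: "\<forall>i\<in>V. is_word S i (\<sigma> i)"
  then obtain h where h: "S i = wtape h (\<sigma> i)" using assms by (auto simp: is_word_def)
  let ?S1 = "S(i := (h - 1, \<lambda>j. word_tape (\<sigma> i) (j - h)))"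
  let ?S2 = "S(i := wtape (h - 1) (b # \<sigma> i))"
  have "run (act1 i (\<lambda>a. (a, -1))) S 1 ?S1"
    by (rule run_act1) (auto simp: h wtape_def scan_def fun_eq_iff)
  moreover have "run (act1 i (\<lambda>a. (bsym b, 0))) ?S1 1 ?S2"
    by (rule run_act1) (auto simp: wtape_def scan_def fun_eq_iff word_tape_Cons)
  ultimately have "run (push i b) S (1 + 1) ?S2" unfolding push_def by (rule run_Seq)
  then have "run (push i b) S 2 ?S2" by (simp only: one_add_one)
  then show "\<exists>t\<le>2. \<exists>S'. run (push i b) S t S' \<and> (\<forall>j\<in>V. is_word S' j ((\<sigma>(i := b # \<sigma> i)) j)) \<and>
      (\<forall>j. j \<notin> V \<longrightarrow> S' j = S j)"
    using S assms by (intro exI[of _ 2] conjI exI[of _ ?S2]) (auto simp: is_word_def)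
qed

lemma wdo_pop:
  assumes "i \<in> V"
  shows "wdo V (pop i) \<sigma> 1 (\<sigma>(i := tl (\<sigma> i)))"
  unfolding wdo_def
proof (intro allI impI)
  fix S assume S: "\<forall>i\<in>V. is_word S i (\<sigma> i)"
  then obtain h where h: "S i = wtape h (\<sigma> i)" using assms by (auto simp: is_word_def)
  let ?S2 = "S(i := wtape (if \<sigma> i = [] then h else h + 1) (tl (\<sigma> i)))"
  have "run (pop i) S 1 ?S2" unfolding pop_def
    by (rule run_act1, cases "\<sigma> i")
      (auto simp: h wtape_def scan_def fun_eq_iff word_tape_Cons bsym_def algebra_simps)
  then show "\<exists>t\<le>1. \<exists>S'. run (pop i) S t S' \<and> (\<forall>j\<in>V. is_word S' j ((\<sigma>(i := tl (\<sigma> i))) j)) \<and>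
      (\<forall>j. j \<notin> V \<longrightarrow> S' j = S j)"
    using S assms by (intro exI[of _ 1] conjI exI[of _ ?S2]) (auto simp: is_word_def)
qed

definition skip :: com where "skip = Act stay"

lemma wdo_skip: "1 \<le> k \<Longrightarrow> wdo V skip \<sigma> k \<sigma>"
proof -
  assume "1 \<le> k"
  moreover have "run skip S 1 S" for S using run_Act[of stay S] by (simp add: skip_def)
  ultimately show ?thesis unfolding wdo_def by blast
qed

definition clear :: "nat \<Rightarrow> com" where "clear i = While i {1, 2} (pop i)"

text \<open>The loop is unrolled along the word that drives it, by induction over this word with the
  registers generalised. All loops over registers are treated after this pattern.\<close>

lemma wdo_clear:
  assumes "i \<in> V" "2 * length (\<sigma> i) + 1 \<le> k"
  shows "wdo V (clear i) \<sigma> k (\<sigma>(i := []))"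
proof -
  have "wdo V (clear i) \<sigma> (2 * length w + 1) (\<sigma>(i := []))" if "\<sigma> i = w" for w \<sigma>
    using that
  proof (induction w arbitrary: \<sigma>)
    case Nil
    then have *: "\<sigma>(i := []) = \<sigma>" by auto
    show ?case unfolding clear_def * by (rule wdo_WhileF) (use assms(1) Nil in auto)
  next
    case (Cons b w)
    have 2: "wdo V (clear i) (\<sigma>(i := w)) (2 * length w + 1) (\<sigma>(i := []))"
      using Cons.IH[of "\<sigma>(i := w)"] by (simp only: fun_upd_same fun_upd_upd simp_thms)
    have 1: "wdo V (pop i) \<sigma> 1 (\<sigma>(i := w))"
      using wdo_pop[OF assms(1), of \<sigma>] Cons.prems by simp
    show ?case unfolding clear_def
      by (rule wdo_WhileT[OF assms(1) _ 1 2[unfolded clear_def]])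
        (use Cons.prems in \<open>auto simp: bsym_def\<close>)
  qed
  from this[OF refl] show ?thesis by (rule wdo_mono) (rule assms)
qed

definition mv :: "nat \<Rightarrow> nat \<Rightarrow> com" where
  "mv i j = Cond i {2} (Seq (pop i) (push j True)) (Seq (pop i) (push j False))"

lemma wdo_mv:
  assumes "i \<in> V" "j \<in> V" "i \<noteq> j" "\<sigma> i = b # w"
  shows "wdo V (mv i j) \<sigma> 4 (\<sigma>(i := w, j := b # \<sigma> j))"
proof -
  have p: "wdo V (pop i) \<sigma> 1 (\<sigma>(i := w))" using wdo_pop[OF assms(1), of \<sigma>] assms(4) by simp
  have q: "wdo V (push j b') (\<sigma>(i := w)) 2 (\<sigma>(i := w, j := b' # \<sigma> j))" for b'
    using wdo_push[OF assms(2), of b' "\<sigma>(i := w)"] assms(3) by simp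
  show ?thesis unfolding mv_def
    by (rule wdo_Cond[where n = 3]; (rule wdo_Seq[OF p])?)
      (use assms q in \<open>auto simp: bsym_def split: if_splits\<close>)
qed

text \<open>Words are stacks, so moving one letter by letter reverses it; two such moves restore the
  order.\<close>

definition rmove :: "nat \<Rightarrow> nat \<Rightarrow> com" where "rmove i j = While i {1, 2} (mv i j)"

lemma wdo_rmove:
  assumes "i \<in> V" "j \<in> V" "i \<noteq> j" "5 * length (\<sigma> i) + 1 \<le> k"
  shows "wdo V (rmove i j) \<sigma> k (\<sigma>(i := [], j := rev (\<sigma> i) @ \<sigma> j))"
proof -
  have "wdo V (rmove i j) \<sigma> (5 * length w + 1) (\<sigma>(i := [], j := rev w @ \<sigma> j))" if "\<sigma> i = w" for w \<sigma>
    using that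
  proof (induction w arbitrary: \<sigma>)
    case Nil
    then have *: "\<sigma>(i := [], j := rev [] @ \<sigma> j) = \<sigma>" by auto
    show ?case unfolding rmove_def * by (rule wdo_WhileF) (use assms(1) Nil in auto)
  next
    case (Cons b w)
    let ?\<sigma> = "\<sigma>(i := w, j := b # \<sigma> j)"
    have *: "?\<sigma> i = w" using assms by simp
    have "?\<sigma>(i := [], j := rev w @ ?\<sigma> j) = \<sigma>(i := [], j := rev (b # w) @ \<sigma> j)"
      using assms by (auto simp: fun_eq_iff)
    with Cons.IH[of ?\<sigma>, OF *] have 2: "wdo V (rmove i j) ?\<sigma> (5 * length w + 1)
      (\<sigma>(i := [], j := rev (b # w) @ \<sigma> j))" by metis
    show ?case unfolding rmove_def
      by (rule wdo_WhileT[OF assms(1) _ wdo_mv[OF assms(1-3), of \<sigma> b w, OF Cons.prems] 2[unfolded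
        rmove_def]])
        (use Cons.prems in \<open>auto simp: bsym_def\<close>)
  qed
  from this[OF refl] show ?thesis by (rule wdo_mono) (rule assms)
qed

definition mv2 :: "nat \<Rightarrow> nat \<Rightarrow> nat \<Rightarrow> com" where
  "mv2 i j l = Cond i {2} (Seq (push l True) (mv i j)) (Seq (push l False) (mv i j))"

lemma wdo_mv2:
  assumes "i \<in> V" "j \<in> V" "l \<in> V" "i \<noteq> j" "l \<noteq> i" "l \<noteq> j" "\<sigma> i = b # w"
  shows "wdo V (mv2 i j l) \<sigma> 7 (\<sigma>(i := w, j := b # \<sigma> j, l := b # \<sigma> l))"
proof -
  have p: "wdo V (push l b') \<sigma> 2 (\<sigma>(l := b' # \<sigma> l))" for b' by (rule wdo_push) fact
  have q: "wdo V (mv i j) (\<sigma>(l := b # \<sigma> l)) 4 (\<sigma>(i := w, j := b # \<sigma> j, l := b # \<sigma> l))"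
    using wdo_mv[OF assms(1,2,4), of "\<sigma>(l := b # \<sigma> l)"] assms
    by (simp add: fun_upd_twist)
  show ?thesis unfolding mv2_def
    by (rule wdo_Cond[where n = 6]; (rule wdo_Seq[OF p])?)
      (use assms q in \<open>auto simp: bsym_def split: if_splits\<close>)
qed

definition rmove2 :: "nat \<Rightarrow> nat \<Rightarrow> nat \<Rightarrow> com" where "rmove2 i j l = While i {1, 2} (mv2 i j l)"

lemma wdo_rmove2:
  assumes "i \<in> V" "j \<in> V" "l \<in> V" "i \<noteq> j" "l \<noteq> i" "l \<noteq> j"
  shows "wdo V (rmove2 i j l) \<sigma> (8 * length (\<sigma> i) + 1)
    (\<sigma>(i := [], j := rev (\<sigma> i) @ \<sigma> j, l := rev (\<sigma> i) @ \<sigma> l))"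
proof -
  have "wdo V (rmove2 i j l) \<sigma> (8 * length w + 1) (\<sigma>(i := [], j := rev w @ \<sigma> j, l := rev w @ \<sigma> l))"
    if "\<sigma> i = w" for w \<sigma>
    using that
  proof (induction w arbitrary: \<sigma>)
    case Nil
    then have *: "\<sigma>(i := [], j := rev [] @ \<sigma> j, l := rev [] @ \<sigma> l) = \<sigma>" by auto
    show ?case unfolding rmove2_def * by (rule wdo_WhileF) (use assms(1) Nil in auto)
  next
    case (Cons b w)
    let ?\<sigma> = "\<sigma>(i := w, j := b # \<sigma> j, l := b # \<sigma> l)"
    have *: "?\<sigma> i = w" using assms by simp
    have "?\<sigma>(i := [], j := rev w @ ?\<sigma> j, l := rev w @ ?\<sigma> l) =
      \<sigma>(i := [], j := rev (b # w) @ \<sigma> j, l := rev (b # w) @ \<sigma> l)"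
      using assms by (auto simp: fun_eq_iff)
    with Cons.IH[of ?\<sigma>, OF *] have 2: "wdo V (rmove2 i j l) ?\<sigma> (8 * length w + 1)
      (\<sigma>(i := [], j := rev (b # w) @ \<sigma> j, l := rev (b # w) @ \<sigma> l))" by metis
    show ?case unfolding rmove2_def
      by (rule wdo_WhileT[OF assms(1) _ wdo_mv2[OF assms, of \<sigma> b w, OF Cons.prems] 2[unfolded
        rmove2_def]])
        (use Cons.prems in \<open>auto simp: bsym_def\<close>)
  qed
  then show ?thesis by blast
qed

text \<open>The detour through the scratch register \<open>l\<close> reverses the word twice. The
  second pass refills \<open>i\<close> and fills \<open>j\<close> at the same time.\<close>

definition dup :: "nat \<Rightarrow> nat \<Rightarrow> nat \<Rightarrow> com" where
  "dup i j l = Seq (rmove i l) (rmove2 l i j)"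

lemma wdo_dup:
  assumes "i \<in> V" "j \<in> V" "l \<in> V" "i \<noteq> j" "l \<noteq> i" "l \<noteq> j" "\<sigma> j = []" "\<sigma> l = []"
    "13 * length (\<sigma> i) + 2 \<le> k"
  shows "wdo V (dup i j l) \<sigma> k (\<sigma>(j := \<sigma> i))"
proof -
  let ?\<sigma> = "\<sigma>(i := [], l := rev (\<sigma> i))"
  have 1: "wdo V (rmove i l) \<sigma> (5 * length (\<sigma> i) + 1) ?\<sigma>"
    using wdo_rmove[of i V l \<sigma>] assms by simp
  have "?\<sigma>(l := [], i := rev (?\<sigma> l) @ ?\<sigma> i, j := rev (?\<sigma> l) @ ?\<sigma> j) = \<sigma>(j := \<sigma> i)"
    using assms by (auto simp: fun_eq_iff)
  with wdo_rmove2[of l V i j ?\<sigma>] have "wdo V (rmove2 l i j) ?\<sigma> (8 * length (?\<sigma> l) + 1)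
    (\<sigma>(j := \<sigma> i))"
    using assms by auto
  then show ?thesis unfolding dup_def using assms by (intro wdo_Seq[OF 1]) auto
qed

definition pairs :: "bool list \<Rightarrow> bool list" where "pairs w = concat (map (\<lambda>b. [True, b]) w)"

lemma enc_word_pairs: "enc_word w = pairs w @ [False]"
  by (simp add: enc_word_def enc_list_def pairs_def)

lemma length_pairs: "length (pairs w) = 2 * length w"
  by (induction w) (auto simp: pairs_def)

lemma length_enc_word: "length (enc_word w) = 2 * length w + 1"
  by (simp add: enc_word_pairs length_pairs)

lemma length_enc_pair: "length (enc_pair u v) = 2 * length u + 1 + length v"
  by (simp add: enc_pair_def length_enc_word)

text \<open>Meant for a register that holds a word in reverse: each letter is pushed and then
  covered with its marker \<open>True\<close>, so the code comes out in the original order.\<close>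

definition encmove :: "nat \<Rightarrow> nat \<Rightarrow> com" where
  "encmove i j = While i {1, 2} (Seq (mv i j) (push j True))"

lemma wdo_encmove:
  assumes "i \<in> V" "j \<in> V" "i \<noteq> j"
  shows "wdo V (encmove i j) \<sigma> (7 * length (\<sigma> i) + 1) (\<sigma>(i := [], j := pairs (rev (\<sigma> i)) @ \<sigma> j))"
proof -
  have "wdo V (encmove i j) \<sigma> (7 * length w + 1) (\<sigma>(i := [], j := pairs (rev w) @ \<sigma> j))"
    if "\<sigma> i = w" for w \<sigma>
    using that
  proof (induction w arbitrary: \<sigma>)
    case Nil
    then have *: "\<sigma>(i := [], j := pairs (rev []) @ \<sigma> j) = \<sigma>" by (auto simp: pairs_def)
    show ?case unfolding encmove_def * by (rule wdo_WhileF) (use assms(1) Nil in auto)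
  next
    case (Cons b w)
    let ?\<sigma>1 = "\<sigma>(i := w, j := b # \<sigma> j)" and ?\<sigma> = "\<sigma>(i := w, j := True # b # \<sigma> j)"
    have *: "?\<sigma> i = w" using assms by simp
    have "wdo V (push j True) ?\<sigma>1 2 ?\<sigma>"
      using wdo_push[OF assms(2), of True ?\<sigma>1] by simp
    then have 1: "wdo V (Seq (mv i j) (push j True)) \<sigma> 6 ?\<sigma>"
      by (rule wdo_Seq[OF wdo_mv[OF assms, of \<sigma> b w, OF Cons.prems]]) simp
    have "?\<sigma>(i := [], j := pairs (rev w) @ ?\<sigma> j) = \<sigma>(i := [], j := pairs (rev (b # w)) @ \<sigma> j)"
      using assms by (auto simp: fun_eq_iff pairs_def)
    with Cons.IH[of ?\<sigma>, OF *] have 2: "wdo V (encmove i j) ?\<sigma> (7 * length w + 1)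
      (\<sigma>(i := [], j := pairs (rev (b # w)) @ \<sigma> j))" by metis
    show ?case unfolding encmove_def
      by (rule wdo_WhileT[OF assms(1) _ 1 2[unfolded encmove_def]])
        (use Cons.prems in \<open>auto simp: bsym_def\<close>)
  qed
  then show ?thesis by blast
qed

text \<open>A total inverse of \<open>enc_pair\<close>. Malformed codes are decoded in the way in
  which the loop of \<open>parse\<close> treats them, so the projections are computable on all
  words.\<close>

fun unpair :: "bool list \<Rightarrow> bool list \<times> bool list" where
  "unpair (True # b # w) = (b # fst (unpair w), snd (unpair w))"
| "unpair [True] = ([], [])"
| "unpair (False # w) = ([], w)"
| "unpair [] = ([], [])"

definition first :: "bool list \<Rightarrow> bool list" where "first w = fst (unpair w)"
definition second :: "bool list \<Rightarrow> bool list" where "second w = snd (unpair w)"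

lemma unpair_enc_pair: "unpair (enc_pair u v) = (u, v)"
  by (induction u) (simp_all add: enc_pair_def enc_word_pairs pairs_def)

lemma first_enc_pair [simp]: "first (enc_pair u v) = u"
  and second_enc_pair [simp]: "second (enc_pair u v) = v"
  by (simp_all add: first_def second_def unpair_enc_pair)

lemma length_unpair: "length (first w) \<le> length w \<and> length (second w) \<le> length w"
  unfolding first_def second_def by (induction w rule: unpair.induct) auto

definition parse :: "nat \<Rightarrow> nat \<Rightarrow> com" where
  "parse i j = Seq (While i {2} (Seq (pop i) (Cond i {1, 2} (mv i j) skip))) (pop i)"

lemma wdo_parse:
  assumes "i \<in> V" "j \<in> V" "i \<noteq> j"
  shows "wdo V (parse i j) \<sigma> (7 * length (\<sigma> i) + 10)
    (\<sigma>(i := second (\<sigma> i), j := rev (first (\<sigma> i)) @ \<sigma> j))"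
proof -
  let ?B = "Seq (pop i) (Cond i {1, 2} (mv i j) skip)"
  have pop: "wdo V (pop i) \<sigma> 1 (\<sigma>(i := w))" if "\<sigma> i = b # w" for \<sigma> :: "nat \<Rightarrow> bool list" and b w
    using wdo_pop[OF assms(1), of \<sigma>] that by simp
  \<comment> \<open>The loop stops in front of the delimiter, or when the word is exhausted. What is
    left is \<open>u\<close>, and the final \<open>pop\<close> takes the delimiter away.\<close>
  have "\<exists>u. tl u = second w \<and> wdo V (While i {2} ?B) \<sigma> (7 * length w + 8)
      (\<sigma>(i := u, j := rev (first w) @ \<sigma> j))" if "\<sigma> i = w" for w \<sigma>
    using that
  proof (induction w arbitrary: \<sigma> rule: unpair.induct)
    case (1 b w)
    let ?\<sigma> = "\<sigma>(i := w, j := b # \<sigma> j)"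
    have "?\<sigma> i = w" using assms by simp
    from 1(1)[of ?\<sigma>, OF this] obtain u where u: "tl u = second w"
      "wdo V (While i {2} ?B) ?\<sigma> (7 * length w + 8)
      (?\<sigma>(i := u, j := rev (first w) @ ?\<sigma> j))" by blast
    moreover have "?\<sigma>(i := u, j := rev (first w) @ ?\<sigma> j) =
        \<sigma>(i := u, j := rev (first (True # b # w)) @ \<sigma> j)"
      using assms by (auto simp: fun_eq_iff first_def)
    moreover have "wdo V (mv i j) (\<sigma>(i := b # w)) 4 ?\<sigma>"
      using wdo_mv[OF assms, of "\<sigma>(i := b # w)" b w] assms by (simp add: fun_upd_twist)
    then have "wdo V (Cond i {1, 2} (mv i j) skip) (\<sigma>(i := b # w)) 5 ?\<sigma>"
      using assms by (intro wdo_Cond[where n = 4]) (auto simp: bsym_def split: if_splits)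
    then have B: "wdo V ?B \<sigma> 6 ?\<sigma>" by (intro wdo_Seq[OF pop[of \<sigma> True "b # w", OF "1.prems"]]) auto
    ultimately have W: "wdo V (While i {2} ?B) ?\<sigma> (7 * length w + 8)
       (\<sigma>(i := u, j := rev (first (True # b # w)) @ \<sigma> j))" by metis
    have "wdo V (While i {2} ?B) \<sigma> (7 * length (True # b # w) + 8)
       (\<sigma>(i := u, j := rev (first (True # b # w)) @ \<sigma> j))"
      by (rule wdo_WhileT[OF assms(1) _ B W]) (use "1.prems" in auto)
    moreover have "tl u = second (True # b # w)" using u(1) by (simp add: second_def)
    ultimately show ?case by blast
  next
    case 2
    let ?\<sigma> = "\<sigma>(i := [])"
    have "wdo V (Cond i {1, 2} (mv i j) skip) ?\<sigma> 2 ?\<sigma>"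
      using assms by (intro wdo_Cond[where n = 1]) (auto intro: wdo_skip)
    then have B: "wdo V ?B \<sigma> 3 ?\<sigma>" by (intro wdo_Seq[OF pop[of \<sigma> True "[]", OF "2"]]) auto
    have W: "wdo V (While i {2} ?B) ?\<sigma> 1 ?\<sigma>" using assms by (intro wdo_WhileF) auto
    have "wdo V (While i {2} ?B) \<sigma> 15 ?\<sigma>"
      by (rule wdo_WhileT[OF assms(1) _ B W]) (use 2 in auto)
    moreover have "?\<sigma>(j := rev (first [True]) @ \<sigma> j) = ?\<sigma>"
      using assms by (auto simp: first_def)
    ultimately show ?case
      by (intro exI[of _ "[]"] conjI) (simp_all add: second_def del: fun_upd_apply)
  next
    case (3 w)
    have "\<sigma>(i := False # w, j := rev (first (False # w)) @ \<sigma> j) = \<sigma>"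
      using 3 assms by (auto simp: first_def fun_eq_iff)
    moreover have "wdo V (While i {2} ?B) \<sigma> (7 * length (False # w) + 8) \<sigma>"
      using assms 3 by (intro wdo_WhileF) auto
    ultimately show ?case
      by (intro exI[of _ "False # w"] conjI) (simp_all add: second_def del: fun_upd_apply)
  next
    case 4
    have "\<sigma>(i := [], j := rev (first []) @ \<sigma> j) = \<sigma>"
      using 4 assms by (auto simp: first_def fun_eq_iff)
    moreover have "wdo V (While i {2} ?B) \<sigma> (7 * length [] + 8) \<sigma>"
      using assms 4 by (intro wdo_WhileF) auto
    ultimately show ?case
      by (intro exI[of _ "[]"] conjI) (simp_all add: second_def del: fun_upd_apply)
  qed
  from this[OF refl] obtain u where u: "tl u = second (\<sigma> i)"
    "wdo V (While i {2} ?B) \<sigma> (7 * length (\<sigma> i) + 8) (\<sigma>(i := u, j := rev (first (\<sigma> i)) @ \<sigma> j))"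
      by blast
  have "wdo V (pop i) (\<sigma>(i := u, j := rev (first (\<sigma> i)) @ \<sigma> j)) 1
      (\<sigma>(i := second (\<sigma> i), j := rev (first (\<sigma> i)) @ \<sigma> j))"
    using wdo_pop[OF assms(1), of "\<sigma>(i := u, j := rev (first (\<sigma> i)) @ \<sigma> j)"] u(1) assms(3)
    by (simp add: fun_upd_twist)
  then show ?thesis unfolding parse_def by (intro wdo_Seq[OF u(2)]) auto
qed

section \<open>Functions computable in polynomial time\<close>

definition pb :: "(nat \<Rightarrow> nat) \<Rightarrow> bool" where
  "pb f \<longleftrightarrow> (\<exists>p :: nat poly. \<forall>n. f n \<le> poly p n)"

text \<open>Coefficients in \<open>nat\<close> are nonnegative. Monotonicity is what allows a time
  bound to be applied to an upper bound of the length instead of the length itself.\<close>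

lemma poly_nat_mono: "m \<le> n \<Longrightarrow> poly (p :: nat poly) m \<le> poly p n"
  by (induction p) (auto intro: add_mono mult_mono)

lemma pb_poly: "pb (poly p)"
  unfolding pb_def by blast

lemma pb_const: "pb (\<lambda>n. c)"
  unfolding pb_def by (rule exI[of _ "[:c:]"]) simp

lemma pb_id: "pb (\<lambda>n. n)"
  unfolding pb_def by (rule exI[of _ "[:0, 1:]"]) simp

lemma pb_add: "pb f \<Longrightarrow> pb g \<Longrightarrow> pb (\<lambda>n. f n + g n)"
  unfolding pb_def by (elim exE, rule_tac x = "p + pa" in exI) (simp add: add_mono)

lemma pb_mult: "pb f \<Longrightarrow> pb g \<Longrightarrow> pb (\<lambda>n. f n * g n)"
  unfolding pb_def by (elim exE, rule_tac x = "p * pa" in exI) (simp add: mult_mono)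

lemma pb_comp: "pb f \<Longrightarrow> pb g \<Longrightarrow> pb (\<lambda>n. f (g n))"
  unfolding pb_def
proof (elim exE)
  fix p q :: "nat poly" assume "\<forall>n. f n \<le> poly p n" "\<forall>n. g n \<le> poly q n"
  then have "f (g n) \<le> poly (pcompose p q) n" for n
    by (metis poly_nat_mono order_trans poly_pcompose)
  then show "\<exists>p. \<forall>n. f (g n) \<le> poly p n" by blast
qed

lemma pb_poly_comp: "pb g \<Longrightarrow> pb (\<lambda>n. poly p (g n))"
  by (rule pb_comp[OF pb_poly])

lemma pb_Suc: "pb f \<Longrightarrow> pb (\<lambda>n. Suc (f n))"
  using pb_add[OF pb_const[of 1]] by simp

lemmas pb_intros = pb_const pb_id pb_add pb_mult pb_poly pb_poly_comp pb_Suc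

text \<open>Register \<open>d\<close> holds argument and result; the \<open>w\<close> registers
  above it are scratch, empty before and after. Uniformity in \<open>d\<close> allows programs to be
  placed side by side, and \<open>V\<close> may exceed their own registers so that they can be
  combined with others.\<close>

definition computes :: "bool list set \<Rightarrow> (bool list \<Rightarrow> bool list) \<Rightarrow> bool" where
  "computes X F \<longleftrightarrow> (\<exists>P w p. (\<forall>d. wf_com (d + w + 1) 3 (P d)) \<and>
     (\<forall>d V \<sigma>. \<sigma> d \<in> X \<longrightarrow> {d..d + w} \<subseteq> V \<longrightarrow> (\<forall>i\<in>{d<..d + w}. \<sigma> i = []) \<longrightarrow>
        wdo V (P d) \<sigma> (poly p (length (\<sigma> d))) (\<sigma>(d := F (\<sigma> d)))))"

lemma computesI:
  assumes "\<And>d. wf_com (d + w + 1) 3 (P d)" "pb b"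
    "\<And>d V \<sigma>. \<sigma> d \<in> X \<Longrightarrow> {d..d + w} \<subseteq> V \<Longrightarrow> (\<forall>i\<in>{d<..d + w}. \<sigma> i = []) \<Longrightarrow>
        wdo V (P d) \<sigma> (b (length (\<sigma> d))) (\<sigma>(d := F (\<sigma> d)))"
  shows "computes X F"
proof -
  obtain p where p: "\<forall>n. b n \<le> poly p n" using assms(2) by (auto simp: pb_def)
  show ?thesis unfolding computes_def
  proof (intro exI conjI allI impI)
    show "wf_com (d + w + 1) 3 (P d)" for d by (rule assms)
    show "wdo V (P d) \<sigma> (poly p (length (\<sigma> d))) (\<sigma>(d := F (\<sigma> d)))"
      if "\<sigma> d \<in> X" "{d..d + w} \<subseteq> V" "\<forall>i\<in>{d<..d + w}. \<sigma> i = []" for d V \<sigma>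
      by (rule wdo_mono[OF assms(3)[OF that]]) (use p in simp)
  qed
qed

lemma computesE:
  assumes "computes X F"
  obtains P w p where "\<And>d. wf_com (d + w + 1) 3 (P d)"
    "\<And>d V \<sigma>. \<sigma> d \<in> X \<Longrightarrow> {d..d + w} \<subseteq> V \<Longrightarrow> (\<forall>i\<in>{d<..d + w}. \<sigma> i = []) \<Longrightarrow>
        wdo V (P d) \<sigma> (poly p (length (\<sigma> d))) (\<sigma>(d := F (\<sigma> d)))"
  using assms unfolding computes_def by blast

text \<open>A step turns at most one cell of a tape nonblank. Thus a time bound is also a bound on
  the length of the output, which is how bounds are obtained for the second of two composed
  functions.\<close>

lemma run_nonblank:
  assumes "run c S t S'" "finite {j. snd (S i) j \<noteq> 0}"
  shows "finite {j. snd (S' i) j \<noteq> 0} \<and> card {j. snd (S' i) j \<noteq> 0} \<le> card {j. snd (S i) j \<noteq> 0} + t"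
  using assms
proof (induction rule: run.induct)
  case (run_Act f S)
  let ?A = "{j. snd (S i) j \<noteq> 0}" and ?B = "{j. snd (perform (f (scan S)) S i) j \<noteq> 0}"
  have "?B \<subseteq> insert (fst (S i)) ?A" by (auto simp: perform_def)
  then show ?case using run_Act card_mono[of "insert (fst (S i)) ?A" ?B]
    card_insert_le_m1[of "Suc (card ?A)" ?A "fst (S i)"] by (auto intro: finite_subset)
qed auto

lemma nonblank_wtape: "{j. snd (wtape h w) j \<noteq> 0} = {h..<h + int (length w)}"
  by (auto simp: wtape_def word_tape_def split: if_splits)

lemma run_length:
  assumes "run c S t S'" "is_word S i u" "is_word S' i v"
  shows "length v \<le> length u + t"
  using run_nonblank[OF assms(1), of i] assms(2,3)
    by (auto simp: is_word_def nonblank_wtape simp del: neq0_conv)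

lemma computes_length:
  assumes "computes X F"
  obtains p :: "nat poly" where "\<And>x. x \<in> X \<Longrightarrow> length (F x) \<le> poly p (length x)"
proof -
  obtain P w p where P: "\<And>d V \<sigma>. \<sigma> d \<in> X \<Longrightarrow> {d..d + w} \<subseteq> V \<Longrightarrow> (\<forall>i\<in>{d<..d + w}. \<sigma> i = []) \<Longrightarrow>
        wdo V (P d) \<sigma> (poly p (length (\<sigma> d))) (\<sigma>(d := F (\<sigma> d)))"
    using computesE[OF assms] by metis
  have "length (F x) \<le> poly (p + [:0, 1:]) (length x)" if "x \<in> X" for x
  proof -
    let ?\<sigma> = "(\<lambda>_. [])(0 :: nat := x)"
    have "wdo UNIV (P 0) ?\<sigma> (poly p (length (?\<sigma> 0))) (?\<sigma>(0 := F (?\<sigma> 0)))"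
      by (rule P[of ?\<sigma> 0 UNIV]) (use that in auto)
    moreover have "\<forall>i\<in>UNIV. is_word (\<lambda>i. wtape 0 (?\<sigma> i)) i (?\<sigma> i)" by (auto simp: is_word_def)
    ultimately obtain t S' where "t \<le> poly p (length (?\<sigma> 0))" "run (P 0) (\<lambda>i. wtape 0 (?\<sigma> i)) t S'"
      "\<forall>i\<in>UNIV. is_word S' i ((?\<sigma>(0 := F (?\<sigma> 0))) i)" by (rule wdoE)
    moreover have "is_word (\<lambda>i. wtape 0 (?\<sigma> i)) 0 x" by (auto simp: is_word_def)
    moreover have "is_word S' 0 (F x)" using calculation(3) by (metis UNIV_I fun_upd_same)
    ultimately have "length (F x) \<le> length x + t" by (intro run_length)
    then show ?thesis using \<open>t \<le> _\<close> by simp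
  qed
  then show ?thesis by (rule that)
qed

lemma wdo_eq: "wdo V c \<sigma> n \<tau> \<Longrightarrow> \<tau> = \<sigma>' \<Longrightarrow> n \<le> m \<Longrightarrow> wdo V c \<sigma> m \<sigma>'"
  using wdo_mono by blast

lemma wf_push [simp]: "i < K \<Longrightarrow> 3 \<le> A \<Longrightarrow> wf_com K A (push i b)"
  by (auto simp: push_def act1_def bsym_def)

lemma wf_pop [simp]: "i < K \<Longrightarrow> 3 \<le> A \<Longrightarrow> wf_com K A (pop i)"
  by (auto simp: pop_def act1_def)

lemma wf_skip [simp]: "wf_com K A skip"
  by (auto simp: skip_def stay_def)

lemma wf_clear [simp]: "i < K \<Longrightarrow> 3 \<le> A \<Longrightarrow> wf_com K A (clear i)"
  by (simp add: clear_def)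

lemma wf_moves [simp]:
  assumes "i < K" "j < K" "3 \<le> A"
  shows "wf_com K A (mv i j)" "wf_com K A (rmove i j)" "wf_com K A (encmove i j)"
    "wf_com K A (parse i j)"
    "l < K \<Longrightarrow> wf_com K A (dup i j l)"
  using assms by (simp_all add: mv_def rmove_def mv2_def rmove2_def dup_def encmove_def parse_def)

lemma computes_id: "computes X (\<lambda>x. x)"
  by (rule computesI[of 0 "\<lambda>d. skip" "\<lambda>n. 1"], simp, rule pb_const)
    (simp only: fun_upd_triv, rule wdo_skip, rule order_refl)

lemma computes_Nil: "computes X (\<lambda>x. [])"
  by (rule computesI[of 0 clear "\<lambda>n. 2 * n + 1"], simp, intro pb_intros, rule wdo_clear) auto

lemma computes_Cons: "computes X (\<lambda>x. b # x)"
  by (rule computesI[of 0 "\<lambda>d. push d b" "\<lambda>n. 2"], simp, rule pb_const, rule wdo_push) auto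

lemma computes_tl: "computes X tl"
  by (rule computesI[of 0 pop "\<lambda>n. 1"], simp, rule pb_const, rule wdo_pop) auto

lemma computes_comp:
  assumes "computes X F" "computes Y G" "F ` X \<subseteq> Y"
  shows "computes X (\<lambda>x. G (F x))"
proof -
  obtain P w p where P: "\<And>d. wf_com (d + w + 1) 3 (P d)"
    "\<And>d V \<sigma>. \<sigma> d \<in> X \<Longrightarrow> {d..d + w} \<subseteq> V \<Longrightarrow> (\<forall>i\<in>{d<..d + w}. \<sigma> i = []) \<Longrightarrow>
        wdo V (P d) \<sigma> (poly p (length (\<sigma> d))) (\<sigma>(d := F (\<sigma> d)))"
    using computesE[OF assms(1)] by metis
  obtain Q v q where Q: "\<And>d. wf_com (d + v + 1) 3 (Q d)"
    "\<And>d V \<sigma>. \<sigma> d \<in> Y \<Longrightarrow> {d..d + v} \<subseteq> V \<Longrightarrow> (\<forall>i\<in>{d<..d + v}. \<sigma> i = []) \<Longrightarrow>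
        wdo V (Q d) \<sigma> (poly q (length (\<sigma> d))) (\<sigma>(d := G (\<sigma> d)))"
    using computesE[OF assms(2)] by metis
  obtain l where l: "\<And>x. x \<in> X \<Longrightarrow> length (F x) \<le> poly l (length x)"
    using computes_length[OF assms(1)] by metis
  show ?thesis
  proof (rule computesI)
    show "wf_com (d + (w + v) + 1) 3 (Seq (P d) (Q d))" for d
      using P(1)[of d] Q(1)[of d] by (auto elim!: wf_com_mono)
    show "pb (\<lambda>n. poly p n + poly q (poly l n))" by (intro pb_intros)
    fix d V and \<sigma> :: "nat \<Rightarrow> bool list"
    assume x: "\<sigma> d \<in> X" and V: "{d..d + (w + v)} \<subseteq> V" and \<sigma>: "\<forall>i\<in>{d<..d + (w + v)}. \<sigma> i = []"
    have 1: "wdo V (P d) \<sigma> (poly p (length (\<sigma> d))) (\<sigma>(d := F (\<sigma> d)))"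
      using x assms(3) V \<sigma> by (intro P(2)) auto
    let ?\<sigma> = "\<sigma>(d := F (\<sigma> d))"
    have "wdo V (Q d) ?\<sigma> (poly q (length (?\<sigma> d))) (?\<sigma>(d := G (?\<sigma> d)))"
      using x assms(3) V \<sigma> by (intro Q(2)) auto
    then have 2: "wdo V (Q d) ?\<sigma> (poly q (poly l (length (\<sigma> d)))) (\<sigma>(d := G (F (\<sigma> d))))"
      by (rule wdo_eq) (use l[OF x] poly_nat_mono in auto)
    show "wdo V (Seq (P d) (Q d)) \<sigma> (poly p (length (\<sigma> d)) + poly q (poly l (length (\<sigma> d))))
        (\<sigma>(d := G (F (\<sigma> d))))" by (rule wdo_Seq[OF 1 2]) simp
  qed
qed

text \<open>The condition is evaluated on a copy above the argument, so that the argument survives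
  for the branch.\<close>

lemma computes_cond:
  assumes "computes X C" "computes X F" "computes X G"
  shows "computes X (\<lambda>x. if C x \<noteq> [] \<and> hd (C x) then F x else G x)"
proof -
  obtain P w p where P: "\<And>d. wf_com (d + w + 1) 3 (P d)"
    "\<And>d V \<sigma>. \<sigma> d \<in> X \<Longrightarrow> {d..d + w} \<subseteq> V \<Longrightarrow> (\<forall>i\<in>{d<..d + w}. \<sigma> i = []) \<Longrightarrow>
        wdo V (P d) \<sigma> (poly p (length (\<sigma> d))) (\<sigma>(d := F (\<sigma> d)))"
    using computesE[OF assms(2)] by metis
  obtain Q v q where Q: "\<And>d. wf_com (d + v + 1) 3 (Q d)"
    "\<And>d V \<sigma>. \<sigma> d \<in> X \<Longrightarrow> {d..d + v} \<subseteq> V \<Longrightarrow> (\<forall>i\<in>{d<..d + v}. \<sigma> i = []) \<Longrightarrow>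
        wdo V (Q d) \<sigma> (poly q (length (\<sigma> d))) (\<sigma>(d := G (\<sigma> d)))"
    using computesE[OF assms(3)] by metis
  obtain R u r where R: "\<And>d. wf_com (d + u + 1) 3 (R d)"
    "\<And>d V \<sigma>. \<sigma> d \<in> X \<Longrightarrow> {d..d + u} \<subseteq> V \<Longrightarrow> (\<forall>i\<in>{d<..d + u}. \<sigma> i = []) \<Longrightarrow>
        wdo V (R d) \<sigma> (poly r (length (\<sigma> d))) (\<sigma>(d := C (\<sigma> d)))"
    using computesE[OF assms(1)] by metis
  obtain l where l: "\<And>x. x \<in> X \<Longrightarrow> length (C x) \<le> poly l (length x)"
    using computes_length[OF assms(1)] by metis
  let ?w = "w + v + u + 2"
  let ?T = "\<lambda>d. Cond (d+1) {2} (Seq (clear (d+1)) (P d)) (Seq (clear (d+1)) (Q d))"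
  let ?b = "\<lambda>n. 13 * n + 2 + (poly r n + (2 * poly l n + 2 + poly p n + poly q n))"
  show ?thesis
  proof (rule computesI)
    show "wf_com (d + ?w + 1) 3 (Seq (dup d (d+1) (d+2)) (Seq (R (d+1)) (?T d)))" for d
      using P(1)[of d] Q(1)[of d] R(1)[of "d+1"] by (auto elim!: wf_com_mono)
    show "pb ?b" by (intro pb_intros)
    fix d V and \<sigma> :: "nat \<Rightarrow> bool list"
    assume x: "\<sigma> d \<in> X" and V: "{d..d + ?w} \<subseteq> V" and \<sigma>: "\<forall>i\<in>{d<..d + ?w}. \<sigma> i = []"
    let ?x = "\<sigma> d"
    let ?n = "length ?x"
    let ?\<sigma>1 = "\<sigma>(d+1 := ?x)"
    let ?\<sigma>2 = "\<sigma>(d+1 := C ?x)"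
    let ?r = "if C ?x \<noteq> [] \<and> hd (C ?x) then F ?x else G ?x"
    have 1: "wdo V (dup d (d+1) (d+2)) \<sigma> (13 * ?n + 2) ?\<sigma>1"
      by (rule wdo_dup) (use x V \<sigma> in auto)
    have 2: "wdo V (R (d+1)) ?\<sigma>1 (poly r ?n) ?\<sigma>2"
      by (rule wdo_eq[OF R(2)]) (use x V \<sigma> in \<open>auto simp: fun_eq_iff\<close>)
    have c: "wdo V (clear (d+1)) ?\<sigma>2 (2 * poly l ?n + 1) \<sigma>"
      by (rule wdo_eq[OF wdo_clear]) (use x V \<sigma> l[OF x] in \<open>auto simp: fun_eq_iff\<close>)
    have p: "wdo V (P d) \<sigma> (poly p ?n) (\<sigma>(d := F ?x))" by (rule P(2)) (use x V \<sigma> in auto)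
    have q: "wdo V (Q d) \<sigma> (poly q ?n) (\<sigma>(d := G ?x))" by (rule Q(2)) (use x V \<sigma> in auto)
    have sy: "sym (?\<sigma>2 (d+1)) \<in> {2} \<longleftrightarrow> C ?x \<noteq> [] \<and> hd (C ?x)"
      by (cases "C ?x") (auto simp: bsym_def)
    have 3: "wdo V (?T d) ?\<sigma>2 (2 * poly l ?n + 2 + poly p ?n + poly q ?n) (\<sigma>(d := ?r))"
    proof (rule wdo_Cond[where n = "2 * poly l ?n + 1 + poly p ?n + poly q ?n"])
      show "d + 1 \<in> V" using V by auto
      show "wdo V (Seq (clear (d+1)) (P d)) ?\<sigma>2 (2 * poly l ?n + 1 + poly p ?n + poly q ?n)
        (\<sigma>(d := ?r))"
        if "sym (?\<sigma>2 (d+1)) \<in> {2}"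
      proof -
        have "?r = F ?x" using that[unfolded sy] by simp
        then show ?thesis by (simp only:) (rule wdo_Seq[OF c p], simp)
      qed
      show "wdo V (Seq (clear (d+1)) (Q d)) ?\<sigma>2 (2 * poly l ?n + 1 + poly p ?n + poly q ?n)
        (\<sigma>(d := ?r))"
        if "sym (?\<sigma>2 (d+1)) \<notin> {2}"
      proof -
        have "?r = G ?x" using that[unfolded sy] by auto
        then show ?thesis by (simp only:) (rule wdo_Seq[OF c q], simp)
      qed
    qed simp
    show "wdo V (Seq (dup d (d+1) (d+2)) (Seq (R (d+1)) (?T d))) \<sigma> (?b ?n) (\<sigma>(d := ?r))"
      by (rule wdo_Seq[OF 1 wdo_Seq[OF 2 3 order_refl]]) simp
  qed
qed

text \<open>Both functions run on copies. Since words grow at the front, the second component is put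
  in place before the code of the first is pushed on top of it.\<close>

lemma computes_pair:
  assumes "computes X F" "computes X G"
  shows "computes X (\<lambda>x. enc_pair (F x) (G x))"
proof -
  obtain P w p where P: "\<And>d. wf_com (d + w + 1) 3 (P d)"
    "\<And>d V \<sigma>. \<sigma> d \<in> X \<Longrightarrow> {d..d + w} \<subseteq> V \<Longrightarrow> (\<forall>i\<in>{d<..d + w}. \<sigma> i = []) \<Longrightarrow>
        wdo V (P d) \<sigma> (poly p (length (\<sigma> d))) (\<sigma>(d := F (\<sigma> d)))"
    using computesE[OF assms(1)] by metis
  obtain Q v q where Q: "\<And>d. wf_com (d + v + 1) 3 (Q d)"
    "\<And>d V \<sigma>. \<sigma> d \<in> X \<Longrightarrow> {d..d + v} \<subseteq> V \<Longrightarrow> (\<forall>i\<in>{d<..d + v}. \<sigma> i = []) \<Longrightarrow>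
        wdo V (Q d) \<sigma> (poly q (length (\<sigma> d))) (\<sigma>(d := G (\<sigma> d)))"
    using computesE[OF assms(2)] by metis
  obtain l where l: "\<And>x. x \<in> X \<Longrightarrow> length (F x) \<le> poly l (length x)"
    using computes_length[OF assms(1)] by metis
  obtain m where m: "\<And>x. x \<in> X \<Longrightarrow> length (G x) \<le> poly m (length x)"
    using computes_length[OF assms(2)] by metis
  let ?w = "w + v + 3"
  let ?P = "\<lambda>d. Seq (dup d (d+1) (d+2)) (Seq (Q (d+1)) (Seq (dup d (d+2) (d+3)) (Seq (P (d+2))
    (Seq (clear d) (Seq (rmove (d+1) (d+3)) (Seq (rmove (d+3) d) (Seq (rmove (d+2) (d+1))
    (Seq (push d False) (encmove (d+1) d)))))))))"
  let ?b = "\<lambda>n. 13 * n + 2 + (poly q n + (13 * n + 2 + (poly p n + (2 * n + 1 + (5 * poly m n + 1 +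
    (5 * poly m n + 1 + (5 * poly l n + 1 + (2 + (7 * poly l n + 1)))))))))"
  show ?thesis
  proof (rule computesI)
    show "wf_com (d + ?w + 1) 3 (?P d)" for d
      using P(1)[of "d+2"] Q(1)[of "d+1"] by (auto elim!: wf_com_mono)
    show "pb ?b" by (intro pb_intros)
    fix d V and \<sigma> :: "nat \<Rightarrow> bool list"
    assume x: "\<sigma> d \<in> X" and V: "{d..d + ?w} \<subseteq> V" and \<sigma>: "\<forall>i\<in>{d<..d + ?w}. \<sigma> i = []"
    have V': "d \<in> V" "d+1 \<in> V" "d+2 \<in> V" "d+3 \<in> V" using V by auto
    have \<sigma>': "\<sigma> (d+1) = []" "\<sigma> (d+2) = []" "\<sigma> (d+3) = []" using \<sigma> by auto
    let ?x = "\<sigma> d"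
    let ?n = "length ?x"
    let ?A = "F ?x" and ?B = "G ?x"
    note eq = fun_eq_iff
    have 1: "wdo V (dup d (d+1) (d+2)) \<sigma> (13 * ?n + 2) (\<sigma>(d+1 := ?x))"
      by (rule wdo_dup) (use x V' \<sigma>' in auto)
    have 2: "wdo V (Q (d+1)) (\<sigma>(d+1 := ?x)) (poly q ?n) (\<sigma>(d+1 := ?B))"
      by (rule wdo_eq[OF Q(2)]) (use x V \<sigma> in \<open>auto simp: eq\<close>)
    have 3: "wdo V (dup d (d+2) (d+3)) (\<sigma>(d+1 := ?B)) (13 * ?n + 2) (\<sigma>(d+1 := ?B, d+2 := ?x))"
      by (rule wdo_eq[OF wdo_dup]) (use x V' \<sigma>' in \<open>auto simp: eq\<close>)
    have 4: "wdo V (P (d+2)) (\<sigma>(d+1 := ?B, d+2 := ?x)) (poly p ?n) (\<sigma>(d+1 := ?B, d+2 := ?A))"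
      by (rule wdo_eq[OF P(2)]) (use x V \<sigma> in \<open>auto simp: eq\<close>)
    have 5: "wdo V (clear d) (\<sigma>(d+1 := ?B, d+2 := ?A)) (2 * ?n + 1)
      (\<sigma>(d := [], d+1 := ?B, d+2 := ?A))"
      by (rule wdo_eq[OF wdo_clear]) (use x V' in \<open>auto simp: eq\<close>)
    have 6: "wdo V (rmove (d+1) (d+3)) (\<sigma>(d := [], d+1 := ?B, d+2 := ?A)) (5 * poly m ?n + 1)
        (\<sigma>(d := [], d+2 := ?A, d+3 := rev ?B))"
      by (rule wdo_eq[OF wdo_rmove]) (use x V' \<sigma>' m[OF x] in \<open>auto simp: eq\<close>)
    have 7: "wdo V (rmove (d+3) d) (\<sigma>(d := [], d+2 := ?A, d+3 := rev ?B)) (5 * poly m ?n + 1)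
        (\<sigma>(d := ?B, d+2 := ?A))"
      by (rule wdo_eq[OF wdo_rmove]) (use x V' \<sigma>' m[OF x] in \<open>auto simp: eq\<close>)
    have 8: "wdo V (rmove (d+2) (d+1)) (\<sigma>(d := ?B, d+2 := ?A)) (5 * poly l ?n + 1)
        (\<sigma>(d := ?B, d+1 := rev ?A))"
      by (rule wdo_eq[OF wdo_rmove]) (use x V' \<sigma>' l[OF x] in \<open>auto simp: eq\<close>)
    have 9: "wdo V (push d False) (\<sigma>(d := ?B, d+1 := rev ?A)) 2 (\<sigma>(d := False # ?B, d+1 := rev ?A))"
      by (rule wdo_eq[OF wdo_push]) (use x V' in \<open>auto simp: eq\<close>)
    have 10: "wdo V (encmove (d+1) d) (\<sigma>(d := False # ?B, d+1 := rev ?A)) (7 * poly l ?n + 1)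
        (\<sigma>(d := enc_pair ?A ?B))"
      by (rule wdo_eq[OF wdo_encmove]) (use x V' \<sigma>' l[OF x] in \<open>auto simp: eq enc_pair_def
        enc_word_pairs\<close>)
    show "wdo V (?P d) \<sigma> (?b ?n) (\<sigma>(d := enc_pair ?A ?B))"
      by (rule wdo_Seq[OF 1 wdo_Seq[OF 2 wdo_Seq[OF 3 wdo_Seq[OF 4 wdo_Seq[OF 5 wdo_Seq[OF 6
            wdo_Seq[OF 7 wdo_Seq[OF 8 wdo_Seq[OF 9 10]]]]]]]]]) (rule order_refl)+
  qed
qed

lemma computes_parse:
  shows computes_first: "computes X first" and computes_second: "computes X second"
    and computes_append: "computes X (\<lambda>x. first x @ second x)"
proof -
  have V': "d \<in> V" "d+1 \<in> V" if "{d..d + 1} \<subseteq> V" for V and d :: nat using that by auto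
  have len: "length (first x) \<le> length x" "length (second x) \<le> length x" for x
    using length_unpair by auto
  have parse: "wdo V (parse d (d+1)) \<sigma> (7 * length (\<sigma> d) + 10)
      (\<sigma>(d := second (\<sigma> d), d+1 := rev (first (\<sigma> d))))"
    if "{d..d + 1} \<subseteq> V" "\<forall>i\<in>{d<..d + 1}. \<sigma> i = []" for d V \<sigma>
    by (rule wdo_eq[OF wdo_parse]) (use V'[OF that(1)] that in \<open>auto simp: fun_eq_iff\<close>)
  show "computes X first"
  proof (rule computesI)
    let ?P = "\<lambda>d. Seq (parse d (d+1)) (Seq (clear d) (rmove (d+1) d))"
    let ?b = "\<lambda>n. 7 * n + 10 + (2 * n + 1 + (5 * n + 1))"
    show "wf_com (d + 1 + 1) 3 (?P d)" for d by auto
    show "pb ?b" by (intro pb_intros)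
    fix d V and \<sigma> :: "nat \<Rightarrow> bool list"
    assume x: "\<sigma> d \<in> X" and V: "{d..d + 1} \<subseteq> V" and \<sigma>: "\<forall>i\<in>{d<..d + 1}. \<sigma> i = []"
    let ?x = "\<sigma> d"
    have 2: "wdo V (clear d) (\<sigma>(d := second ?x, d+1 := rev (first ?x))) (2 * length ?x + 1)
        (\<sigma>(d := [], d+1 := rev (first ?x)))"
      by (rule wdo_eq[OF wdo_clear]) (use x V'[OF V] len in \<open>auto simp: fun_eq_iff\<close>)
    have 3: "wdo V (rmove (d+1) d) (\<sigma>(d := [], d+1 := rev (first ?x))) (5 * length ?x + 1)
        (\<sigma>(d := first ?x))"
      by (rule wdo_eq[OF wdo_rmove]) (use x V'[OF V] \<sigma> len in \<open>auto simp: fun_eq_iff\<close>)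
    show "wdo V (?P d) \<sigma> (?b (length ?x)) (\<sigma>(d := first ?x))"
      by (rule wdo_Seq[OF parse[OF V \<sigma>] wdo_Seq[OF 2 3]]) (rule order_refl)+
  qed
  show "computes X second"
  proof (rule computesI)
    let ?P = "\<lambda>d. Seq (parse d (d+1)) (clear (d+1))"
    let ?b = "\<lambda>n. 7 * n + 10 + (2 * n + 1)"
    show "wf_com (d + 1 + 1) 3 (?P d)" for d by auto
    show "pb ?b" by (intro pb_intros)
    fix d V and \<sigma> :: "nat \<Rightarrow> bool list"
    assume x: "\<sigma> d \<in> X" and V: "{d..d + 1} \<subseteq> V" and \<sigma>: "\<forall>i\<in>{d<..d + 1}. \<sigma> i = []"
    let ?x = "\<sigma> d"
    have 2: "wdo V (clear (d+1)) (\<sigma>(d := second ?x, d+1 := rev (first ?x))) (2 * length ?x + 1)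
        (\<sigma>(d := second ?x))"
      by (rule wdo_eq[OF wdo_clear]) (use x V'[OF V] \<sigma> len in \<open>auto simp: fun_eq_iff\<close>)
    show "wdo V (?P d) \<sigma> (?b (length ?x)) (\<sigma>(d := second ?x))"
      by (rule wdo_Seq[OF parse[OF V \<sigma>] 2]) (rule order_refl)+
  qed
  show "computes X (\<lambda>x. first x @ second x)"
  proof (rule computesI)
    let ?P = "\<lambda>d. Seq (parse d (d+1)) (rmove (d+1) d)"
    let ?b = "\<lambda>n. 7 * n + 10 + (5 * n + 1)"
    show "wf_com (d + 1 + 1) 3 (?P d)" for d by auto
    show "pb ?b" by (intro pb_intros)
    fix d V and \<sigma> :: "nat \<Rightarrow> bool list"
    assume x: "\<sigma> d \<in> X" and V: "{d..d + 1} \<subseteq> V" and \<sigma>: "\<forall>i\<in>{d<..d + 1}. \<sigma> i = []"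
    let ?x = "\<sigma> d"
    have 2: "wdo V (rmove (d+1) d) (\<sigma>(d := second ?x, d+1 := rev (first ?x))) (5 * length ?x + 1)
        (\<sigma>(d := first ?x @ second ?x))"
      by (rule wdo_eq[OF wdo_rmove]) (use x V'[OF V] \<sigma> len in \<open>auto simp: fun_eq_iff\<close>)
    show "wdo V (?P d) \<sigma> (?b (length ?x)) (\<sigma>(d := first ?x @ second ?x))"
      by (rule wdo_Seq[OF parse[OF V \<sigma>] 2]) (rule order_refl)+
  qed
qed

text \<open>The first component of the pair is a unary counter. The bound on all iterates is
  essential: a repeated polynomial-time function, such as doubling a word, may grow
  exponentially.\<close>

lemma computes_funpow:
  assumes "computes Y G"
    and size: "\<And>x i. x \<in> X \<Longrightarrow> i \<le> length (first x) \<Longrightarrow>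
      length ((G ^^ i) (second x)) \<le> poly q (length x)"
    and dom: "\<And>x i. x \<in> X \<Longrightarrow> i < length (first x) \<Longrightarrow> (G ^^ i) (second x) \<in> Y"
  shows "computes X (\<lambda>x. (G ^^ length (first x)) (second x))"
proof -
  obtain P w p where P: "\<And>d. wf_com (d + w + 1) 3 (P d)"
    "\<And>d V \<sigma>. \<sigma> d \<in> Y \<Longrightarrow> {d..d + w} \<subseteq> V \<Longrightarrow> (\<forall>i\<in>{d<..d + w}. \<sigma> i = []) \<Longrightarrow>
        wdo V (P d) \<sigma> (poly p (length (\<sigma> d))) (\<sigma>(d := G (\<sigma> d)))"
    using computesE[OF assms(1)] by metis
  have len: "length (first x) \<le> length x" "length (second x) \<le> length x" for x
    using length_unpair by auto
  let ?w = "w + 2"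
  let ?B = "\<lambda>d. Seq (pop d) (P (d+1))"
  let ?P = "\<lambda>d. Seq (parse d (d+1)) (Seq (rmove d (d+2))
    (Seq (rmove (d+1) d) (Seq (rmove (d+2) (d+1))
    (Seq (While d {1, 2} (?B d)) (Seq (rmove (d+1) (d+2)) (rmove (d+2) d))))))"
  let ?b = "\<lambda>n. 7 * n + 10 + (5 * n + 1 + (5 * n + 1 + (5 * n + 1 +
    (n * (poly p (poly q n) + 2) + 1 + (5 * poly q n + 1 + (5 * poly q n + 1))))))"
  show ?thesis
  proof (rule computesI)
    show "wf_com (d + ?w + 1) 3 (?P d)" for d
      using P(1)[of "d+1"] by (auto elim!: wf_com_mono)
    show "pb ?b" by (intro pb_intros)
    fix d V and \<sigma> :: "nat \<Rightarrow> bool list"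
    assume x: "\<sigma> d \<in> X" and V: "{d..d + ?w} \<subseteq> V" and \<sigma>: "\<forall>i\<in>{d<..d + ?w}. \<sigma> i = []"
    have V': "d \<in> V" "d+1 \<in> V" "d+2 \<in> V" using V by auto
    have \<sigma>': "\<sigma> (d+1) = []" "\<sigma> (d+2) = []" using \<sigma> by auto
    have loop: "wdo V (While d {1, 2} (?B d)) (\<sigma>(d := u, d+1 := a)) (length u * (M + 2) + 1)
        (\<sigma>(d := [], d+1 := (G ^^ length u) a))"
      if "\<forall>i<length u. (G ^^ i) a \<in> Y \<and> poly p (length ((G ^^ i) a)) \<le> M" for M u a
      using that
    proof (induction u arbitrary: a)
      case Nil
      show ?case by (rule wdo_eq[OF wdo_WhileF]) (use V' in auto)
    next
      case (Cons b u)
      have 1: "wdo V (pop d) (\<sigma>(d := b # u, d+1 := a)) 1 (\<sigma>(d := u, d+1 := a))"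
        by (rule wdo_eq[OF wdo_pop]) (use V' in \<open>auto simp: fun_eq_iff\<close>)
      have 2: "wdo V (P (d+1)) (\<sigma>(d := u, d+1 := a)) M (\<sigma>(d := u, d+1 := G a))"
        by (rule wdo_eq[OF P(2)]) (use V \<sigma> Cons.prems in \<open>auto simp: fun_eq_iff\<close>)
      have 3: "wdo V (While d {1, 2} (?B d)) (\<sigma>(d := u, d+1 := G a)) (length u * (M + 2) + 1)
          (\<sigma>(d := [], d+1 := (G ^^ length (b # u)) a))"
      proof -
        have "(G ^^ i) (G a) \<in> Y \<and> poly p (length ((G ^^ i) (G a))) \<le> M" if "i < length u" for i
          using Cons.prems[rule_format, of "Suc i"] that by (simp add: funpow_swap1)
        then show ?thesis using Cons.IH[of "G a"]
          by (simp add: funpow_swap1 del: fun_upd_apply)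
      qed
      show ?case
        by (rule wdo_WhileT[OF V'(1) _ wdo_Seq[OF 1 2 order_refl] 3]) (auto simp: bsym_def)
    qed
    let ?x = "\<sigma> d"
    let ?n = "length ?x"
    let ?u = "first ?x" and ?a = "second ?x"
    let ?r = "(G ^^ length ?u) ?a"
    note eq = fun_eq_iff
    have 1: "wdo V (parse d (d+1)) \<sigma> (7 * ?n + 10) (\<sigma>(d := ?a, d+1 := rev ?u))"
      by (rule wdo_eq[OF wdo_parse]) (use V' \<sigma>' in \<open>auto simp: eq\<close>)
    have 2: "wdo V (rmove d (d+2)) (\<sigma>(d := ?a, d+1 := rev ?u)) (5 * ?n + 1)
       (\<sigma>(d := [], d+1 := rev ?u, d+2 := rev ?a))"
      by (rule wdo_eq[OF wdo_rmove]) (use V' \<sigma>' len in \<open>auto simp: eq\<close>)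
    have 3: "wdo V (rmove (d+1) d) (\<sigma>(d := [], d+1 := rev ?u, d+2 := rev ?a)) (5 * ?n + 1)
       (\<sigma>(d := ?u, d+2 := rev ?a))"
      by (rule wdo_eq[OF wdo_rmove]) (use V' \<sigma>' len in \<open>auto simp: eq\<close>)
    have 4: "wdo V (rmove (d+2) (d+1)) (\<sigma>(d := ?u, d+2 := rev ?a)) (5 * ?n + 1)
      (\<sigma>(d := ?u, d+1 := ?a))"
      by (rule wdo_eq[OF wdo_rmove]) (use V' \<sigma>' len in \<open>auto simp: eq\<close>)
    have "\<forall>i<length ?u. (G ^^ i) ?a \<in> Y \<and> poly p (length ((G ^^ i) ?a)) \<le> poly p (poly q ?n)"
      using dom[OF x] size[OF x] poly_nat_mono by auto
    from loop[OF this]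
    have 5: "wdo V (While d {1, 2} (?B d)) (\<sigma>(d := ?u, d+1 := ?a))
      (?n * (poly p (poly q ?n) + 2) + 1)
        (\<sigma>(d := [], d+1 := ?r))"
      by (rule wdo_mono) (intro add_mono mult_mono len order_refl; simp)
    have 6: "wdo V (rmove (d+1) (d+2)) (\<sigma>(d := [], d+1 := ?r)) (5 * poly q ?n + 1)
      (\<sigma>(d := [], d+2 := rev ?r))"
      by (rule wdo_eq[OF wdo_rmove]) (use V' \<sigma>' size[OF x] in \<open>auto simp: eq\<close>)
    have 7: "wdo V (rmove (d+2) d) (\<sigma>(d := [], d+2 := rev ?r)) (5 * poly q ?n + 1) (\<sigma>(d := ?r))"
      by (rule wdo_eq[OF wdo_rmove]) (use V' \<sigma>' size[OF x] in \<open>auto simp: eq\<close>)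
    show "wdo V (?P d) \<sigma> (?b ?n) (\<sigma>(d := ?r))"
      by (rule wdo_Seq[OF 1 wdo_Seq[OF 2 wdo_Seq[OF 3 wdo_Seq[OF 4 wdo_Seq[OF 5
            wdo_Seq[OF 6 7]]]]]]) (rule order_refl)+
  qed
qed

section \<open>Turing machines as subroutines\<close>

text \<open>The displacement is normalised to 1 or -1, which makes the command well-formed for every
  \<open>s\<close>.\<close>

definition act2 :: "nat \<Rightarrow> nat \<Rightarrow> int \<Rightarrow> com" where
  "act2 i j s = Act (\<lambda>r l. if l = i \<or> l = j then (r l, if s = 1 then 1 else - 1) else (r l, 0))"

text \<open>In contrast to \<open>rmove\<close>, a single pass preserves the order, and both heads
  return to the cells where they started. This is how a word gets to a prescribed cell.\<close>

definition transfer :: "nat \<Rightarrow> nat \<Rightarrow> com" where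
  "transfer i j =
     Seq (While i {1, 2} (Act (\<lambda>r l. if l = i then (0, 1)
            else if l = j then (if r i = 2 then 2 else 1, 1) else (r l, 0))))
    (Seq (act2 i j (- 1)) (Seq (While j {1, 2} (act2 i j (- 1))) (act2 i j 1)))"

lemma wf_transfer [simp]: "i < K \<Longrightarrow> j < K \<Longrightarrow> 3 \<le> A \<Longrightarrow> wf_com K A (transfer i j)"
  by (auto simp: transfer_def act2_def)

lemma run_act2:
  assumes "i \<noteq> j" "s \<in> {1, - 1}"
  shows "run (act2 i j s) (S(i := (h, c), j := (g, e))) 1 (S(i := (h + s, c), j := (g + s, e)))"
proof -
  let ?f = "\<lambda>r l. if l = i \<or> l = j then (r l, if s = 1 then 1 else - 1) else (r l, 0)"
  let ?S = "S(i := (h, c), j := (g, e))"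
  have "perform (?f (scan ?S)) ?S = S(i := (h + s, c), j := (g + s, e))"
    using assms by (auto simp: perform_def scan_def fun_eq_iff)
  then show ?thesis unfolding act2_def using run_Act[of ?f ?S] by simp
qed

lemma word_tape_take_Suc:
  assumes "n < length y"
  shows "word_tape (take (Suc n) y) i = (if i = int n then bsym (y ! n)
    else word_tape (take n y) i)"
  using assms by (auto simp: word_tape_def bsym_def)

text \<open>About the source only the cells of \<open>y\<close> and the blank behind it are known,
  as for the first tape of a machine that has halted with output \<open>y\<close>; whatever lies
  further out stays there.\<close>

lemma run_transfer:
  assumes "i \<noteq> j" "S i = (h, c)" "S j = (g, \<lambda>_. 0)"
    and y: "\<And>n. n < length y \<Longrightarrow> c (h + int n) = bsym (y ! n)" "c (h + int (length y)) = 0"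
  shows "run (transfer i j) S (4 * length y + 4)
    (S(i := (h, \<lambda>m. if h \<le> m \<and> m < h + int (length y) then 0 else c m), j := wtape g y))"
proof -
  define C where "C n = (\<lambda>m. if h \<le> m \<and> m < h + int n then 0 else c m)" for n
  define E where "E n = (\<lambda>m. word_tape (take n y) (m - g))" for n
  let ?f = "\<lambda>r l. if l = i then (0, 1 :: int)
            else if l = j then (if r i = 2 then 2 else 1, 1) else (r l, 0 :: int)"
  let ?W = "While i {1, 2} (Act ?f)"
  define St where "St n = S(i := (h + int n, C n), j := (g + int n, E n))" for n
  have C_Suc: "C (Suc n) = (C n)(h + int n := 0)" for n
    by (auto simp: C_def fun_eq_iff)
  have E_Suc: "E (Suc n) = (E n)(g + int n := bsym (y ! n))" if "n < length y" for n
    using word_tape_take_Suc[OF that] by (auto simp: E_def fun_eq_iff)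
  have step: "run (Act ?f) (St n) 1 (St (Suc n))" "scan (St n) i \<in> {1, 2}" if "n < length y" for n
  proof -
    have sc: "scan (St n) i = bsym (y ! n)"
      using y(1)[OF that] assms(1) by (simp add: St_def scan_def C_def)
    then show "scan (St n) i \<in> {1, 2}" by (simp add: bsym_def)
    have "perform (?f (scan (St n))) (St n) = St (Suc n)"
    proof
      fix l
      consider "l = i" | "l = j" | "l \<noteq> i" "l \<noteq> j" by blast
      then show "perform (?f (scan (St n))) (St n) l = St (Suc n) l"
      proof cases
        case 1
        then show ?thesis using assms(1) by (simp add: perform_def St_def C_Suc algebra_simps)
      next
        case 2
        then show ?thesis using assms(1) sc E_Suc[OF that]
          by (simp add: perform_def St_def algebra_simps bsym_def)
      next
        case 3
        then show ?thesis by (simp add: perform_def St_def scan_def)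
      qed
    qed
    then show "run (Act ?f) (St n) 1 (St (Suc n))" using run_Act[of ?f "St n"] by simp
  qed
  have W: "run ?W (St n) (2 * (length y - n) + 1) (St (length y))" if "n \<le> length y" for n
    using that
  proof (induction "length y - n" arbitrary: n)
    case 0
    then have [simp]: "n = length y" by simp
    have "scan (St n) i \<notin> {1, 2}" using y(2) assms(1) by (simp add: St_def scan_def C_def)
    then show ?case using run_WhileF[of "St n" i "{1, 2}"] by simp
  next
    case (Suc k)
    then have n: "n < length y" by simp
    have "run ?W (St (Suc n)) (2 * (length y - Suc n) + 1) (St (length y))"
      using Suc by (intro Suc.hyps(1)) auto
    from run_WhileT[OF step(2)[OF n] step(1)[OF n] this]
    have "run ?W (St n) (Suc (1 + (2 * (length y - Suc n) + 1))) (St (length y))" .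
    moreover have "Suc (1 + (2 * (length y - Suc n) + 1)) = 2 * (length y - n) + 1" using n by simp
    ultimately show ?case by metis
  qed
  have "St 0 = S" using assms by (auto simp: St_def C_def E_def fun_eq_iff)
  then have 1: "run ?W S (2 * length y + 1) (St (length y))" using W[of 0] by simp
  \<comment> \<open>The heads on the way back, just to the left of letter \<open>n\<close>. In
    \<open>Bk 0\<close> the target shows the blank in front of its word, which ends the loop; one
    more step to the right completes the return.\<close>
  define Bk where "Bk n = S(i := (h + int n - 1, C (length y)), j :=
    (g + int n - 1, E (length y)))" for n
  have 2: "run (act2 i j (- 1)) (St (length y)) 1 (Bk (length y))"
    using run_act2[OF assms(1), of "- 1" S "h + int (length y)" "C (length y)"
      "g + int (length y)" "E (length y)"]
    by (simp add: St_def Bk_def)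
  have 3: "run (While j {1, 2} (act2 i j (- 1))) (Bk n) (2 * n + 1) (Bk 0)" if "n \<le> length y" for n
    using that
  proof (induction n)
    case 0
    have "scan (Bk 0) j \<notin> {1, 2}" by (simp add: Bk_def scan_def E_def)
    then show ?case using run_WhileF[of "Bk 0" j "{1, 2}"] by simp
  next
    case (Suc n)
    have "scan (Bk (Suc n)) j = bsym (y ! n)"
      using Suc.prems by (simp add: Bk_def scan_def E_def word_tape_def bsym_def)
    then have sc: "scan (Bk (Suc n)) j \<in> {1, 2}" by (simp add: bsym_def)
    have "run (act2 i j (- 1)) (Bk (Suc n)) 1 (Bk n)"
      using run_act2[OF assms(1), of "- 1" S "h + int n" "C (length y)" "g + int n" "E (length y)"]
      by (simp add: Bk_def)
    from run_WhileT[OF sc this Suc.IH] show ?case using Suc.prems by simp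
  qed
  have 4: "run (act2 i j 1) (Bk 0) 1 (S(i := (h, C (length y)), j := (g, E (length y))))"
    using run_act2[OF assms(1), of 1 S "h - 1" "C (length y)" "g - 1" "E (length y)"]
    by (simp add: Bk_def)
  have "run (transfer i j) S (2 * length y + 1 + (1 + (2 * length y + 1 + 1)))
      (S(i := (h, C (length y)), j := (g, E (length y))))"
    unfolding transfer_def by (rule run_Seq[OF 1 run_Seq[OF 2 run_Seq[OF 3[OF order_refl] 4]]])
  moreover have "2 * length y + 1 + (1 + (2 * length y + 1 + 1)) = 4 * length y + 4" by simp
  ultimately show ?thesis by (simp only: C_def E_def wtape_def take_all order_refl)
qed

lemma run_transfer_word:
  assumes "i \<noteq> j" "is_word S i y" "is_word S j []"
  obtains S' where "run (transfer i j) S (4 * length y + 4) S'" "is_word S' i []" "is_word S' j y"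
    "\<And>l. l \<noteq> i \<Longrightarrow> l \<noteq> j \<Longrightarrow> S' l = S l"
proof -
  obtain h g where hg: "S i = (h, \<lambda>m. word_tape y (m - h))" "S j = (g, \<lambda>_. 0)"
    using assms(2,3) by (auto simp: is_word_def wtape_def)
  let ?c = "\<lambda>m. if h \<le> m \<and> m < h + int (length y) then 0 else word_tape y (m - h)"
  have "run (transfer i j) S (4 * length y + 4) (S(i := (h, ?c), j := wtape g y))"
    by (rule run_transfer[OF assms(1) hg]) (auto simp: word_tape_def bsym_def)
  moreover have "(h, ?c) = wtape h []" by (auto simp: wtape_def word_tape_def fun_eq_iff)
  ultimately show ?thesis using assms(1)
    by (intro that[of "S(i := (h, ?c), j := wtape g y)"]) (auto simp: is_word_def)
qed

text \<open>Weaker than \<open>computes\<close>: the alphabet may be larger, and the scratch tapes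
  may be left dirty. This is as much as the simulation of an arbitrary machine offers.\<close>

definition computes_on :: "bool list set \<Rightarrow> (bool list \<Rightarrow> bool list) \<Rightarrow> bool" where
  "computes_on X F \<longleftrightarrow> (\<exists>P w A p. 3 \<le> A \<and> (\<forall>d. wf_com (d + w + 1) A (P d)) \<and>
     (\<forall>d S x. x \<in> X \<longrightarrow> is_word S d x \<longrightarrow> (\<forall>i\<in>{d<..d + w}. is_word S i []) \<longrightarrow>
        (\<exists>t \<le> poly p (length x). \<exists>S'. run (P d) S t S' \<and> is_word S' d (F x) \<and>
           (\<forall>i. i \<notin> {d..d + w} \<longrightarrow> S' i = S i))))"

lemma computes_onI:
  assumes "3 \<le> A" "\<And>d. wf_com (d + w + 1) A (P d)" "pb b"
    "\<And>d S x. x \<in> X \<Longrightarrow> is_word S d x \<Longrightarrow> (\<forall>i\<in>{d<..d + w}. is_word S i []) \<Longrightarrow>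
        (\<exists>t \<le> b (length x). \<exists>S'. run (P d) S t S' \<and> is_word S' d (F x) \<and>
           (\<forall>i. i \<notin> {d..d + w} \<longrightarrow> S' i = S i))"
  shows "computes_on X F"
proof -
  obtain p where p: "\<forall>n. b n \<le> poly p n" using assms(3) by (auto simp: pb_def)
  show ?thesis unfolding computes_on_def
  proof (rule exI[of _ P], rule exI[of _ w], rule exI[of _ A], rule exI[of _ p], intro conjI allI
    impI)
    show "3 \<le> A" by fact
    show "wf_com (d + w + 1) A (P d)" for d by fact
    fix d S x
    assume "x \<in> X" "is_word S d x" "\<forall>i\<in>{d<..d + w}. is_word S i []"
    from assms(4)[OF this] obtain t S' where "t \<le> b (length x)" "run (P d) S t S'"
      "is_word S' d (F x)"
      "\<forall>i. i \<notin> {d..d + w} \<longrightarrow> S' i = S i" by blast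
    then show "\<exists>t \<le> poly p (length x). \<exists>S'. run (P d) S t S' \<and> is_word S' d (F x) \<and>
           (\<forall>i. i \<notin> {d..d + w} \<longrightarrow> S' i = S i)" using p by (metis order_trans)
  qed
qed

lemma computes_onE:
  assumes "computes_on X F"
  obtains P w A p where "3 \<le> A" "\<And>d. wf_com (d + w + 1) A (P d)"
    "\<And>d S x. x \<in> X \<Longrightarrow> is_word S d x \<Longrightarrow> (\<forall>i\<in>{d<..d + w}. is_word S i []) \<Longrightarrow>
        (\<exists>t \<le> poly p (length x). \<exists>S'. run (P d) S t S' \<and> is_word S' d (F x) \<and>
           (\<forall>i. i \<notin> {d..d + w} \<longrightarrow> S' i = S i))"
  using assms unfolding computes_on_def by blast

lemma computes_on_length:
  assumes "computes_on X F"
  obtains p :: "nat poly" where "\<And>x. x \<in> X \<Longrightarrow> length (F x) \<le> poly p (length x)"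
proof -
  obtain P w A p where "3 \<le> A" "\<And>d. wf_com (d + w + 1) A (P d)"
    and P: "\<And>d S x. x \<in> X \<Longrightarrow> is_word S d x \<Longrightarrow> (\<forall>i\<in>{d<..d + w}. is_word S i []) \<Longrightarrow>
        (\<exists>t \<le> poly p (length x). \<exists>S'. run (P d) S t S' \<and> is_word S' d (F x) \<and>
           (\<forall>i. i \<notin> {d..d + w} \<longrightarrow> S' i = S i))"
    by (rule computes_onE[OF assms], rule that)
  have "length (F x) \<le> poly (p + [:0, 1:]) (length x)" if "x \<in> X" for x
  proof -
    let ?S = "\<lambda>i. wtape 0 (if i = 0 then x else [])"
    have S: "is_word ?S 0 x" "\<forall>i\<in>{0<..0 + w}. is_word ?S i []" by (auto simp: is_word_def)
    from P[OF that S] obtain t S' where "t \<le> poly p (length x)" "run (P 0) ?S t S'"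
      "is_word S' 0 (F x)"
      by blast
    then show ?thesis using run_length[of "P 0" ?S t S' 0 x "F x"] S(1) by simp
  qed
  then show ?thesis by (rule that)
qed

lemma computes_on_computes:
  assumes "computes X F"
  shows "computes_on X F"
proof -
  obtain P w p where P: "\<And>d. wf_com (d + w + 1) 3 (P d)"
    "\<And>d V \<sigma>. \<sigma> d \<in> X \<Longrightarrow> {d..d + w} \<subseteq> V \<Longrightarrow> (\<forall>i\<in>{d<..d + w}. \<sigma> i = []) \<Longrightarrow>
        wdo V (P d) \<sigma> (poly p (length (\<sigma> d))) (\<sigma>(d := F (\<sigma> d)))"
    using computesE[OF assms] by metis
  show ?thesis
  proof (rule computes_onI[OF order_refl P(1) pb_poly])
    fix d S x assume X: "x \<in> X" and x: "is_word S d x" "\<forall>i\<in>{d<..d + w}. is_word S i []"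
    let ?\<sigma> = "(\<lambda>_. [])(d := x)"
    have "wdo {d..d + w} (P d) ?\<sigma> (poly p (length (?\<sigma> d))) (?\<sigma>(d := F (?\<sigma> d)))"
      by (rule P(2)) (use X in auto)
    moreover have "\<forall>i\<in>{d..d + w}. is_word S i (?\<sigma> i)" using x by auto
    ultimately obtain t S' where S': "t \<le> poly p (length (?\<sigma> d))" "run (P d) S t S'"
      "\<forall>i\<in>{d..d + w}. is_word S' i ((?\<sigma>(d := F (?\<sigma> d))) i)" "\<forall>i. i \<notin> {d..d + w} \<longrightarrow> S' i = S i"
      by (rule wdoE)
    moreover have "is_word S' d (F x)" using S'(3)[rule_format, of d] by simp
    ultimately show "\<exists>t\<le>poly p (length x). \<exists>S'. run (P d) S t S' \<and> is_word S' d (F x) \<and>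
      (\<forall>i. i \<notin> {d..d + w} \<longrightarrow> S' i = S i)" by auto
  qed
qed

text \<open>The tapes of the first command may be dirty after its run, so the second command works
  entirely above them; \<open>transfer\<close> carries its argument up and its result down.\<close>

lemma computes_on_comp:
  assumes "computes_on X F" "computes_on Y G" "F ` X \<subseteq> Y"
  shows "computes_on X (\<lambda>x. G (F x))"
proof -
  obtain P w A p where P: "3 \<le> A" "\<And>d. wf_com (d + w + 1) A (P d)"
    "\<And>d S x. x \<in> X \<Longrightarrow> is_word S d x \<Longrightarrow> (\<forall>i\<in>{d<..d + w}. is_word S i []) \<Longrightarrow>
        (\<exists>t \<le> poly p (length x). \<exists>S'. run (P d) S t S' \<and> is_word S' d (F x) \<and>
           (\<forall>i. i \<notin> {d..d + w} \<longrightarrow> S' i = S i))"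
    by (rule computes_onE[OF assms(1)], rule that)
  obtain Q v B q where Q: "3 \<le> B" "\<And>d. wf_com (d + v + 1) B (Q d)"
    "\<And>d S x. x \<in> Y \<Longrightarrow> is_word S d x \<Longrightarrow> (\<forall>i\<in>{d<..d + v}. is_word S i []) \<Longrightarrow>
        (\<exists>t \<le> poly q (length x). \<exists>S'. run (Q d) S t S' \<and> is_word S' d (G x) \<and>
           (\<forall>i. i \<notin> {d..d + v} \<longrightarrow> S' i = S i))"
    by (rule computes_onE[OF assms(2)], rule that)
  obtain l where l: "\<And>x. x \<in> X \<Longrightarrow> length (F x) \<le> poly l (length x)"
    using computes_on_length[OF assms(1)] by metis
  obtain m where m: "\<And>x. x \<in> Y \<Longrightarrow> length (G x) \<le> poly m (length x)"
    using computes_on_length[OF assms(2)] by metis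
  let ?e = "\<lambda>d. d + w + 1"
  let ?P = "\<lambda>d. Seq (P d) (Seq (transfer d (?e d)) (Seq (Q (?e d)) (transfer (?e d) d)))"
  let ?b = "\<lambda>n. poly p n + ((4 * poly l n + 4) + (poly q (poly l n) + (4 * poly m (poly l n) + 4)))"
  show ?thesis
  proof (rule computes_onI[where w = "w + v + 1"])
    show "3 \<le> A + B" using P(1) by simp
    show "wf_com (d + (w + v + 1) + 1) (A + B) (?P d)" for d
      using wf_com_mono[OF P(2)[of d], of "d + (w + v + 1) + 1" "A + B"]
        wf_com_mono[OF Q(2)[of "?e d"], of "d + (w + v + 1) + 1" "A + B"] P(1) by simp
    show "pb ?b" by (intro pb_intros)
    fix d S x assume x: "x \<in> X" "is_word S d x" "\<forall>i\<in>{d<..d + (w + v + 1)}. is_word S i []"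
    let ?n = "length x"
    have "\<forall>i\<in>{d<..d + w}. is_word S i []" using x(3) by auto
    from P(3)[OF x(1,2) this] obtain t1 S1 where 1: "t1 \<le> poly p ?n" "run (P d) S t1 S1"
      "is_word S1 d (F x)" "\<forall>i. i \<notin> {d..d + w} \<longrightarrow> S1 i = S i" by blast
    have S1: "is_word S1 i []" if "i \<in> {?e d..?e d + v}" for i
      using x(3) 1(4) that by (force simp: is_word_def)
    have ne: "d \<noteq> ?e d" "?e d \<noteq> d" by auto
    obtain S2 where 2: "run (transfer d (?e d)) S1 (4 * length (F x) + 4) S2" "is_word S2 d []"
      "is_word S2 (?e d) (F x)" "\<And>l. l \<noteq> d \<Longrightarrow> l \<noteq> ?e d \<Longrightarrow> S2 l = S1 l"
      using run_transfer_word[OF ne(1) 1(3) S1[of "?e d"]] by auto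
    have "\<forall>i\<in>{?e d<..?e d + v}. is_word S2 i []"
      using S1 2(4) by (auto simp: is_word_def)
    moreover have Y: "F x \<in> Y" using assms(3) x(1) by auto
    ultimately obtain t3 S3 where 3: "t3 \<le> poly q (length (F x))" "run (Q (?e d)) S2 t3 S3"
      "is_word S3 (?e d) (G (F x))" "\<forall>i. i \<notin> {?e d..?e d + v} \<longrightarrow> S3 i = S2 i"
      using Q(3)[OF _ 2(3)] by blast
    have "is_word S3 d []" using 2(2) 3(4) by (simp add: is_word_def)
    from run_transfer_word[OF ne(2) 3(3) this]
    obtain S4 where 4: "run (transfer (?e d) d) S3 (4 * length (G (F x)) + 4) S4"
      "is_word S4 d (G (F x))" "\<And>l. l \<noteq> ?e d \<Longrightarrow> l \<noteq> d \<Longrightarrow> S4 l = S3 l" by metis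
    have "length (G (F x)) \<le> poly m (poly l ?n)"
      using m[OF Y] poly_nat_mono[OF l[OF x(1)], of m] by simp
    moreover have "t3 \<le> poly q (poly l ?n)"
      using 3(1) poly_nat_mono[OF l[OF x(1)], of q] by simp
    ultimately have "t1 + ((4 * length (F x) + 4) + (t3 + (4 * length (G (F x)) + 4))) \<le> ?b ?n"
      using 1(1) l[OF x(1)] by (intro add_mono) auto
    moreover have "run (?P d) S (t1 + ((4 * length (F x) + 4) +
      (t3 + (4 * length (G (F x)) + 4)))) S4"
      by (intro run_Seq) fact+
    moreover have "\<forall>i. i \<notin> {d..d + (w + v + 1)} \<longrightarrow> S4 i = S i"
      using 1(4) 2(4) 3(4) 4(3) by auto
    ultimately show "\<exists>t\<le>?b ?n. \<exists>S'. run (?P d) S t S' \<and> is_word S' d (G (F x)) \<and>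
        (\<forall>i. i \<notin> {d..d + (w + v + 1)} \<longrightarrow> S' i = S i)"
      using 4(2) by blast
  qed
qed

text \<open>Keeps the argument next to the result, since the answer of a subroutine has to be
  checked against the word for which it was computed.\<close>

lemma computes_on_pair:
  assumes "computes_on X F"
  shows "computes_on X (\<lambda>x. enc_pair x (F x))"
proof -
  obtain P w A p where P: "3 \<le> A" "\<And>d. wf_com (d + w + 1) A (P d)"
    "\<And>d S x. x \<in> X \<Longrightarrow> is_word S d x \<Longrightarrow> (\<forall>i\<in>{d<..d + w}. is_word S i []) \<Longrightarrow>
        (\<exists>t \<le> poly p (length x). \<exists>S'. run (P d) S t S' \<and> is_word S' d (F x) \<and>
           (\<forall>i. i \<notin> {d..d + w} \<longrightarrow> S' i = S i))"
    by (rule computes_onE[OF assms(1)], rule that)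
  obtain l where l: "\<And>x. x \<in> X \<Longrightarrow> length (F x) \<le> poly l (length x)"
    using computes_on_length[OF assms(1)] by metis
  \<comment> \<open>Lies beyond the tapes \<open>d + 1\<close> to \<open>d + 1 + w\<close> of the
    command and is therefore still blank after its run.\<close>
  let ?e = "\<lambda>d. d + w + 3"
  let ?A = "\<lambda>d. Seq (rmove d (?e d)) (Seq (push (d+1) False) (encmove (?e d) (d+1)))"
  let ?P = "\<lambda>d. Seq (dup d (d+1) (d+2)) (Seq (P (d+1)) (Seq (?A d) (transfer (d+1) d)))"
  let ?b = "\<lambda>n. (13 * n + 2) + (poly p n + ((5 * n + 1 + (2 + (7 * n + 1))) +
    (4 * (2 * n + 1 + poly l n) + 4)))"
  show ?thesis
  proof (rule computes_onI[where w = "w + 3"])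
    show "3 \<le> A" by fact
    show "wf_com (d + (w + 3) + 1) A (?P d)" for d
      using wf_com_mono[OF P(2)[of "d+1"], of "d + (w + 3) + 1" A] P(1) by simp
    show "pb ?b" by (intro pb_intros)
    fix d S x assume x: "x \<in> X" "is_word S d x" "\<forall>i\<in>{d<..d + (w + 3)}. is_word S i []"
    let ?n = "length x"
    let ?V = "{d, d+1, d+2}"
    let ?\<sigma> = "(\<lambda>_. [])(d := x)"
    have "wdo ?V (dup d (d+1) (d+2)) ?\<sigma> (13 * ?n + 2) (?\<sigma>(d+1 := ?\<sigma> d))"
      by (rule wdo_dup) auto
    moreover have "\<forall>i\<in>?V. is_word S i (?\<sigma> i)" using x by auto
    ultimately obtain t1 S1 where 1: "t1 \<le> 13 * ?n + 2" "run (dup d (d+1) (d+2)) S t1 S1"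
      "\<forall>i\<in>?V. is_word S1 i ((?\<sigma>(d+1 := ?\<sigma> d)) i)" "\<forall>i. i \<notin> ?V \<longrightarrow> S1 i = S i" by (rule wdoE)
    have S1: "is_word S1 d x" "is_word S1 (d+1) x" "is_word S1 (d+2) []"
      using 1(3) by auto
    have "is_word S1 i []" if "i \<in> {d+1<..d + 1 + w}" for i
      using x(3) 1(4) S1(3) that by (cases "i = d + 2") (auto simp: is_word_def)
    then obtain t2 S2 where 2: "t2 \<le> poly p ?n" "run (P (d+1)) S1 t2 S2" "is_word S2 (d+1) (F x)"
      "\<forall>i. i \<notin> {d+1..d + 1 + w} \<longrightarrow> S2 i = S1 i" using P(3)[OF x(1) S1(2)] by blast
    let ?U = "{d, d+1, ?e d}"
    let ?\<tau> = "(\<lambda>_. [])(d := x, d+1 := F x)"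
    have S2: "\<forall>i\<in>?U. is_word S2 i (?\<tau> i)"
      using x(3) S1 1(4) 2(3,4) by (auto simp: is_word_def)
    have a: "wdo ?U (rmove d (?e d)) ?\<tau> (5 * ?n + 1) ((\<lambda>_. [])(d+1 := F x, ?e d := rev x))"
      by (rule wdo_eq[OF wdo_rmove]) (auto simp: fun_eq_iff)
    have b: "wdo ?U (push (d+1) False) ((\<lambda>_. [])(d+1 := F x, ?e d := rev x)) 2
        ((\<lambda>_. [])(d+1 := False # F x, ?e d := rev x))"
      by (rule wdo_eq[OF wdo_push]) (auto simp: fun_eq_iff)
    have c: "wdo ?U (encmove (?e d) (d+1)) ((\<lambda>_. [])(d+1 := False #
      F x, ?e d := rev x)) (7 * ?n + 1)
        ((\<lambda>_. [])(d+1 := enc_pair x (F x)))"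
      by (rule wdo_eq[OF wdo_encmove]) (auto simp: fun_eq_iff enc_pair_def enc_word_pairs)
    have "wdo ?U (?A d) ?\<tau> (5 * ?n + 1 + (2 + (7 * ?n + 1))) ((\<lambda>_. [])(d+1 := enc_pair x (F x)))"
      by (rule wdo_Seq[OF a wdo_Seq[OF b c]]) (rule order_refl)+
    from this S2 obtain t3 S3 where 3: "t3 \<le> 5 * ?n + 1 + (2 + (7 * ?n + 1))" "run (?A d) S2 t3 S3"
      "\<forall>i\<in>?U. is_word S3 i (((\<lambda>_. [])(d+1 := enc_pair x (F x))) i)" "\<forall>i. i \<notin> ?U \<longrightarrow> S3 i = S2 i"
      by (rule wdoE)
    have "is_word S3 (d+1) (enc_pair x (F x))" "is_word S3 d []" "d + 1 \<noteq> d" using 3(3) by auto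
    from run_transfer_word[OF this(3,1,2)]
    obtain S4 where 4: "run (transfer (d+1) d) S3 (4 * length (enc_pair x (F x)) + 4) S4"
      "is_word S4 d (enc_pair x (F x))" "\<And>l. l \<noteq> d+1 \<Longrightarrow> l \<noteq> d \<Longrightarrow> S4 l = S3 l" by metis
    have "t1 + (t2 + (t3 + (4 * length (enc_pair x (F x)) + 4))) \<le> ?b ?n"
      using 1(1) 2(1) 3(1) l[OF x(1)] by (intro add_mono) (auto simp: length_enc_pair)
    moreover have "run (?P d) S (t1 + (t2 + (t3 + (4 * length (enc_pair x (F x)) + 4)))) S4"
      by (intro run_Seq[OF 1(2)] run_Seq[OF 2(2)] run_Seq[OF 3(2)] 4(1))
    moreover have "\<forall>i. i \<notin> {d..d + (w + 3)} \<longrightarrow> S4 i = S i"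
      using 1(4) 2(4) 3(4) 4(3) by auto
    ultimately show "\<exists>t\<le>?b ?n. \<exists>S'. run (?P d) S t S' \<and> is_word S' d (enc_pair x (F x)) \<and>
        (\<forall>i. i \<notin> {d..d + (w + 3)} \<longrightarrow> S' i = S i)"
      using 4(2) by blast
  qed
qed

text \<open>The command works from tape 1 on, where the start of a word may drift. The transfers at
  both ends meet the convention that input and output start at cell 0 of the first tape.\<close>

lemma poly_time_solvable_computes_on:
  assumes "computes_on UNIV F"
  shows "poly_time_solvable (\<lambda>x. x) UNIV (\<lambda>x y. y = F x)"
proof -
  obtain P w A p where P: "3 \<le> A" "\<And>d. wf_com (d + w + 1) A (P d)"
    "\<And>d S x. x \<in> UNIV \<Longrightarrow> is_word S d x \<Longrightarrow> (\<forall>i\<in>{d<..d + w}. is_word S i []) \<Longrightarrow>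
        (\<exists>t \<le> poly p (length x). \<exists>S'. run (P d) S t S' \<and> is_word S' d (F x) \<and>
           (\<forall>i. i \<notin> {d..d + w} \<longrightarrow> S' i = S i))"
    by (rule computes_onE[OF assms(1)], rule that)
  obtain l where l: "\<And>x. x \<in> UNIV \<Longrightarrow> length (F x) \<le> poly l (length x)"
    by (rule computes_on_length[OF assms(1)], rule that)
  let ?c = "Seq (transfer 0 1) (Seq (P 1) (transfer 1 0))"
  let ?K = "w + 2"
  let ?M = "machine ?K A ?c"
  have wf: "wf_com ?K A ?c" using P(1) P(2)[of 1] by simp
  have tm: "turing_machine ?M" by (rule turing_machine_machine[OF wf _ P(1)]) simp
  have "pb (\<lambda>n. 4 * n + 4 + (poly p n + (4 * poly l n + 4)))" by (intro pb_intros)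
  then obtain q where q: "\<And>n. 4 * n + 4 + (poly p n + (4 * poly l n + 4)) \<le> poly q n"
    by (auto simp: pb_def)
  have "\<exists>t y. t \<le> poly q (length x) \<and> halts_with ?M x t y \<and> y = F x" for x
  proof -
    let ?S = "\<lambda>i. wtape 0 (if i = 0 then x else [])"
    have ini: "initial ?M x = (0, map ?S [0..<?K])"
    proof -
      have "(0, word_tape x) # replicate (w + 1) (0, \<lambda>_. 0) = map ?S [0..<?K]"
        by (rule nth_equalityI)
          (auto simp: wtape_def nth_Cons fun_eq_iff simp del: upt_Suc split: nat.splits)
      then show ?thesis by (simp add: initial_def machine_def)
    qed
    have e1: "(0::int, \<lambda>m::int. if 0 \<le> m \<and> m < 0 + int (length x) then 0 else word_tape x m) =
      wtape 0 []"
      by (auto simp: wtape_def word_tape_def)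
    have "run (transfer 0 1) ?S (4 * length x + 4)
       (?S(0 := (0, \<lambda>m. if 0 \<le> m \<and> m < 0 + int (length x) then 0
         else word_tape x m), 1 := wtape 0 x))"
      by (rule run_transfer) (auto simp: wtape_def word_tape_def bsym_def fun_eq_iff)
    then have 1: "run (transfer 0 1) ?S (4 * length x + 4) (?S(0 := wtape 0 [], 1 := wtape 0 x))"
      unfolding e1 .
    let ?S1 = "?S(0 := wtape 0 [], 1 := wtape 0 x)"
    have S1: "is_word ?S1 1 x" "\<forall>i\<in>{1<..1 + w}. is_word ?S1 i []" by (auto simp: is_word_def)
    from P(3)[OF UNIV_I S1] obtain t S2 where 2: "t \<le> poly p (length x)" "run (P 1) ?S1 t S2"
      "is_word S2 1 (F x)" "\<forall>i. i \<notin> {1..1 + w} \<longrightarrow> S2 i = ?S1 i" by blast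
    then obtain g where g: "S2 1 = (g, \<lambda>m. word_tape (F x) (m - g))" "S2 0 = (0, \<lambda>_. 0)"
      by (auto simp: is_word_def wtape_def)
    obtain S3 where 3: "run (transfer 1 0) S2 (4 * length (F x) + 4) S3" "S3 0 = wtape 0 (F x)"
      using run_transfer[of 1 0 S2 g "\<lambda>m. word_tape (F x) (m - g)" 0 "F x"] g
      by (auto simp: word_tape_def bsym_def)
    let ?t = "4 * length x + 4 + (t + (4 * length (F x) + 4))"
    have "run ?c ?S ?t S3"
      by (rule run_Seq[OF 1 run_Seq[OF 2(2) 3(1)]])
    from run_machine[OF wf this]
    have "(step ?M ^^ ?t) (initial ?M x) = (csize ?c, map S3 [0..<?K])" unfolding ini .
    then have "halts_with ?M x ?t (F x)"
      using 3(2) by (simp add: halts_with_def machine_def wtape_def hd_map upt_rec)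
    moreover have "?t \<le> poly q (length x)"
      using q[of "length x"] 2(1) l[OF UNIV_I, of x] by linarith
    ultimately show ?thesis by blast
  qed
  then show ?thesis unfolding poly_time_solvable_def using tm by blast
qed

text \<open>A simulated tape sits at an offset: its cell 0 is the cell where the head of the host
  tape stands when the simulation begins.\<close>

definition shift :: "int \<Rightarrow> tape \<Rightarrow> tape" where
  "shift g = (\<lambda>(h, c). (h + g, \<lambda>m. c (m - g)))"

text \<open>Displacements are logged as 1, 2 or 3, so an entry of the log is never blank. On an
  invalid state or symbol nothing happens, because \<open>delta\<close> is unconstrained there and
  could violate well-formedness.\<close>

definition tm_act :: "tm \<Rightarrow> nat \<Rightarrow> nat \<Rightarrow> nat list \<Rightarrow> nat \<Rightarrow> nat \<Rightarrow> nat \<times> int" where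
  "tm_act M e q ss a j =
     (if q < num_states M \<and> set ss \<subseteq> {..<num_symbols M}
      then if e \<le> j \<and> j < e + num_tapes M then snd (delta M q ss) ! (j - e)
        else if j = e + num_tapes M then (fst (delta M q ss), 0)
        else if j = e + num_tapes M + 1 then (nat (snd (snd (delta M q ss) ! 0) + 2), 1)
        else (a, 0)
      else (a, 0))"

definition tm_body :: "tm \<Rightarrow> nat \<Rightarrow> com" where
  "tm_body M e = Act (\<lambda>r j.
     tm_act M e (r (e + num_tapes M)) (map (\<lambda>i. r (e + i)) [0..<num_tapes M]) (r j) j)"

text \<open>A log entry \<open>s\<close> stands for the displacement \<open>s - 2\<close>, hence the
  head is moved by \<open>2 - s\<close>; the blank in front of the log ends the loop. The case
  distinction inside keeps the displacement legal on every symbol.\<close>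

definition tm_unwind :: "nat \<Rightarrow> nat \<Rightarrow> com" where
  "tm_unwind l e = Seq (act1 l (\<lambda>a. (a, - 1)))
     (While l {1, 2, 3} (Act (\<lambda>r j. if j = e then (r j, if r l \<in> {1, 2, 3} then 2 - int (r l)
       else 0)
        else if j = l then (0, - 1) else (r j, 0))))"

text \<open>
  The tapes of \<open>M\<close> are \<open>d + 1, \<dots>, d + k\<close>; tape \<open>d + k + 1\<close> holds the state in a single cell. Tape
  \<open>d + k + 2\<close> logs the displacements of the first head, which are undone afterwards to find the
  cell at which the output starts.
\<close>

definition tm_call :: "tm \<Rightarrow> nat \<Rightarrow> com" where
  "tm_call M d = (let k = num_tapes M in
     Seq (transfer d (d + 1))
    (Seq (While (d + 1 + k) (- {num_states M}) (tm_body M (d + 1)))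
    (Seq (tm_unwind (d + 1 + k + 1) (d + 1)) (transfer (d + 1) d))))"

lemma delta_valid:
  assumes "turing_machine M" "q < num_states M" "length ss = num_tapes M"
    "set ss \<subseteq> {..<num_symbols M}"
  shows "fst (delta M q ss) \<le> num_states M" "length (snd (delta M q ss)) = num_tapes M"
    "\<And>i. i < num_tapes M \<Longrightarrow> fst (snd (delta M q ss) ! i) < num_symbols M"
    "\<And>i. i < num_tapes M \<Longrightarrow> snd (snd (delta M q ss) ! i) \<in> {-1, 0, 1}"
proof -
  obtain q' as where qa: "delta M q ss = (q', as)" by fastforce
  then have "q' \<le> num_states M \<and> length as = num_tapes M \<and>
         (\<forall>(a, d) \<in> set as. a < num_symbols M \<and> d \<in> {-1, 0, 1})"
    using assms unfolding turing_machine_def by fastforce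
  then show "fst (delta M q ss) \<le> num_states M" "length (snd (delta M q ss)) = num_tapes M"
    "\<And>i. i < num_tapes M \<Longrightarrow> fst (snd (delta M q ss) ! i) < num_symbols M"
    "\<And>i. i < num_tapes M \<Longrightarrow> snd (snd (delta M q ss) ! i) \<in> {-1, 0, 1}"
    using nth_mem[of _ as] by (auto simp: qa case_prod_beta)
qed

lemma tm_act_valid:
  assumes "turing_machine M" "length ss = num_tapes M"
  shows "fst (tm_act M e q ss a j) < num_symbols M + num_states M + 4 \<or>
    fst (tm_act M e q ss a j) = a"
    and "snd (tm_act M e q ss a j) \<in> {-1, 0, 1}"
    and "e + num_tapes M + 2 \<le> j \<Longrightarrow> tm_act M e q ss a j = (a, 0)"
proof -
  note D = delta_valid[OF assms(1) _ assms(2), of q]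
  have k: "0 < num_tapes M" using assms(1) by (simp add: turing_machine_def)
  consider "\<not> (q < num_states M \<and> set ss \<subseteq> {..<num_symbols M})"
    | "q < num_states M" "set ss \<subseteq> {..<num_symbols M}" "e \<le> j \<and> j < e + num_tapes M"
    | "q < num_states M" "set ss \<subseteq> {..<num_symbols M}" "j = e + num_tapes M"
    | "q < num_states M" "set ss \<subseteq> {..<num_symbols M}" "j = e + num_tapes M + 1"
    | "q < num_states M" "set ss \<subseteq> {..<num_symbols M}" "\<not> (e \<le> j \<and> j < e + num_tapes M + 2)"
    by linarith
  then have "(fst (tm_act M e q ss a j) < num_symbols M + num_states M + 4 \<or>
    fst (tm_act M e q ss a j) = a)
    \<and> snd (tm_act M e q ss a j) \<in> {-1, 0, 1} \<and> (e + num_tapes M + 2 \<le> j \<longrightarrow>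
      tm_act M e q ss a j = (a, 0))"
  proof cases
    case 2
    then have "j - e < num_tapes M" by linarith
    then show ?thesis using 2 D(3)[OF 2(1,2), of "j - e"] D(4)[OF 2(1,2), of "j - e"]
      by (auto simp: tm_act_def)
  next
    case 3
    then show ?thesis using D(1)[OF 3(1,2)] by (auto simp: tm_act_def)
  next
    case 4
    then show ?thesis using D(4)[OF 4(1,2) k] by (auto simp: tm_act_def)
  qed (auto simp: tm_act_def)
  then show "fst (tm_act M e q ss a j) < num_symbols M + num_states M + 4 \<or>
    fst (tm_act M e q ss a j) = a"
    "snd (tm_act M e q ss a j) \<in> {-1, 0, 1}"
    "e + num_tapes M + 2 \<le> j \<Longrightarrow> tm_act M e q ss a j = (a, 0)" by blast+
qed

lemma wf_tm_call:
  assumes M: "turing_machine M"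
  shows "wf_com (d + (num_tapes M + 2) + 1) (num_symbols M + num_states M + 4) (tm_call M d)"
proof -
  let ?k = "num_tapes M"
  let ?K = "d + (?k + 2) + 1" and ?A = "num_symbols M + num_states M + 4"
  have k: "1 \<le> ?k" using M by (simp add: turing_machine_def)
  have "wf_com ?K ?A (tm_body M (d + 1))"
    unfolding tm_body_def wf_com.simps
  proof (intro conjI allI impI)
    fix r r' :: "nat \<Rightarrow> nat" and j
    assume r: "\<forall>i<?K. r i = r' i" and j: "j < ?K"
    have "map (\<lambda>i. r (d + 1 + i)) [0..<?k] = map (\<lambda>i. r' (d + 1 + i)) [0..<?k]"
      "r (d + 1 + ?k) = r' (d + 1 + ?k)" "r j = r' j" using r j by auto
    then show "tm_act M (d + 1) (r (d + 1 + ?k)) (map (\<lambda>i. r (d + 1 + i)) [0..<?k]) (r j) j =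
      tm_act M (d + 1) (r' (d + 1 + ?k)) (map (\<lambda>i. r' (d + 1 + i)) [0..<?k]) (r' j) j"
        by (simp only:)
  qed (rule tm_act_valid[OF M]; simp)+
  moreover have "wf_com ?K ?A (tm_unwind (d + 1 + ?k + 1) (d + 1))"
    unfolding tm_unwind_def act1_def using k by auto
  ultimately show ?thesis by (simp add: tm_call_def Let_def)
qed

lemma set_scanned:
  assumes "\<forall>i<length ts. \<forall>m. snd (ts ! i) m < A"
  shows "set (map (\<lambda>(h, c). c h) ts) \<subseteq> {..<A}"
proof
  fix y assume "y \<in> set (map (\<lambda>(h, c). c h) ts)"
  then obtain i where "i < length (map (\<lambda>(h, c). c h) ts)" "map (\<lambda>(h, c). c h) ts ! i = y"
    unfolding in_set_conv_nth by blast
  then show "y \<in> {..<A}" using assms by (auto simp: case_prod_beta)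
qed

lemma tm_config_valid:
  assumes M: "turing_machine M"
  shows "fst ((step M ^^ n) (initial M x)) \<le> num_states M \<and>
    length (snd ((step M ^^ n) (initial M x))) = num_tapes M \<and>
    (\<forall>i<num_tapes M. \<forall>m. snd (snd ((step M ^^ n) (initial M x)) ! i) m < num_symbols M)"
proof (induction n)
  case 0
  have "3 \<le> num_symbols M" "1 \<le> num_tapes M" using M by (auto simp: turing_machine_def)
  then show ?case by (auto simp: initial_def nth_Cons word_tape_def split: nat.splits)
next
  case (Suc n)
  obtain q ts where c: "(step M ^^ n) (initial M x) = (q, ts)" by fastforce
  show ?case
  proof (cases "q = num_states M")
    case True
    then show ?thesis using Suc c by simp
  next
    case False
    let ?ss = "map (\<lambda>(h, c). c h) ts"
    have q: "q < num_states M" and l: "length ?ss = num_tapes M"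
      and ss: "set ?ss \<subseteq> {..<num_symbols M}"
      using Suc c False by (simp_all add: set_scanned del: set_map)
    note D = delta_valid[OF M q l ss]
    have "(step M ^^ Suc n) (initial M x) = (fst (delta M q ?ss),
       map2 (\<lambda>(a, d) (h, c). (h + d, c(h := a))) (snd (delta M q ?ss)) ts)"
      using c False by (simp add: case_prod_beta)
    then show ?thesis using D Suc c by (auto simp: case_prod_beta)
  qed
qed

lemma step_nth:
  assumes M: "turing_machine M" and c: "(step M ^^ n) (initial M x) = (q, ts)"
    and q: "q \<noteq> num_states M"
    and ss: "ss = map (\<lambda>(h, c). c h) ts"
  shows "q < num_states M" "set ss \<subseteq> {..<num_symbols M}" "length ss = num_tapes M"
    "fst ((step M ^^ Suc n) (initial M x)) = fst (delta M q ss)"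
    "\<And>i. i < num_tapes M \<Longrightarrow> snd ((step M ^^ Suc n) (initial M x)) ! i =
       (fst (ts ! i) + snd (snd (delta M q ss) ! i),
         (snd (ts ! i))(fst (ts ! i) := fst (snd (delta M q ss) ! i)))"
proof -
  note v = tm_config_valid[OF M, of n x]
  show 1: "q < num_states M" "set ss \<subseteq> {..<num_symbols M}" "length ss = num_tapes M"
    using v c q unfolding ss by (simp_all add: set_scanned del: set_map)
  have "(step M ^^ Suc n) (initial M x) = (fst (delta M q ss),
       map2 (\<lambda>(a, d) (h, c). (h + d, c(h := a))) (snd (delta M q ss)) ts)"
    using c q by (simp add: case_prod_beta ss)
  then show "fst ((step M ^^ Suc n) (initial M x)) = fst (delta M q ss)"
    "\<And>i. i < num_tapes M \<Longrightarrow> snd ((step M ^^ Suc n) (initial M x)) ! i =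
       (fst (ts ! i) + snd (snd (delta M q ss) ! i),
         (snd (ts ! i))(fst (ts ! i) := fst (snd (delta M q ss) ! i)))"
    using v c delta_valid(2)[OF M 1(1,3,2)] by (auto simp: case_prod_beta)
qed

lemma steps_halted:
  assumes "fst ((step M ^^ n) c) = num_states M" "n \<le> m"
  shows "(step M ^^ m) c = (step M ^^ n) c"
  using assms(2)
proof (induction rule: dec_induct)
  case (step m)
  then show ?case using assms(1) by (cases "(Defs.step M ^^ n) c") auto
qed simp

text \<open>\<open>T\<close> is the first halting time because the loop stops at the first sight of
  the halting state. The factor 4 counts test and body, once in the simulation and once in the
  unwinding of the log.\<close>

lemma run_tm_loop:
  fixes M x e S1
  defines "k \<equiv> num_tapes M"
  defines "q \<equiv> \<lambda>n. fst ((step M ^^ n) (initial M x))"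
    and "ts \<equiv> \<lambda>n. snd ((step M ^^ n) (initial M x))"
  assumes M: "turing_machine M"
    and g: "\<And>i. i \<le> k + 1 \<Longrightarrow> S1 (e + i) = wtape (g i) (if i = 0 then x else [])"
    and T: "q T = num_states M" "\<And>n. n < T \<Longrightarrow> q n \<noteq> num_states M"
  obtains S2 where
    "run (Seq (While (e + k) (- {num_states M}) (tm_body M e)) (tm_unwind (e + k + 1) e)) S1
      (4 * T + 3) S2"
    "S2 e = (g 0, \<lambda>m. snd (ts T ! 0) (m - g 0))"
    "\<And>j. \<not> (e \<le> j \<and> j < e + k + 2) \<Longrightarrow> S2 j = S1 j"
proof -
  have k: "0 < k" using M by (simp add: turing_machine_def k_def)
  define pos where "pos n = fst (ts n ! 0)" for n
  define code where "code n = nat (pos (Suc n) - pos n + 2)" for n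
  define L where "L n = (\<lambda>m. if g (k + 1) \<le> m \<and> m < g (k + 1) + int n then
    code (nat (m - g (k + 1))) else 0)" for n
  define St where "St n j = (if e \<le> j \<and> j < e + k then shift (g (j - e)) (ts n ! (j - e))
    else if j = e + k then (g k, (\<lambda>_. 0)(g k := q n))
    else if j = e + k + 1 then (g (k + 1) + int n, L n) else S1 j)" for n j
  \<comment> \<open>The initial state is 0, which is also the blank, so an empty state tape is
    already initialised.\<close>
  have St0: "St 0 = S1"
  proof
    fix j
    consider "e \<le> j" "j < e + k" | "j = e + k" | "j = e + k + 1" | "\<not> (e \<le> j \<and> j < e + k + 2)"
      by linarith
    then show "St 0 j = S1 j"
    proof cases
      case 1
      then have "ts 0 ! (j - e) = (0, word_tape (if j - e = 0 then x else []))"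
        by (auto simp: ts_def initial_def nth_Cons k_def fun_eq_iff split: nat.splits)
      then show ?thesis using 1 g[of "j - e"] by (simp add: St_def shift_def wtape_def)
    next
      case 2
      then show ?thesis using g[of k] k by (simp add: St_def q_def initial_def wtape_def fun_eq_iff)
    next
      case 3
      then show ?thesis using g[of "k + 1"] by (simp add: St_def L_def wtape_def fun_eq_iff)
    qed (auto simp: St_def)
  qed
  let ?f = "\<lambda>r j. tm_act M e (r (e + k)) (map (\<lambda>i. r (e + i)) [0..<k]) (r j) j"
  have st: "run (tm_body M e) (St n) 1 (St (Suc n))" "code n \<in> {1, 2, 3}"
    "int (code n) = pos (Suc n) - pos n + 2" "scan (St n) (e + k) \<in> - {num_states M}"
      if n: "n < T" for n
  proof -
    let ?ss = "map (\<lambda>(h, c). c h) (ts n)"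
    have c: "(step M ^^ n) (initial M x) = (q n, ts n)" by (simp add: q_def ts_def)
    have s: "q n < num_states M" "set ?ss \<subseteq> {..<num_symbols M}" "length ?ss = num_tapes M"
      "q (Suc n) = fst (delta M (q n) ?ss)"
      "\<And>i. i < num_tapes M \<Longrightarrow> ts (Suc n) ! i = (fst (ts n ! i) + snd (snd (delta M (q n) ?ss) ! i),
         (snd (ts n ! i))(fst (ts n ! i) := fst (snd (delta M (q n) ?ss) ! i)))"
      using step_nth[OF M c T(2)[OF n] refl] unfolding q_def ts_def by blast+
    have sc: "scan (St n) (e + k) = q n" by (simp add: scan_def St_def)
    then show "scan (St n) (e + k) \<in> - {num_states M}" using T(2)[OF n] by simp
    have lts: "length (ts n) = k" using s(3) by (simp add: k_def)
    have scs: "map (\<lambda>i. scan (St n) (e + i)) [0..<k] = ?ss"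
      by (rule nth_equalityI) (auto simp: lts scan_def St_def shift_def case_prod_beta)
    have p: "pos (Suc n) - pos n = snd (snd (delta M (q n) ?ss) ! 0)"
      using s(5)[of 0] k by (simp add: pos_def k_def)
    have p1: "snd (snd (delta M (q n) ?ss) ! 0) \<in> {-1, 0, 1}"
      using delta_valid(4)[OF M s(1,3,2), of 0] k by (simp add: k_def)
    show "code n \<in> {1, 2, 3}" "int (code n) = pos (Suc n) - pos n + 2"
      using p p1 by (auto simp: code_def)
    have "perform (?f (scan (St n))) (St n) = St (Suc n)"
    proof
      fix j
      have f: "?f (scan (St n)) j = (if e \<le> j \<and> j < e + k then snd (delta M (q n) ?ss) ! (j - e)
        else if j = e + k then (fst (delta M (q n) ?ss), 0)
        else if j = e + k + 1 then (code n, 1)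
        else (scan (St n) j, 0))"
        unfolding sc scs tm_act_def using s(1,2) p by (simp add: k_def code_def)
      consider "e \<le> j" "j < e + k" | "j = e + k" | "j = e + k + 1" | "\<not> (e \<le> j \<and> j < e + k + 2)"
        by linarith
      then show "perform (?f (scan (St n))) (St n) j = St (Suc n) j"
      proof cases
        case 1
        then show ?thesis unfolding perform_def f using s(5)[of "j - e"]
          by (auto simp: St_def shift_def k_def fun_eq_iff case_prod_beta)
      next
        case 2
        then show ?thesis unfolding perform_def f using s(4) by (auto simp: St_def)
      next
        case 3
        then show ?thesis unfolding perform_def f by (auto simp: St_def L_def fun_eq_iff)
      next
        case 4
        then show ?thesis unfolding perform_def f by (auto simp: St_def scan_def)
      qed
    qed
    then show "run (tm_body M e) (St n) 1 (St (Suc n))"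
      unfolding tm_body_def using run_Act[of ?f "St n"] by (simp add: k_def)
  qed
  let ?W = "While (e + k) (- {num_states M}) (tm_body M e)"
  have W: "run ?W (St n) (2 * (T - n) + 1) (St T)" if "n \<le> T" for n
    using that
  proof (induction "T - n" arbitrary: n)
    case 0
    then have [simp]: "n = T" by simp
    have "scan (St n) (e + k) = num_states M" using T(1) by (simp add: scan_def St_def)
    then have "scan (St n) (e + k) \<notin> - {num_states M}" by simp
    from run_WhileF[OF this] show ?case by simp
  next
    case (Suc m)
    then have n: "n < T" by simp
    have "run ?W (St (Suc n)) (2 * (T - Suc n) + 1) (St T)" using Suc by (intro Suc.hyps(1)) auto
    from run_WhileT[OF st(4)[OF n] st(1)[OF n] this]
    have "run ?W (St n) (Suc (1 + (2 * (T - Suc n) + 1))) (St T)" .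
    moreover have "Suc (1 + (2 * (T - Suc n) + 1)) = 2 * (T - n) + 1" using n by simp
    ultimately show ?case by simp
  qed
  have W0: "run ?W S1 (2 * T + 1) (St T)" using W[of 0] St0 by simp
  define R where "R n = (St T)(e := (pos n + g 0, \<lambda>m. snd (ts T ! 0) (m - g 0)),
    e + k + 1 := (g (k + 1) + int n - 1, L n))" for n
  have tsT: "shift (g 0) (ts T ! 0) = (pos T + g 0, \<lambda>m. snd (ts T ! 0) (m - g 0))"
    by (simp add: shift_def pos_def case_prod_beta)
  have U1: "run (act1 (e + k + 1) (\<lambda>a. (a, - 1))) (St T) 1 (R T)"
    using k tsT by (intro run_act1) (auto simp: R_def St_def scan_def fun_eq_iff)
  let ?h = "\<lambda>r j. if j = e then (r j, if r (e + k + 1) \<in> {1, 2, 3} then 2 - int (r (e + k + 1))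
    else 0)
        else if j = e + k + 1 then (0, - 1) else (r j, 0)"
  let ?U = "While (e + k + 1) {1, 2, 3} (Act ?h)"
  have U2: "run ?U (R n) (2 * n + 1) (R 0)" if "n \<le> T" for n
    using that
  proof (induction n)
    case 0
    have "scan (R 0) (e + k + 1) \<notin> {1, 2, 3}" by (simp add: scan_def R_def L_def)
    from run_WhileF[OF this] show ?case by simp
  next
    case (Suc n)
    then have n: "n < T" by simp
    have sc: "scan (R (Suc n)) (e + k + 1) = code n" by (simp add: scan_def R_def L_def)
    have "perform (?h (scan (R (Suc n)))) (R (Suc n)) = R n"
    proof
      fix j
      have h: "?h (scan (R (Suc n))) j = (if j = e then (scan (R (Suc n)) j, 2 - int (code n))
        else if j = e + k + 1 then (0, - 1) else (scan (R (Suc n)) j, 0))"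
        unfolding sc using st(2)[OF n] by simp
      show "perform (?h (scan (R (Suc n)))) (R (Suc n)) j = R n j"
        unfolding perform_def h st(3)[OF n] by (auto simp: R_def L_def scan_def fun_eq_iff)
    qed
    then have "run (Act ?h) (R (Suc n)) 1 (R n)" using run_Act[of ?h "R (Suc n)"] by simp
    moreover have "scan (R (Suc n)) (e + k + 1) \<in> {1, 2, 3}" unfolding sc by (rule st(2)[OF n])
    moreover have "run ?U (R n) (2 * n + 1) (R 0)" using Suc by simp
    ultimately have "run ?U (R (Suc n)) (Suc (1 + (2 * n + 1))) (R 0)" by (intro run_WhileT)
    then show ?case by simp
  qed
  have "run (Seq ?W (tm_unwind (e + k + 1) e)) S1 (2 * T + 1 + (1 + (2 * T + 1))) (R 0)"
    unfolding tm_unwind_def by (rule run_Seq[OF W0 run_Seq[OF U1 U2[OF order_refl]]])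
  moreover have "2 * T + 1 + (1 + (2 * T + 1)) = 4 * T + 3" by simp
  ultimately have "run (Seq ?W (tm_unwind (e + k + 1) e)) S1 (4 * T + 3) (R 0)" by metis
  moreover have "pos 0 = 0" by (simp add: pos_def ts_def initial_def)
  ultimately show ?thesis
    using k by (intro that[of "R 0"]) (auto simp: R_def St_def)
qed

inductive_cases run_SeqE: "run (Seq c d) S t S'"

lemma run_Seq_assoc: "run (Seq (Seq a b) c) S t S' \<Longrightarrow> run (Seq a (Seq b c)) S t S'"
  by (elim run_SeqE) (auto simp: add.assoc intro: run_Seq)

text \<open>Only runs on words in \<open>X\<close> matter, so this covers an algorithm whose
  behaviour is promised merely on the codes of certain inputs.\<close>

lemma computes_on_tm:
  assumes M: "turing_machine M"
    and F: "\<And>x. x \<in> X \<Longrightarrow> \<exists>t \<le> poly p (length x). halts_with M x t (F x)"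
  shows "computes_on X F"
proof -
  let ?k = "num_tapes M"
  let ?b = "\<lambda>n. (4 * n + 4) + ((4 * poly p n + 3) + (4 * (n + 4 * poly p n + 3) + 4))"
  show ?thesis
  proof (rule computes_onI[OF _ wf_tm_call[OF M]])
    show "3 \<le> num_symbols M + num_states M + 4" by simp
    show "pb ?b" by (intro pb_intros)
    fix d S x assume x: "x \<in> X" "is_word S d x" "\<forall>i\<in>{d<..d + (?k + 2)}. is_word S i []"
    obtain t where t: "t \<le> poly p (length x)" "halts_with M x t (F x)" using F[OF x(1)] by blast
    let ?c = "\<lambda>n. (step M ^^ n) (initial M x)"
    have ht: "fst (?c t) = num_states M"
      "\<And>i. i \<in> {0..int (length (F x))} \<Longrightarrow> snd (hd (snd (?c t))) i = word_tape (F x) i"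
      using t(2) by (auto simp: halts_with_def case_prod_beta)
    define T where "T = (LEAST n. fst (?c n) = num_states M)"
    have T: "fst (?c T) = num_states M" "T \<le> t" unfolding T_def
      using ht(1) by (auto intro: LeastI Least_le)
    have T': "fst (?c n) \<noteq> num_states M" if "n < T" for n using not_less_Least that
      unfolding T_def by blast
    have cT: "?c t = ?c T" using steps_halted[OF T] .
    have l: "length (snd (?c T)) = ?k" using tm_config_valid[OF M] by blast
    have k: "0 < ?k" using M by (simp add: turing_machine_def)
    have hd: "hd (snd (?c T)) = snd (?c T) ! 0" using l k by (intro hd_conv_nth) auto
    have ne: "d \<noteq> d + 1" "d + 1 \<noteq> d" by auto
    obtain S1 where 1: "run (transfer d (d + 1)) S (4 * length x + 4) S1" "is_word S1 d []"
      "is_word S1 (d + 1) x" "\<And>l. l \<noteq> d \<Longrightarrow> l \<noteq> d + 1 \<Longrightarrow> S1 l = S l"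
      using run_transfer_word[OF ne(1) x(2)] x(3) by auto
    have "\<exists>h. S1 (d + 1 + i) = wtape h (if i = 0 then x else [])" if "i \<le> ?k + 1" for i
    proof (cases "i = 0")
      case True
      then show ?thesis using 1(3) by (simp add: is_word_def)
    next
      case False
      then show ?thesis using 1(4)[of "d + 1 + i"] x(3) that by (auto simp: is_word_def)
    qed
    then obtain g where g: "\<And>i. i \<le> ?k + 1 \<Longrightarrow> S1 (d + 1 + i) = wtape (g i) (if i = 0 then x else [])"
      by metis
    let ?W = "While (d + 1 + ?k) (- {num_states M}) (tm_body M (d + 1))"
    let ?U = "tm_unwind (d + 1 + ?k + 1) (d + 1)"
    obtain S2 where 2: "run (Seq ?W ?U) S1 (4 * T + 3) S2"
      "S2 (d + 1) = (g 0, \<lambda>m. snd (snd (?c T) ! 0) (m - g 0))"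
      "\<And>j. \<not> (d + 1 \<le> j \<and> j < d + 1 + ?k + 2) \<Longrightarrow> S2 j = S1 j"
      using run_tm_loop[OF M g T(1) T'] by blast
    have out: "snd (snd (?c T) ! 0) i = word_tape (F x) i" if "i \<in> {0..int (length (F x))}" for i
      using ht(2)[OF that] by (simp add: cT hd)
    obtain h where h: "S2 d = (h, \<lambda>_. 0)"
      using 1(2) 2(3)[of d] by (auto simp: is_word_def wtape_def)
    define S3 where "S3 = S2(d + 1 := (g 0, \<lambda>m. if g 0 \<le> m \<and> m < g 0 + int (length (F x)) then 0
       else snd (snd (?c T) ! 0) (m - g 0)), d := wtape h (F x))"
    have 3: "run (transfer (d + 1) d) S2 (4 * length (F x) + 4) S3"
      unfolding S3_def
      by (rule run_transfer[OF ne(2) 2(2) h]) (auto simp: out word_tape_def bsym_def)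
    \<comment> \<open>The output occupies cells that are nonblank after the simulation, and their
      number is bounded by the input length plus the running time. This pays for the final
      \<open>transfer\<close>.\<close>
    have len: "length (F x) \<le> length x + (4 * T + 3)"
    proof -
      have "finite {j. snd (S1 (d + 1)) j \<noteq> 0}" "card {j. snd (S1 (d + 1)) j \<noteq> 0} = length x"
        using g[of 0] by (simp_all add: nonblank_wtape del: neq0_conv)
      with run_nonblank[OF 2(1), of "d + 1"]
      have f: "finite {j. snd (S2 (d + 1)) j \<noteq> 0}"
        "card {j. snd (S2 (d + 1)) j \<noteq> 0} \<le> length x + (4 * T + 3)"
        by auto
      have "(\<lambda>n. g 0 + int n) ` {..<length (F x)} \<subseteq> {j. snd (S2 (d + 1)) j \<noteq> 0}"
        unfolding 2(2) by (auto simp: out word_tape_def)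
      from card_mono[OF f(1) this] f(2) show ?thesis by (simp add: card_image inj_on_def)
    qed
    have "run (tm_call M d) S ((4 * length x + 4) + ((4 * T + 3) + (4 * length (F x) + 4))) S3"
      unfolding tm_call_def Let_def
      by (rule run_Seq[OF 1(1) run_Seq_assoc[OF run_Seq[OF 2(1) 3]]])
    moreover have "(4 * length x + 4) + ((4 * T + 3) + (4 * length (F x) + 4)) \<le> ?b (length x)"
      using len T(2) t(1) by simp
    moreover have "is_word S3 d (F x)" by (auto simp: S3_def is_word_def)
    moreover have "\<forall>i. i \<notin> {d..d + (?k + 2)} \<longrightarrow> S3 i = S i"
      using 1(4) 2(3) by (auto simp: S3_def)
    ultimately show "\<exists>t\<le>?b (length x). \<exists>S'. run (tm_call M d) S t S' \<and> is_word S' d (F x) \<and>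
        (\<forall>i. i \<notin> {d..d + (?k + 2)} \<longrightarrow> S' i = S i)" by blast
  qed
qed

section \<open>P and NP in terms of computable functions\<close>

lemma class_P_iff: "L \<in> class_P \<longleftrightarrow> computes_on UNIV (\<lambda>x. [x \<in> L])"
proof
  assume "L \<in> class_P"
  then obtain M p where "turing_machine M"
    "\<forall>x. \<exists>t y. t \<le> poly p (length x) \<and> halts_with M x t y \<and> y = [x \<in> L]"
    unfolding class_P_def poly_time_solvable_def by auto
  then show "computes_on UNIV (\<lambda>x. [x \<in> L])" by (intro computes_on_tm[of M _ p]) auto
next
  assume "computes_on UNIV (\<lambda>x. [x \<in> L])"
  then show "L \<in> class_P" unfolding class_P_def using poly_time_solvable_computes_on by blast
qed

lemma class_P_vimage:
  assumes "L \<in> class_P" "computes UNIV F"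
  shows "F -` L \<in> class_P"
  using computes_on_comp[OF computes_on_computes[OF assms(2)] assms(1)[unfolded class_P_iff]]
  by (simp add: class_P_iff)

text \<open>The verifier looks at the first component only; the zero polynomial leaves the empty
  word as the only witness.\<close>

lemma P_subset_NP: "class_P \<subseteq> class_NP"
proof
  fix L assume L: "L \<in> class_P"
  have "first -` L \<in> class_P" by (rule class_P_vimage[OF L computes_first])
  moreover have "x \<in> L \<longleftrightarrow> (\<exists>y. length y \<le> poly 0 (length x) \<and> enc_pair x y \<in> first -` L)" for x
    by simp
  ultimately show "L \<in> class_NP" unfolding class_NP_def by blast
qed

section \<open>Polynomial time on structured data\<close>

class enc =
  fixes encode :: "'a \<Rightarrow> bool list"
  assumes encode_inj: "encode x = encode y \<Longrightarrow> x = y"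

lemma inj_enc_pair: "enc_pair u v = enc_pair u' v' \<longleftrightarrow> u = u' \<and> v = v'"
  by (metis first_enc_pair second_enc_pair)

text \<open>A word that is its own code. A plain \<open>bool list\<close> is instead encoded as a
  list, element by element.\<close>

datatype raw = Raw (unraw: "bool list")

instantiation raw :: enc
begin
definition "encode r = unraw r"
instance by standard (simp add: encode_raw_def raw.expand)
end

instantiation bool :: enc
begin
definition "encode b = [b]"
instance by standard (simp add: encode_bool_def)
end

text \<open>Unary, so that polynomial in the size means polynomial in the value. This is adequate
  because the numbers that occur in building an instance are polynomially bounded; numbers in binary
  are treated as lists of bits.\<close>

instantiation nat :: enc
begin
definition "encode n = replicate n True"
instance by standard (metis encode_nat_def length_replicate)
end

instantiation prod :: (enc, enc) enc
begin
definition "encode p = enc_pair (encode (fst p)) (encode (snd p))"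
instance by standard (auto simp: encode_prod_def inj_enc_pair prod_eq_iff dest: encode_inj)
end

text \<open>\<open>enc_pair\<close> doubles only its first component, so nesting to the right keeps
  the code of a list linear in the codes of its elements.\<close>

instantiation list :: (enc) enc
begin
primrec encode_list :: "'a list \<Rightarrow> bool list" where
  "encode_list [] = [False]"
| "encode_list (x # xs) = True # enc_pair (encode x) (encode_list xs)"
instance
proof
  fix xs ys :: "'a list"
  show "encode xs = encode ys \<Longrightarrow> xs = ys"
  proof (induction xs arbitrary: ys)
    case Nil
    then show ?case by (cases ys) auto
  next
    case (Cons x xs)
    then show ?case by (cases ys) (auto simp: inj_enc_pair dest: encode_inj)
  qed
qed
end

abbreviation esize :: "'a :: enc \<Rightarrow> nat" where "esize x \<equiv> length (encode x)"

lemma esize_simps [simp]: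
  "esize (Raw w) = length w" "esize b = 1" "esize n = n"
  "esize (x, y) = 2 * esize x + 1 + esize y"
  "esize [] = 1" "esize (z # zs) = 2 * esize z + 2 + esize zs"
  for b :: bool and n :: nat and x :: "'a :: enc" and y :: "'b :: enc" and z :: "'c :: enc"
  by (simp_all add: encode_raw_def encode_bool_def encode_nat_def encode_prod_def length_enc_pair)

declare encode_list.simps [simp del]

definition polytime :: "('a :: enc \<Rightarrow> 'b :: enc) \<Rightarrow> bool" where
  "polytime f \<longleftrightarrow> (\<exists>F. computes (range (encode :: 'a \<Rightarrow> _)) F \<and> (\<forall>x. F (encode x) = encode (f x)))"

text \<open>Closure rules that follow the shape of a term, so that polynomial time of a function is
  mostly read off its definition.\<close>

named_theorems pt

lemma polytimeI:
  fixes f :: "'a :: enc \<Rightarrow> 'b :: enc"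
  assumes "computes (range (encode :: 'a \<Rightarrow> _)) F" "\<And>x. F (encode x) = encode (f x)"
  shows "polytime f"
  using assms unfolding polytime_def by blast

lemma polytimeE:
  fixes f :: "'a :: enc \<Rightarrow> 'b :: enc"
  assumes "polytime f"
  obtains F where "computes (range (encode :: 'a \<Rightarrow> _)) F" "\<And>x. F (encode x) = encode (f x)"
  using assms unfolding polytime_def by blast

lemma polytime_esize:
  assumes "polytime f"
  obtains p :: "nat poly" where "\<And>x. esize (f x) \<le> poly p (esize x)"
proof -
  obtain F where F: "computes (range (encode :: 'a \<Rightarrow> _)) F" "\<And>x. F (encode x) = encode (f x)"
    by (rule polytimeE[OF assms], rule that)
  obtain p where "\<And>w. w \<in> range (encode :: 'a \<Rightarrow> _) \<Longrightarrow> length (F w) \<le> poly p (length w)"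
    by (rule computes_length[OF F(1)], rule that)
  then have "esize (f x) \<le> poly p (esize x)" for x using F(2) by (metis rangeI)
  then show ?thesis by (rule that)
qed

lemma polytime_comp:
  fixes f :: "'a :: enc \<Rightarrow> 'b :: enc" and g :: "'b \<Rightarrow> 'c :: enc"
  assumes "polytime g" "polytime f"
  shows "polytime (\<lambda>x. g (f x))"
proof -
  obtain F where F: "computes (range (encode :: 'a \<Rightarrow> _)) F" "\<And>x. F (encode x) = encode (f x)"
    by (rule polytimeE[OF assms(2)], rule that)
  obtain G where G: "computes (range (encode :: 'b \<Rightarrow> _)) G" "\<And>x. G (encode x) = encode (g x)"
    by (rule polytimeE[OF assms(1)], rule that)
  show ?thesis
    by (rule polytimeI[OF computes_comp[OF F(1) G(1)]]) (auto simp: F(2) G(2))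
qed

lemma polytime_word:
  fixes f :: "'a :: enc \<Rightarrow> 'b :: enc" and h :: "'a \<Rightarrow> 'c :: enc"
  assumes "polytime f" "computes UNIV G" "\<And>x. G (encode (f x)) = encode (h x)"
  shows "polytime h"
proof -
  obtain F where F: "computes (range (encode :: 'a \<Rightarrow> _)) F" "\<And>x. F (encode x) = encode (f x)"
    by (rule polytimeE[OF assms(1)], rule that)
  show ?thesis
    by (rule polytimeI[OF computes_comp[OF F(1) assms(2)]]) (auto simp: F(2) assms(3))
qed

lemma computes_const: "computes X (\<lambda>x. w)"
proof (induction w)
  case (Cons b w)
  show ?case using computes_comp[OF Cons computes_Cons[of UNIV b]] by simp
qed (rule computes_Nil)

lemma polytime_id [pt]: "polytime (\<lambda>x. x)"
  by (rule polytimeI[OF computes_id]) simp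

lemma polytime_const [pt]: "polytime (\<lambda>x. c)"
  by (rule polytimeI[OF computes_const]) simp

lemma polytime_Pair [pt]:
  fixes f :: "'a :: enc \<Rightarrow> 'b :: enc" and g :: "'a \<Rightarrow> 'c :: enc"
  assumes "polytime f" "polytime g"
  shows "polytime (\<lambda>x. (f x, g x))"
proof -
  obtain F where F: "computes (range (encode :: 'a \<Rightarrow> _)) F" "\<And>x. F (encode x) = encode (f x)"
    by (rule polytimeE[OF assms(1)], rule that)
  obtain G where G: "computes (range (encode :: 'a \<Rightarrow> _)) G" "\<And>x. G (encode x) = encode (g x)"
    by (rule polytimeE[OF assms(2)], rule that)
  show ?thesis
    by (rule polytimeI[OF computes_pair[OF F(1) G(1)]]) (auto simp: F(2) G(2) encode_prod_def)
qed

lemma polytime_fst [pt]: "polytime f \<Longrightarrow> polytime (\<lambda>x. fst (f x))"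
  by (rule polytime_word[OF _ computes_first]) (auto simp: encode_prod_def)

lemma polytime_snd [pt]: "polytime f \<Longrightarrow> polytime (\<lambda>x. snd (f x))"
  by (rule polytime_word[OF _ computes_second]) (auto simp: encode_prod_def)

lemma polytime_if [pt]:
  fixes f :: "'a :: enc \<Rightarrow> 'b :: enc"
  assumes "polytime c" "polytime f" "polytime g"
  shows "polytime (\<lambda>x. if c x then f x else g x)"
proof -
  obtain F where F: "computes (range (encode :: 'a \<Rightarrow> _)) F" "\<And>x. F (encode x) = encode (f x)"
    by (rule polytimeE[OF assms(2)], rule that)
  obtain G where G: "computes (range (encode :: 'a \<Rightarrow> _)) G" "\<And>x. G (encode x) = encode (g x)"
    by (rule polytimeE[OF assms(3)], rule that)
  obtain C where C: "computes (range (encode :: 'a \<Rightarrow> _)) C" "\<And>x. C (encode x) = encode (c x)"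
    by (rule polytimeE[OF assms(1)], rule that)
  show ?thesis
    by (rule polytimeI[OF computes_cond[OF C(1) F(1) G(1)]])
      (auto simp: F(2) G(2) C(2) encode_bool_def)
qed

lemma polytime_Not [pt]:
  assumes "polytime f"
  shows "polytime (\<lambda>x. \<not> f x)"
proof -
  have "(\<lambda>x. \<not> f x) = (\<lambda>x. if f x then False else True)" by auto
  then show ?thesis by (simp only:) (intro pt assms)
qed

lemma polytime_conj [pt]:
  assumes "polytime f" "polytime g"
  shows "polytime (\<lambda>x. f x \<and> g x)"
proof -
  have "(\<lambda>x. f x \<and> g x) = (\<lambda>x. if f x then g x else False)" by auto
  then show ?thesis by (simp only:) (intro pt assms)
qed

lemma polytime_disj [pt]: "polytime f \<Longrightarrow> polytime g \<Longrightarrow> polytime (\<lambda>x. f x \<or> g x)"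
  using polytime_Not[OF polytime_conj[OF polytime_Not polytime_Not], of f g] by simp

lemma polytime_imp [pt]: "polytime f \<Longrightarrow> polytime g \<Longrightarrow> polytime (\<lambda>x. f x \<longrightarrow> g x)"
  using polytime_disj[OF polytime_Not, of f g] by simp

lemma computes_head: "computes X (\<lambda>w. [w \<noteq> [] \<and> hd w])"
proof -
  have "(\<lambda>w. [w \<noteq> [] \<and> hd w]) = (\<lambda>w. if w \<noteq> [] \<and> hd w then [True] else [False])" by auto
  then show ?thesis by (simp only:) (rule computes_cond[OF computes_id computes_const
    computes_const])
qed

lemma computes_nonempty: "computes X (\<lambda>w. [w \<noteq> []])"
proof -
  have "computes X (\<lambda>w. enc_pair w [])" by (intro computes_pair computes_id computes_Nil)
  from computes_comp[OF this computes_head[of UNIV]]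
  have "computes X (\<lambda>w. [enc_pair w [] \<noteq> [] \<and> hd (enc_pair w [])])" by simp
  moreover have "enc_pair w [] \<noteq> [] \<and> hd (enc_pair w []) \<longleftrightarrow> w \<noteq> []" for w
    by (cases w) (auto simp: enc_pair_def enc_word_pairs pairs_def)
  ultimately show ?thesis by simp
qed

lemma polytime_Cons [pt]:
  assumes "polytime f" "polytime g"
  shows "polytime (\<lambda>x. f x # g x)"
  by (rule polytime_word[OF polytime_Pair[OF assms] computes_Cons[of _ True]])
    (simp add: encode_prod_def encode_list.simps)

lemma polytime_null [pt]: "polytime f \<Longrightarrow> polytime (\<lambda>x. f x = [])"
proof -
  assume "polytime f"
  then have "polytime (\<lambda>x. f x \<noteq> [])"
    by (rule polytime_word[OF _ computes_head])
      (case_tac "f x"; simp add: encode_bool_def encode_list.simps)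
  from polytime_Not[OF this] show ?thesis by simp
qed

text \<open>The first letter of the code tells whether the list is empty. In that case the result is
  a fixed value, possibly an unspecified one such as \<open>hd []\<close>, whose code
  \<open>encode d\<close> is hard-wired.\<close>

lemma polytime_list_word:
  fixes f :: "'a :: enc \<Rightarrow> 'b :: enc list" and h :: "'a \<Rightarrow> 'c :: enc"
  assumes "polytime f" "computes UNIV G" "\<And>x y ys. f x = y # ys \<Longrightarrow> G (encode (f x)) = encode (h x)"
    "\<And>x. f x = [] \<Longrightarrow> h x = d"
  shows "polytime h"
proof -
  obtain F where F: "computes (range (encode :: 'a \<Rightarrow> _)) F" "\<And>x. F (encode x) = encode (f x)"
    by (rule polytimeE[OF assms(1)], rule that)
  have "computes (range (encode :: 'a \<Rightarrow> _)) (\<lambda>w. G (F w))"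
    by (rule computes_comp[OF F(1) assms(2)]) simp
  from computes_cond[OF F(1) this computes_const[of _ "encode d"]] show ?thesis
  proof (rule polytimeI)
    fix x
    show "(if F (encode x) \<noteq> [] \<and> hd (F (encode x)) then G (F (encode x))
      else encode d) = encode (h x)"
      using assms(3,4)[of x] by (cases "f x") (auto simp: F(2) encode_list.simps)
  qed
qed

lemma polytime_hd [pt]: "polytime f \<Longrightarrow> polytime (\<lambda>x. hd (f x))"
  by (rule polytime_list_word[where f = f and d =
    "hd []", OF _ computes_comp[OF computes_tl computes_first]])
    (auto simp: encode_list.simps)

lemma polytime_tl [pt]: "polytime f \<Longrightarrow> polytime (\<lambda>x. tl (f x))"
  by (rule polytime_list_word[where f = f and d =
    "[]", OF _ computes_comp[OF computes_tl computes_second]])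
    (auto simp: encode_list.simps)

lemma polytime_Suc [pt]: "polytime f \<Longrightarrow> polytime (\<lambda>x. Suc (f x))"
  by (rule polytime_word[OF _ computes_Cons[of _ True]]) (auto simp: encode_nat_def)

lemma polytime_pred: "polytime f \<Longrightarrow> polytime (\<lambda>x. f x - Suc 0)"
  by (rule polytime_word[OF _ computes_tl]) (auto simp: encode_nat_def)

lemma polytime_is_0: "polytime f \<Longrightarrow> polytime (\<lambda>x. f x = (0 :: nat))"
proof -
  assume "polytime f"
  then have "polytime (\<lambda>x. f x \<noteq> 0)"
    by (rule polytime_word[OF _ computes_head])
      (case_tac "f x"; simp add: encode_nat_def encode_bool_def)
  from polytime_Not[OF this] show ?thesis by simp
qed

section \<open>Operations on raw words\<close>

definition rnull :: "raw \<Rightarrow> bool" where "rnull r \<longleftrightarrow> unraw r = []"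
definition rhd :: "raw \<Rightarrow> bool" where "rhd r \<longleftrightarrow> unraw r \<noteq> [] \<and> hd (unraw r)"
definition rtl :: "raw \<Rightarrow> raw" where "rtl r = Raw (tl (unraw r))"
definition rcons :: "bool \<Rightarrow> raw \<Rightarrow> raw" where "rcons b r = Raw (b # unraw r)"
definition rfirst :: "raw \<Rightarrow> raw" where "rfirst r = Raw (first (unraw r))"
definition rsecond :: "raw \<Rightarrow> raw" where "rsecond r = Raw (second (unraw r))"

lemmas raw_defs = rnull_def rhd_def rtl_def rcons_def rfirst_def rsecond_def

lemma polytime_raw [pt]:
  "polytime f \<Longrightarrow> polytime (\<lambda>x. rtl (f x))"
  "polytime f \<Longrightarrow> polytime (\<lambda>x. rfirst (f x))"
  "polytime f \<Longrightarrow> polytime (\<lambda>x. rsecond (f x))"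
  "polytime f \<Longrightarrow> polytime (\<lambda>x. rhd (f x))"
  "polytime f \<Longrightarrow> polytime (\<lambda>x. rnull (f x))"
proof -
  assume f: "polytime f"
  show "polytime (\<lambda>x. rtl (f x))" "polytime (\<lambda>x. rfirst (f x))" "polytime (\<lambda>x. rsecond (f x))"
    "polytime (\<lambda>x. rhd (f x))"
    by (rule polytime_word[OF f computes_tl] polytime_word[OF f computes_first]
        polytime_word[OF f computes_second] polytime_word[OF f computes_head];
        simp add: raw_defs encode_raw_def encode_bool_def)+
  have "polytime (\<lambda>x. \<not> rnull (f x))"
    by (rule polytime_word[OF f computes_nonempty])
      (simp add: raw_defs encode_raw_def encode_bool_def)
  from polytime_Not[OF this] show "polytime (\<lambda>x. rnull (f x))" by simp
qed

lemma polytime_rcons [pt]: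
  assumes "polytime b" "polytime f"
  shows "polytime (\<lambda>x. rcons (b x) (f x))"
proof -
  have c: "polytime (\<lambda>x. rcons c (f x))" for c
    by (rule polytime_word[OF assms(2) computes_Cons]) (simp add: raw_defs encode_raw_def)
  have "(\<lambda>x. rcons (b x) (f x)) = (\<lambda>x. if b x then rcons True (f x) else rcons False (f x))" by auto
  then show ?thesis by (simp only:) (intro pt assms c)
qed

lemma polytime_Raw: "polytime f \<Longrightarrow> polytime (\<lambda>x. Raw (encode (f x)))"
  by (rule polytime_word[OF _ computes_id]) (auto simp: encode_raw_def)

lemma polytime_add [pt]: "polytime f \<Longrightarrow> polytime g \<Longrightarrow> polytime (\<lambda>x. f x + g x :: nat)"
  by (rule polytime_word[OF polytime_Pair computes_append, of f g])
    (auto simp: encode_prod_def encode_nat_def replicate_add)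

text \<open>The code of a pair has the form that \<open>computes_funpow\<close> expects, and the
  code of \<open>c x\<close> acts as the counter; only its length counts.\<close>

lemma polytime_funpow0:
  fixes s :: "'a :: enc \<Rightarrow> 'a" and i :: "'x :: enc \<Rightarrow> 'a" and c :: "'x \<Rightarrow> 'c :: enc"
  assumes s: "polytime s" and i: "polytime i" and c: "polytime c"
    and B: "\<And>x k. k \<le> esize (c x) \<Longrightarrow> esize ((s ^^ k) (i x)) \<le> poly q (esize (c x, i x))"
  shows "polytime (\<lambda>x. (s ^^ esize (c x)) (i x))"
proof -
  obtain G where G: "computes (range (encode :: 'a \<Rightarrow> _)) G" "\<And>x. G (encode x) = encode (s x)"
    by (rule polytimeE[OF s], rule that)
  obtain F where F: "computes (range (encode :: 'x \<Rightarrow> _)) F" "\<And>x. F (encode x) = encode (c x, i x)"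
    by (rule polytimeE[OF polytime_Pair[OF c i]], rule that)
  have pow: "(G ^^ k) (encode a) = encode ((s ^^ k) a)" for k a
    using G(2) by (induction k) auto
  let ?H = "\<lambda>w. (G ^^ length (first w)) (second w)"
  let ?X = "range (\<lambda>x. encode (c x, i x))"
  have "computes ?X ?H"
  proof (rule computes_funpow[OF G(1)])
    fix w k assume "w \<in> ?X"
    then obtain x where x: "first w = encode (c x)" "second w = encode (i x)"
      "w = encode (c x, i x)"
      by (auto simp: encode_prod_def)
    show "(G ^^ k) (second w) \<in> range (encode :: 'a \<Rightarrow> _)" unfolding x(2) pow by simp
    show "length ((G ^^ k) (second w)) \<le> poly q (length w)" if "k \<le> length (first w)"
      using that B[of k x] x(3) unfolding x(1,2) pow by simp
  qed
  then have "computes (range (encode :: 'x \<Rightarrow> _)) (\<lambda>w. ?H (F w))"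
    by (rule computes_comp[OF F(1)]) (use F in auto)
  then show ?thesis
    by (rule polytimeI) (use F(2) in \<open>simp add: pow encode_prod_def\<close>)
qed

text \<open>The step may depend on \<open>x\<close>, which is therefore carried along unchanged in
  the iterated state.\<close>

lemma polytime_funpow:
  fixes s :: "'x :: enc \<Rightarrow> 'a :: enc \<Rightarrow> 'a" and i :: "'x \<Rightarrow> 'a" and c :: "'x \<Rightarrow> 'c :: enc"
  assumes s: "polytime (\<lambda>p. s (fst p) (snd p))" and i: "polytime i" and c: "polytime c"
    and "pb B" "\<And>x k. k \<le> esize (c x) \<Longrightarrow> esize ((s x ^^ k) (i x)) \<le> B (esize x)"
  shows "polytime (\<lambda>x. (s x ^^ esize (c x)) (i x))"
proof -
  obtain q where q: "\<forall>n. B n \<le> poly q n" using assms(4) by (auto simp: pb_def)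
  let ?s = "\<lambda>p. (fst p, s (fst p) (snd p))"
  have pow: "(?s ^^ k) (x, a) = (x, (s x ^^ k) a)" for k x a
    by (induction k) auto
  have "polytime (\<lambda>x. (?s ^^ esize (c x)) (x, i x))"
  proof (rule polytime_funpow0[where q = "q + [:1, 2:]"])
    fix x k assume "k \<le> esize (c x)"
    then have "esize ((s x ^^ k) (i x)) \<le> poly q (esize x)"
      using assms(5) q order_trans by blast
    moreover have "poly q (esize x) \<le> poly q (esize (c x, x, i x))" by (rule poly_nat_mono) simp
    ultimately show "esize ((?s ^^ k) (x, i x)) \<le> poly (q + [:1, 2:]) (esize (c x, x, i x))"
      by (simp add: pow)
  qed (intro pt s i c)+
  from polytime_snd[OF this] show ?thesis by (simp add: pow)
qed

lemma esize_pos [simp]: "0 < esize (xs :: 'a :: enc list)"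
  by (cases xs) auto

lemma length_le_esize: "length (xs :: 'a :: enc list) \<le> esize xs"
  by (induction xs) auto

lemma esize_sum: "esize (xs :: 'a :: enc list) = 1 + (\<Sum>x\<leftarrow>xs. 2 * esize x + 2)"
  by (induction xs) auto

lemma esize_append: "esize (xs @ ys) + 1 = esize xs + esize (ys :: 'a :: enc list)"
  by (induction xs) auto

lemma esize_rev [simp]: "esize (rev (xs :: 'a :: enc list)) = esize xs"
  by (simp add: esize_sum rev_map[symmetric])

lemma esize_drop: "esize (drop k (xs :: 'a :: enc list)) \<le> esize xs"
  using esize_append[of "take k xs" "drop k xs"] esize_pos[of "take k xs"]
  unfolding append_take_drop_id by linarith

lemma esize_take: "esize (take k (xs :: 'a :: enc list)) \<le> esize xs"
  using esize_append[of "take k xs" "drop k xs"] esize_pos[of "drop k xs"]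
  unfolding append_take_drop_id by linarith

lemma esize_mem: "x \<in> set xs \<Longrightarrow> esize x \<le> esize (xs :: 'a :: enc list)"
  by (induction xs) auto

text \<open>The step is iterated as often as the code of the list has letters, which is at least the
  number of elements; surplus rounds find an empty list and change nothing. The size bound is
  required for every prefix.\<close>

lemma polytime_foldl:
  assumes s: "polytime (\<lambda>p. s (fst p) (fst (snd p)) (snd (snd p)))" and i: "polytime i"
    and xs: "polytime xs" and B: "pb B"
    "\<And>x k. k \<le> length (xs x) \<Longrightarrow> esize (foldl (s x) (i x) (take k (xs x))) \<le> B (esize x)"
  shows "polytime (\<lambda>x. foldl (s x) (i x) (xs x))"
proof -
  obtain l where l: "\<And>x. esize (xs x) \<le> poly l (esize x)" by (rule polytime_esize[OF xs], rule that)
  let ?s = "\<lambda>x a. if fst a = [] then a else (tl (fst a), s x (snd a) (hd (fst a)))"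
  have pow: "(?s x ^^ k) (ys, a) = (drop k ys, foldl (s x) a (take k ys))" for x k ys a
  proof (induction k)
    case (Suc k)
    show ?case
    proof (cases "k < length ys")
      case True
      then show ?thesis using Suc
        by (simp add: take_Suc_conv_app_nth drop_Suc tl_drop hd_drop_conv_nth)
    qed (use Suc in simp)
  qed simp
  have 1: "polytime (\<lambda>p. ?s (fst p) (snd p))"
    using polytime_comp[OF s, of "\<lambda>p. (fst p, snd (snd p), hd (fst (snd p)))"] by (simp add: pt)
  have 2: "pb (\<lambda>n. 2 * poly l n + 1 + B n)" by (intro pb_intros B)
  have 3: "polytime (\<lambda>x. (xs x, i x))" by (intro pt xs i)
  have "polytime (\<lambda>x. (?s x ^^ esize (xs x)) (xs x, i x))"
  proof (rule polytime_funpow[OF 1 3 xs 2])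
    fix x k
    have "esize (foldl (s x) (i x) (take k (xs x))) \<le> B (esize x)"
      using B(2)[of "min k (length (xs x))" x] by (cases "k \<le> length (xs x)") auto
    then show "esize ((?s x ^^ k) (xs x, i x)) \<le> 2 * poly l (esize x) + 1 + B (esize x)"
      using l[of x] esize_drop[of k "xs x"] by (simp add: pow)
  qed
  from polytime_snd[OF this] show ?thesis
    by (simp add: pow take_all[OF length_le_esize])
qed

lemma foldl_Cons: "foldl (\<lambda>a e. f e # a) a xs = rev (map f xs) @ a"
  by (induction xs arbitrary: a) auto

lemma polytime_rev [pt]: 
  assumes "polytime f"
  shows "polytime (\<lambda>x. rev (f x))"
proof -
  obtain l where l: "\<And>x. esize (f x) \<le> poly l (esize x)"
    by (rule polytime_esize[OF assms], rule that)
  have "polytime (\<lambda>x. foldl (\<lambda>a e. e # a) [] (f x))"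
    by (rule polytime_foldl[where B = "poly l"])
      (use l esize_take le_trans in \<open>fastforce intro: pt assms pb_poly simp: foldl_Cons[of
        "\<lambda>e. e"]\<close>)+
  then show ?thesis by (simp add: foldl_Cons[of "\<lambda>e. e"])
qed

lemma polytime_append [pt]: 
  assumes "polytime f" "polytime g"
  shows "polytime (\<lambda>x. f x @ g x)"
proof -
  obtain l where l: "\<And>x. esize (f x) \<le> poly l (esize x)"
    by (rule polytime_esize[OF assms(1)], rule that)
  obtain m where m: "\<And>x. esize (g x) \<le> poly m (esize x)"
    by (rule polytime_esize[OF assms(2)], rule that)
  have "polytime (\<lambda>x. foldl (\<lambda>a e. e # a) (g x) (rev (f x)))"
  proof (rule polytime_foldl)
    show "pb (\<lambda>n. poly l n + poly m n)" by (intro pb_intros)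
    fix x k
    have "esize (rev (take k (rev (f x))) @ g x) + 1 \<le> esize (f x) + esize (g x)"
      unfolding esize_append using esize_take[of k "rev (f x)"] by simp
    then show "esize (foldl (\<lambda>a e. e # a) (g x) (take k (rev (f x)))) \<le>
      poly l (esize x) + poly m (esize x)"
      using l[of x] m[of x] by (simp add: foldl_Cons[of "\<lambda>e. e"])
  qed (intro pt assms)+
  then show ?thesis by (simp add: foldl_Cons[of "\<lambda>e. e"])
qed

lemma polytime_map [pt]: 
  assumes f: "polytime (\<lambda>p. f (fst p) (snd p))" and xs: "polytime xs"
  shows "polytime (\<lambda>x. map (f x) (xs x))"
proof -
  obtain l where l: "\<And>x. esize (xs x) \<le> poly l (esize x)" by (rule polytime_esize[OF xs], rule that)
  obtain m where m: "\<And>p. esize (f (fst p) (snd p)) \<le> poly m (esize p)"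
    by (rule polytime_esize[OF f], rule that)
  let ?M = "\<lambda>n. 2 * poly m (2 * n + 1 + poly l n) + 2"
  have "polytime (\<lambda>x. foldl (\<lambda>a e. f x e # a) [] (xs x))"
  proof (rule polytime_foldl)
    show "pb (\<lambda>n. 1 + poly l n * ?M n)" by (intro pb_intros)
    have "polytime (\<lambda>p. f (fst p) (snd (snd p)))"
      using polytime_comp[OF f, of "\<lambda>p. (fst p, snd (snd p))"] by (simp add: pt)
    then show "polytime (\<lambda>p. f (fst p) (snd (snd p)) # fst (snd p))" by (intro pt)
    fix x k
    let ?ys = "take k (xs x)"
    have "2 * esize (f x e) + 2 \<le> ?M (esize x)" if "e \<in> set ?ys" for e
    proof -
      have "esize e \<le> poly l (esize x)" using l[of x] esize_mem[OF in_set_takeD[OF that]] by simp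
      then have "poly m (esize (x, e)) \<le> poly m (2 * esize x + 1 + poly l (esize x))"
        by (intro poly_nat_mono) simp
      then show ?thesis using m[of "(x, e)"] by simp
    qed
    then have "(\<Sum>e\<leftarrow>?ys. 2 * esize (f x e) + 2) \<le> (\<Sum>e\<leftarrow>?ys. ?M (esize x))" by (rule sum_list_mono)
    also have "\<dots> = length ?ys * ?M (esize x)" by (simp add: sum_list_triv)
    also have "\<dots> \<le> poly l (esize x) * ?M (esize x)"
      using l[of x] length_le_esize[of "xs x"] by (intro mult_mono) auto
    finally have "(\<Sum>e\<leftarrow>?ys. 2 * esize (f x e) + 2) \<le> poly l (esize x) * ?M (esize x)" .
    moreover have "esize (map (f x) ?ys) = 1 + (\<Sum>e\<leftarrow>?ys. 2 * esize (f x e) + 2)"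
      by (simp add: esize_sum comp_def)
    ultimately show "esize (foldl (\<lambda>a e. f x e # a) [] ?ys) \<le> 1 + poly l (esize x) * ?M (esize x)"
      unfolding foldl_Cons append_Nil2 esize_rev by simp
  qed (intro pt xs)+
  from polytime_rev[OF this] show ?thesis by (simp add: foldl_Cons)
qed

lemma polytime_concat [pt]:
  fixes f :: "'a :: enc \<Rightarrow> 'c :: enc list list"
  assumes "polytime f"
  shows "polytime (\<lambda>x. concat (f x))"
proof -
  obtain l where l: "\<And>x. esize (f x) \<le> poly l (esize x)"
    by (rule polytime_esize[OF assms], rule that)
  have fc: "foldl (\<lambda>a e. a @ e) a xss = a @ concat xss" for a :: "'c list" and xss
    by (induction xss arbitrary: a) auto
  have sz: "esize (concat xss) \<le> esize xss" for xss :: "'c list list"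
  proof (induction xss)
    case (Cons xs xss)
    then show ?case using esize_append[of xs "concat xss"] by simp
  qed simp
  have "polytime (\<lambda>x. foldl (\<lambda>a e. a @ e) [] (f x))"
  proof (rule polytime_foldl)
    fix x k
    show "esize (foldl (\<lambda>a e. a @ e) [] (take k (f x))) \<le> poly l (esize x)"
      unfolding fc using sz[of "take k (f x)"] esize_take[of k "f x"] l[of x] by simp
  qed (intro pt assms pb_poly)+
  then show ?thesis by (simp add: fc)
qed

lemma polytime_filter [pt]:
  assumes P: "polytime (\<lambda>p. P (fst p) (snd p))" and xs: "polytime xs"
  shows "polytime (\<lambda>x. filter (P x) (xs x))"
proof -
  have "filter Q ys = concat (map (\<lambda>e. if Q e then [e] else []) ys)" for Q :: "'c \<Rightarrow> bool" and ys
    by (induction ys) auto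
  then have "(\<lambda>x. filter (P x) (xs x)) = (\<lambda>x. concat (map (\<lambda>e. if P x e then [e]
    else []) (xs x)))" by auto
  then show ?thesis by (simp only:) (intro pt P xs)
qed

lemma polytime_ball [pt]:
  assumes P: "polytime (\<lambda>p. P (fst p) (snd p))" and xs: "polytime xs"
  shows "polytime (\<lambda>x. \<forall>e\<in>set (xs x). P x e)"
proof -
  have "polytime (\<lambda>x. filter (\<lambda>e. \<not> P x e) (xs x) = [])" by (intro pt P xs)
  then show ?thesis by (simp add: filter_empty_conv)
qed

lemma polytime_length [pt]:
  assumes "polytime f"
  shows "polytime (\<lambda>x. length (f x))"
proof -
  obtain l where l: "\<And>x. esize (f x) \<le> poly l (esize x)"
    by (rule polytime_esize[OF assms], rule that)
  have fc: "foldl (\<lambda>a e. Suc a) n ys = n + length ys" for n and ys :: "'b list"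
    by (induction ys arbitrary: n) auto
  have "polytime (\<lambda>x. foldl (\<lambda>a e. Suc a) 0 (f x))"
  proof (rule polytime_foldl)
    fix x k
    show "esize (foldl (\<lambda>a e. Suc a) 0 (take k (f x))) \<le> poly l (esize x)"
      unfolding fc using length_le_esize[of "f x"] l[of x] by simp
  qed (intro pt assms pb_poly)+
  then show ?thesis by (simp add: fc)
qed

lemma polytime_funpow_nat:
  fixes s :: "'x :: enc \<Rightarrow> 'a :: enc \<Rightarrow> 'a" and i :: "'x \<Rightarrow> 'a" and c :: "'x \<Rightarrow> nat"
  assumes "polytime (\<lambda>p. s (fst p) (snd p))" "polytime i" "polytime c"
    and "pb B" "\<And>x k. k \<le> c x \<Longrightarrow> esize ((s x ^^ k) (i x)) \<le> B (esize x)"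
  shows "polytime (\<lambda>x. (s x ^^ c x) (i x))"
  using polytime_funpow[OF assms(1-4)] assms(5) by simp

lemma polytime_drop [pt]:
  assumes "polytime f" "polytime g"
  shows "polytime (\<lambda>x. drop (f x) (g x))"
proof -
  obtain l where l: "\<And>x. esize (g x) \<le> poly l (esize x)"
    by (rule polytime_esize[OF assms(2)], rule that)
  have pow: "(tl ^^ k) ys = drop k ys" for k and ys :: "'b list"
    by (induction k) (auto simp: drop_Suc tl_drop)
  have "polytime (\<lambda>x. (tl ^^ f x) (g x))"
  proof (rule polytime_funpow_nat)
    fix x k show "esize ((tl ^^ k) (g x)) \<le> poly l (esize x)"
      unfolding pow using l[of x] esize_drop[of k "g x"] by simp
  qed (intro pt assms pb_poly)+
  then show ?thesis by (simp add: pow)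
qed

lemma polytime_diff [pt]:
  assumes "polytime f" "polytime g"
  shows "polytime (\<lambda>x. f x - g x :: nat)"
proof -
  obtain l where l: "\<And>x. esize (f x) \<le> poly l (esize x)"
    by (rule polytime_esize[OF assms(1)], rule that)
  have pow: "((\<lambda>n. n - Suc 0) ^^ k) m = m - k" for k m by (induction k) auto
  have "polytime (\<lambda>x. ((\<lambda>n. n - Suc 0) ^^ g x) (f x))"
  proof (rule polytime_funpow_nat)
    fix x k show "esize (((\<lambda>n. n - Suc 0) ^^ k) (f x)) \<le> poly l (esize x)"
      unfolding pow using l[of x] by simp
  qed (intro pt polytime_pred assms pb_poly)+
  then show ?thesis by (simp add: pow)
qed

lemma polytime_mult [pt]:
  assumes "polytime f" "polytime g"
  shows "polytime (\<lambda>x. f x * g x :: nat)"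
proof -
  obtain l where l: "\<And>x. esize (f x) \<le> poly l (esize x)"
    by (rule polytime_esize[OF assms(1)], rule that)
  obtain m where m: "\<And>x. esize (g x) \<le> poly m (esize x)"
    by (rule polytime_esize[OF assms(2)], rule that)
  have pow: "(((+) n) ^^ k) 0 = n * k" for n k :: nat by (induction k) auto
  have "polytime (\<lambda>x. ((\<lambda>a. f x + a) ^^ g x) 0)"
  proof (rule polytime_funpow_nat)
    show "pb (\<lambda>n. poly l n * poly m n)" by (intro pb_intros)
    show "polytime (\<lambda>p. f (fst p) + snd p)"
      by (intro pt polytime_comp[OF assms(1)])
    fix x k assume "k \<le> g x"
    then show "esize (((+) (f x) ^^ k) 0) \<le> poly l (esize x) * poly m (esize x)"
      unfolding pow using l[of x] m[of x] by (auto intro: mult_mono)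
  qed (intro pt assms)+
  then show ?thesis by (simp add: pow)
qed

lemma polytime_le [pt]: "polytime f \<Longrightarrow> polytime g \<Longrightarrow> polytime (\<lambda>x. f x \<le> (g x :: nat))"
  using polytime_is_0[OF polytime_diff, of f g] by simp

lemma polytime_less [pt]: "polytime f \<Longrightarrow> polytime g \<Longrightarrow> polytime (\<lambda>x. f x < (g x :: nat))"
  using polytime_Not[OF polytime_le, of g f] by (simp add: not_le)

lemma polytime_upt [pt]:
  assumes "polytime f"
  shows "polytime (\<lambda>x. [0..<f x])"
proof -
  obtain l where l: "\<And>x. esize (f x) \<le> poly l (esize x)"
    by (rule polytime_esize[OF assms], rule that)
  let ?s = "\<lambda>p. (fst p - Suc 0, (fst p - Suc 0) # snd p)"
  have pow: "k \<le> n \<Longrightarrow> (?s ^^ k) (n, []) = (n - k, [n - k..<n])" for k n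
  proof (induction k)
    case (Suc k)
    then have "[n - Suc k..<n] = (n - Suc k) # [n - k..<n]"
      by (metis Suc_diff_Suc Suc_le_lessD diff_Suc_less upt_conv_Cons gr_implies_not0 not_gr_zero)
    then show ?case using Suc by simp
  qed simp
  have "polytime (\<lambda>x. (?s ^^ f x) (f x, []))"
  proof (rule polytime_funpow_nat)
    show "pb (\<lambda>n. 2 * poly l n + 1 + (1 + poly l n * (2 * poly l n + 2)))" by (intro pb_intros)
    fix x k assume k: "k \<le> f x"
    have fx: "f x \<le> poly l (esize x)" using l[of x] by simp
    have "(\<Sum>e\<leftarrow>[f x - k..<f x]. 2 * e + 2) \<le> (\<Sum>e\<leftarrow>[f x - k..<f x]. 2 * f x + 2)"
      by (rule sum_list_mono) auto
    also have "\<dots> = k * (2 * f x + 2)" using k by (simp add: sum_list_triv)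
    also have "\<dots> \<le> poly l (esize x) * (2 * poly l (esize x) + 2)"
      using k fx by (intro mult_mono) auto
    finally have "esize [f x - k..<f x] \<le> 1 + poly l (esize x) * (2 * poly l (esize x) + 2)"
      unfolding esize_sum by simp
    then show "esize ((?s ^^ k) (f x, [])) \<le> 2 * poly l (esize x) + 1 +
      (1 + poly l (esize x) * (2 * poly l (esize x) + 2))"
      using fx k by (simp add: pow)
  qed (intro pt polytime_pred assms)+
  from polytime_snd[OF this] show ?thesis by (simp add: pow)
qed

text \<open>Both words are consumed in parallel until one of them is empty. They are equal if no
  mismatch has been recorded and both are then empty.\<close>

lemma polytime_raw_eq:
  assumes "polytime f" "polytime g"
  shows "polytime (\<lambda>x. unraw (f x) = unraw (g x))"
proof -
  obtain l where l: "\<And>x. esize (f x) \<le> poly l (esize x)"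
    by (rule polytime_esize[OF assms(1)], rule that)
  obtain m where m: "\<And>x. esize (g x) \<le> poly m (esize x)"
    by (rule polytime_esize[OF assms(2)], rule that)
  let ?s = "\<lambda>p. if rnull (fst p) \<or> rnull (fst (snd p)) then p
     else (rtl (fst p), rtl (fst (snd p)), snd (snd p) \<and> (rhd (fst p) \<longrightarrow> rhd (fst (snd p))) \<and>
       (rhd (fst (snd p)) \<longrightarrow> rhd (fst p)))"
  let ?r = "\<lambda>p. snd (snd p) \<and> rnull (fst p) \<and> rnull (fst (snd p))"
  have pow: "length (unraw (fst ((?s ^^ k) p))) \<le> length (unraw (fst p)) \<and>
      length (unraw (fst (snd ((?s ^^ k) p)))) \<le> length (unraw (fst (snd p)))" for k p
    by (induction k) (auto simp: raw_defs)
  have res: "?r ((?s ^^ length u) (Raw u, Raw v, b)) \<longleftrightarrow> b \<and> u = v" for u v b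
  proof (induction u arbitrary: v b)
    case Nil
    then show ?case by (auto simp: raw_defs)
  next
    case (Cons c u)
    have fix_s: "(?s ^^ k) (u, Raw [], b) = (u, Raw [], b)" for k u b
      by (induction k) (auto simp: raw_defs)
    show ?case
    proof (cases v)
      case Nil
      then show ?thesis using fix_s[of "Suc (length u)" "Raw (c # u)" b]
        by (simp del: funpow.simps) (simp add: raw_defs)
    next
      case (Cons d w)
      have "?s (Raw (c # u), Raw (d # w), b) = (Raw u, Raw w, b \<and> (c \<longleftrightarrow> d))"
        by (auto simp: raw_defs)
      then show ?thesis using Cons.IH[of w "b \<and> (c \<longleftrightarrow> d)"] Cons
        by (simp del: funpow.simps add: funpow_Suc_right)
    qed
  qed
  have s: "polytime ?s" by (intro pt)
  have "polytime (\<lambda>x. (?s ^^ esize (f x)) (f x, g x, True))"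
  proof (rule polytime_funpow)
    show "pb (\<lambda>n. 2 * poly l n + 1 + (2 * poly m n + 1 + 1))" by (intro pb_intros)
    show "polytime (\<lambda>p. ?s (snd p))" by (rule polytime_comp[OF s]) (intro pt)
    fix x k
    obtain u v b where p: "(?s ^^ k) (f x, g x, True) = (u, v, b)" by (rule prod_cases3)
    then show "esize ((?s ^^ k) (f x, g x, True)) \<le>
      2 * poly l (esize x) + 1 + (2 * poly m (esize x) + 1 + 1)"
      using pow[of k "(f x, g x, True)"] l[of x] m[of x] unfolding p
      by (simp add: encode_raw_def)
  qed (intro pt assms)+
  then have "polytime (\<lambda>x. ?r ((?s ^^ esize (f x)) (f x, g x, True)))"
    by (rule polytime_comp[of ?r, rotated]) (intro pt)
  moreover have "?r ((?s ^^ esize (f x)) (f x, g x, True)) = (unraw (f x) = unraw (g x))" for x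
    using res[of "unraw (f x)" "unraw (g x)" True] by (simp add: encode_raw_def)
  ultimately show ?thesis by simp
qed

text \<open>Equality of values is equality of their codes, by injectivity, so comparing words
  settles it for all types at once.\<close>

lemma polytime_eq [pt]:
  assumes "polytime f" "polytime g"
  shows "polytime (\<lambda>x. f x = g x)"
proof -
  have "polytime (\<lambda>x. unraw (Raw (encode (f x))) = unraw (Raw (encode (g x))))"
    by (rule polytime_raw_eq; rule polytime_Raw; rule assms)
  moreover have "(encode (f x) = encode (g x)) = (f x = g x)" for x by (auto dest: encode_inj)
  ultimately show ?thesis by simp
qed

lemma polytime_unraw [pt]:
  assumes "polytime f"
  shows "polytime (\<lambda>x. unraw (f x))"
proof -
  obtain l where l: "\<And>x. esize (f x) \<le> poly l (esize x)"
    by (rule polytime_esize[OF assms], rule that)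
  let ?s = "\<lambda>p. (rtl (fst p), rhd (fst p) # snd p)"
  have pow: "k \<le> length (unraw r) \<Longrightarrow> (?s ^^ k) (r, []) =
    (Raw (drop k (unraw r)), rev (take k (unraw r)))" for k r
    by (induction k) (auto simp: raw_defs drop_Suc tl_drop take_Suc_conv_app_nth hd_drop_conv_nth)
  have "polytime (\<lambda>x. (?s ^^ esize (f x)) (f x, []))"
  proof (rule polytime_funpow)
    show "pb (\<lambda>n. 2 * poly l n + 1 + (1 + poly l n * 4))" by (intro pb_intros)
    fix x k assume k: "k \<le> esize (f x)"
    have "esize (take k (unraw (f x))) = 1 + k * 4"
      using k unfolding esize_sum by (simp add: sum_list_triv encode_raw_def)
    then show "esize ((?s ^^ k) (f x, [])) \<le> 2 * poly l (esize x) + 1 + (1 + poly l (esize x) * 4)"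
      using k l[of x] by (simp add: pow encode_raw_def)
  qed (intro pt assms)+
  from polytime_rev[OF polytime_snd[OF this]] show ?thesis by (simp add: pow encode_raw_def)
qed

lemma polytime_raw_of_bits [pt]:
  assumes "polytime f"
  shows "polytime (\<lambda>x. Raw (f x))"
proof -
  obtain l where l: "\<And>x. esize (f x) \<le> poly l (esize x)"
    by (rule polytime_esize[OF assms], rule that)
  have fc: "foldl (\<lambda>a e. rcons e a) (Raw a) ys = Raw (rev ys @ a)" for a ys
    by (induction ys arbitrary: a) (auto simp: raw_defs)
  have "polytime (\<lambda>x. foldl (\<lambda>a e. rcons e a) (Raw []) (rev (f x)))"
  proof (rule polytime_foldl)
    fix x k
    show "esize (foldl (\<lambda>a e. rcons e a) (Raw []) (take k (rev (f x)))) \<le> poly l (esize x)"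
      unfolding fc using length_le_esize[of "f x"] l[of x] by simp
  qed (intro pt assms pb_poly)+
  then show ?thesis by (simp add: fc)
qed

lemma polytime_poly [pt]:
  assumes "polytime f"
  shows "polytime (\<lambda>x. poly p (f x) :: nat)"
  by (induction p) (simp_all add: pt assms)

section \<open>The trip network of a layered choice problem\<close>

datatype node = Src | V nat | U nat | X nat nat | LY nat | LZ nat | K nat | HY nat | HZ nat | Lf
  nat nat

datatype tag = TY nat | TZ nat | TH nat | TI nat | TF | TW nat nat | TIni | TEnt nat | TExt nat
  | TCh nat nat | TLf nat nat | TBy node | TRet node

text \<open>
  One of the options \<open>a < C\<close> must be chosen from each of the layers \<open>0, \<dots>, N - 1\<close>, such that no two
  chosen options are in conflict. Layer \<open>i\<close> is crossed from \<open>U i\<close> to \<open>U (i + 1)\<close> along one of the chains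
  \<open>X a 0, \<dots>, X a C\<close>. If \<open>a\<close> and \<open>b\<close>, of a later layer, are in conflict, then one step of both chains
  is only served by the trip \<open>TW a b\<close>, which visits the chain of \<open>b\<close> first, so that no path uses both.

  The trips \<open>TY j, TZ j\<close>, and likewise \<open>TH j, TI j\<close>, form a lock: only one of its two exits can
  be open. The locks at the first \<open>B\<close> layers fix the choice between the options \<open>2 j\<close> and \<open>2 j + 1\<close>.
  The locks at \<open>V j\<close> let only one of the hubs \<open>K j\<close> be reached after trip \<open>TF\<close>, while a path that
  reaches \<open>U N\<close> in time for \<open>TF\<close> is taken to all hubs.
\<close>

locale net =
  fixes N B C m :: nat and lay :: "nat \<Rightarrow> nat" and conf :: "nat \<Rightarrow> nat \<Rightarrow> bool"
begin

text \<open>In a lock the last edge of each trip ends where the other trip begins. So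
  \<open>U j\<close> is left through \<open>LY j\<close> only if
  \<open>g (TY j) + 3 \<le> g (TZ j)\<close> and through \<open>LZ j\<close> only if
  \<open>g (TZ j) + 3 \<le> g (TY j)\<close>. The middle edges join the useful ones to a walk; that
  of \<open>TW a b\<close> leads back from the chain of \<open>b\<close> to the chain of
  \<open>a\<close>.\<close>

fun route :: "tag \<Rightarrow> (node \<times> node) list" where
  "route (TY j) = [(LZ j, X (2 * j + 1) 0), (X (2 * j + 1) 0, U j), (U j, LY j)]"
| "route (TZ j) = [(LY j, X (2 * j) 0), (X (2 * j) 0, U j), (U j, LZ j)]"
| "route (TH j) = [(HZ j, V (Suc j)), (V (Suc j), V j), (V j, HY j)]"
| "route (TI j) = [(HY j, K j), (K j, V j), (V j, HZ j)]"
| "route TF = (U N, K 0) # map (\<lambda>j. (K j, K (Suc j))) [0..<m - 1] @ [(K (m - 1), Src), (Src, V 0)]"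
| "route (TW a b) = [(X b a, X b (Suc a)), (X b (Suc a), X a b), (X a b, X a (Suc b))]"
| "route TIni = [(Src, U 0)]"
| "route (TEnt a) = [(U (lay a), X a 0)]"
| "route (TExt a) = [(X a C, U (Suc (lay a)))]"
| "route (TCh a b) = [(X a b, X a (Suc b))]"
| "route (TLf j i) = [(K j, Lf j i)]"
| "route (TBy v) = [(V 0, v)]"
| "route (TRet v) = [(v, Src)]"

definition clash :: "nat \<Rightarrow> nat \<Rightarrow> bool" where "clash a b \<longleftrightarrow> lay a < lay b \<and> conf a b"

text \<open>These nodes get a direct trip from \<open>V 0\<close>, since the ordinary way to them
  through the layers depends on the choice problem.\<close>

definition core_nodes :: "node list" where
  "core_nodes = map U [0..<Suc N] @ concat (map (\<lambda>a. map (X a) [0..<Suc C]) [0..<C]) @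
     map LY [0..<B] @ map LZ [0..<B]"

definition inner_nodes :: "node list" where
  "inner_nodes = Src # map V [0..<Suc m] @ core_nodes @ map K [0..<m] @ map HY [0..<m] @
    map HZ [0..<m]"

definition leaves :: "node list" where
  "leaves = concat (map (\<lambda>j. map (Lf j) [0..<m]) [0..<m])"

definition all_nodes :: "node list" where
  "all_nodes = inner_nodes @ leaves"

text \<open>The order matters at the front: \<open>TY j\<close> and \<open>TZ j\<close> have the
  indices \<open>2 * j\<close> and \<open>2 * j + 1\<close>, where the witness is read off. An
  option below \<open>2 * B\<close> has no \<open>TEnt\<close>, as its chain is entered through a
  lock.\<close>

definition tags :: "tag list" where
  "tags = concat (map (\<lambda>j. [TY j, TZ j]) [0..<B]) @ concat (map (\<lambda>j. [TH j, TI j]) [0..<m]) @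
    [TF, TIni] @
     concat (map (\<lambda>a. map (TW a) (filter (clash a) [0..<C])) [0..<C]) @
     map TEnt (filter (\<lambda>a. 2 * B \<le> a) [0..<C]) @ map TExt [0..<C] @
     concat (map (\<lambda>a. map (TCh a) (filter (\<lambda>b. \<not> clash a b \<and> \<not> clash b a) [0..<C])) [0..<C]) @
     concat (map (\<lambda>j. map (TLf j) [0..<m]) [0..<m]) @ map TBy core_nodes @ map TRet all_nodes"

text \<open>Nonempty temporal paths in terms of tags and node names. Only the arrival time is kept,
  which is all that an extension of a path depends on.\<close>

inductive arr :: "(tag \<Rightarrow> real) \<Rightarrow> node \<Rightarrow> node \<Rightarrow> real \<Rightarrow> bool" for g where
  arr_base: "T \<in> set tags \<Longrightarrow> j < length (route T) \<Longrightarrow> route T ! j = (u, v) \<Longrightarrow>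
    arr g u v (g T + real j + 1)"
| arr_step: "arr g u w \<theta> \<Longrightarrow> T \<in> set tags \<Longrightarrow> j < length (route T) \<Longrightarrow> route T ! j = (w, v) \<Longrightarrow>
     \<theta> \<le> g T + real j \<Longrightarrow> arr g u v (g T + real j + 1)"

definition network :: "(node \<Rightarrow> nat) \<Rightarrow> nat trip_network" where
  "network f = \<lparr>nodes = f ` set all_nodes,
     edges = mset (concat (map (\<lambda>T. map (\<lambda>(u, v). (f u, f v, 1)) (route T)) tags)),
     trips = map (\<lambda>T. map (\<lambda>(u, v). (f u, f v, 1)) (route T)) tags\<rparr>"

lemma set_tags:
  "set tags = {TF, TIni} \<union> (\<Union>j<B. {TY j, TZ j}) \<union> (\<Union>j<m. {TH j, TI j}) \<union>
    {TW a b | a b. a < C \<and> b < C \<and> clash a b} \<union> {TEnt a | a. 2 * B \<le> a \<and>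
      a < C} \<union> {TExt a | a. a < C} \<union>
    {TCh a b | a b. a < C \<and> b < C \<and> \<not> clash a b \<and> \<not> clash b a} \<union> {TLf j i | j i. j < m \<and> i < m} \<union>
    TBy ` set core_nodes \<union> TRet ` set all_nodes"
  unfolding tags_def by auto

lemma tag_mem [simp]:
  "TF \<in> set tags" "TIni \<in> set tags" "TY j \<in> set tags \<longleftrightarrow> j < B" "TZ j \<in> set tags \<longleftrightarrow> j < B"
  "TH j \<in> set tags \<longleftrightarrow> j < m" "TI j \<in> set tags \<longleftrightarrow> j < m"
  "TW a b \<in> set tags \<longleftrightarrow> a < C \<and> b < C \<and> clash a b" "TEnt a \<in> set tags \<longleftrightarrow> 2 * B \<le> a \<and> a < C"
  "TExt a \<in> set tags \<longleftrightarrow> a < C"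
  "TCh a b \<in> set tags \<longleftrightarrow> a < C \<and> b < C \<and> \<not> clash a b \<and> \<not> clash b a"
  "TLf j i \<in> set tags \<longleftrightarrow> j < m \<and> i < m" "TBy v \<in> set tags \<longleftrightarrow> v \<in> set core_nodes"
  "TRet v \<in> set tags \<longleftrightarrow> v \<in> set all_nodes"
  unfolding set_tags by auto

lemma set_core_nodes:
  "set core_nodes = U ` {..N} \<union> {X a p | a p. a < C \<and> p \<le> C} \<union> LY ` {..<B} \<union> LZ ` {..<B}"
  unfolding core_nodes_def by (auto simp: less_Suc_eq_le simp del: upt_Suc)

lemma set_leaves: "set leaves = {Lf j i | j i. j < m \<and> i < m}"
  unfolding leaves_def by auto

lemma set_inner_nodes:
  "set inner_nodes = {Src} \<union> V ` {..m} \<union> set core_nodes \<union> K ` {..<m} \<union> HY ` {..<m} \<union> HZ ` {..<m}"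
  unfolding inner_nodes_def by (auto simp: less_Suc_eq_le simp del: upt_Suc)

lemma core_node_mem [simp]:
  "Src \<notin> set core_nodes" "V j \<notin> set core_nodes" "U i \<in> set core_nodes \<longleftrightarrow> i \<le> N"
  "X a p \<in> set core_nodes \<longleftrightarrow> a < C \<and> p \<le> C" "LY j \<in> set core_nodes \<longleftrightarrow> j < B"
    "LZ j \<in> set core_nodes \<longleftrightarrow> j < B"
  "K j \<notin> set core_nodes" "HY j \<notin> set core_nodes" "HZ j \<notin> set core_nodes" "Lf j i \<notin> set core_nodes"
  unfolding set_core_nodes by auto

lemma set_all_nodes: "set all_nodes = set inner_nodes \<union> set leaves"
  by (simp add: all_nodes_def)

lemma node_mem [simp]:
  "Src \<in> set all_nodes" "V j \<in> set all_nodes \<longleftrightarrow> j \<le> m" "U i \<in> set all_nodes \<longleftrightarrow> i \<le> N"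
  "X a p \<in> set all_nodes \<longleftrightarrow> a < C \<and> p \<le> C" "LY j \<in> set all_nodes \<longleftrightarrow> j < B"
    "LZ j \<in> set all_nodes \<longleftrightarrow> j < B"
  "K j \<in> set all_nodes \<longleftrightarrow> j < m" "HY j \<in> set all_nodes \<longleftrightarrow> j < m" "HZ j \<in> set all_nodes \<longleftrightarrow> j < m"
  "Lf j i \<in> set all_nodes \<longleftrightarrow> j < m \<and> i < m"
  unfolding set_all_nodes set_inner_nodes set_leaves by auto

end

lemma distinct_concat_map:
  assumes "distinct xs" "\<And>x. x \<in> set xs \<Longrightarrow> distinct (f x)"
    "\<And>x y. x \<in> set xs \<Longrightarrow> y \<in> set xs \<Longrightarrow> x \<noteq> y \<Longrightarrow> set (f x) \<inter> set (f y) = {}"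
  shows "distinct (concat (map f xs))"
  using assms
proof (induction xs)
  case (Cons x xs)
  then have "set (f x) \<inter> (\<Union>y\<in>set xs. set (f y)) = {}" by fastforce
  then show ?case using Cons by simp
qed simp

context net
begin

lemma distinct_core_nodes: "distinct core_nodes"
  unfolding core_nodes_def
  by (simp only: distinct_append, intro conjI)
    (auto simp: distinct_map inj_on_def intro!: distinct_concat_map)

lemma distinct_all_nodes: "distinct all_nodes"
  unfolding all_nodes_def inner_nodes_def leaves_def using distinct_core_nodes
  by (simp only: distinct_append distinct.simps, intro conjI)
    (auto simp: distinct_map inj_on_def intro!: distinct_concat_map)

lemma distinct_tags: "distinct tags"
  unfolding tags_def using distinct_core_nodes distinct_all_nodes
  by (simp only: distinct_append, intro conjI)
    (auto simp: distinct_map inj_on_def intro!: distinct_concat_map)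

lemma length_leaves: "length leaves = m * m"
  by (simp add: leaves_def length_concat comp_def sum_list_triv)

lemma length_inner_nodes: "length inner_nodes = 4 * m + (N + C * (C + 1) + 2 * B + 3)"
  by (simp add: inner_nodes_def core_nodes_def length_concat comp_def sum_list_triv)

end

text \<open>The options below \<open>2 * B\<close> come in pairs, one pair for each of the first
  \<open>B\<close> layers; \<open>lay_rest\<close> says that these layers have no further
  options.\<close>

locale core = net +
  assumes m: "0 < m" and BN: "B \<le> N" and BC: "2 * B \<le> C" and lay: "\<And>a. a < C \<Longrightarrow> lay a < N"
    and lay_bit: "\<And>j. j < B \<Longrightarrow> lay (2 * j) = j \<and> lay (2 * j + 1) = j"
    and lay_rest: "\<And>a. a < C \<Longrightarrow> 2 * B \<le> a \<Longrightarrow> B \<le> lay a"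
begin

lemma length_TF: "length (route TF) = m + 2"
  using m by simp

lemma nth_TF:
  "route TF ! 0 = (U N, K 0)" "0 < j \<Longrightarrow> j < m \<Longrightarrow> route TF ! j = (K (j - 1), K j)"
  "route TF ! m = (K (m - 1), Src)" "route TF ! Suc m = (Src, V 0)"
  using m by (auto simp: nth_append nth_Cons split: nat.splits)

lemma TF_cases:
  assumes "j < length (route TF)" "route TF ! j = (w, v)"
  obtains "j = 0" "w = U N" "v = K 0" | "0 < j" "j < m" "w = K (j - 1)" "v = K j"
    | "j = m" "w = K (m - 1)" "v = Src" | "j = Suc m" "w = Src" "v = V 0"
proof -
  have "j = 0 \<or> (0 < j \<and> j < m) \<or> j = m \<or> j = Suc m" using assms(1) unfolding length_TF by linarith
  then show ?thesis using that assms(2) nth_TF m by (elim disjE) auto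
qed

lemma route_nodes:
  assumes "T \<in> set tags" "(u, v) \<in> set (route T)"
  shows "u \<in> set all_nodes" "v \<in> set all_nodes"
proof -
  have core: "v \<in> set core_nodes \<Longrightarrow> v \<in> set all_nodes" for v
    by (simp add: all_nodes_def inner_nodes_def)
  have "u \<in> set all_nodes \<and> v \<in> set all_nodes"
  proof (cases T)
    case TF
    then show ?thesis using assms m BN by auto
  qed (use assms m BN BC lay lay_bit core in \<open>auto simp: clash_def Suc_le_eq intro: less_imp_le\<close>)
  then show "u \<in> set all_nodes" "v \<in> set all_nodes" by auto
qed

lemma route_walk: "successively (\<lambda>(u, v) (u', v'). v = u') (route T)"
proof (cases T)
  case TF
  have "successively (\<lambda>(u, v) (u', v'). v = u') (map (\<lambda>j. (K j, K (Suc j))) [0..<k])" for k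
    by (induction k) (auto simp: successively_append_iff last_map split: if_splits)
  moreover have "hd (map (\<lambda>j. (K j, K (Suc j))) [0..<m - 1]) = (K 0, K 1)" if "m - 1 \<noteq> 0"
    using that by (simp add: hd_map upt_conv_Cons)
  moreover have "last (map (\<lambda>j. (K j, K (Suc j))) [0..<m - 1]) = (K (m - 2), K (m - 1))"
    if "m - 1 \<noteq> 0"
    using that by (simp add: last_map numeral_2_eq_2 Suc_diff_Suc)
  ultimately show ?thesis using m unfolding TF route.simps
    by (cases "m = 1") (auto simp: successively_append_iff successively_Cons)
qed auto

lemma route_ne: "route T \<noteq> []"
  by (cases T) auto


subsection \<open>Temporal paths and arrival times\<close>

lemma temporal_edges_network:
  assumes g: "\<And>i. i < length tags \<Longrightarrow> \<tau> i = g (tags ! i)"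
  shows "temporal_edges (network f) \<tau> =
    {(f u, f v, g T + real j, 1) | T j u v. T \<in> set tags \<and> j < length (route T) \<and> route T ! j =
      (u, v)}"
proof -
  let ?h = "\<lambda>(u, v). (f u, f v, 1 :: real)"
  have w: "(\<Sum>l<j. weight (map ?h (route T) ! l)) = real j" if "j < length (route T)" for T j
  proof -
    have "(\<Sum>l<j. weight (map ?h (route T) ! l)) = (\<Sum>l<j. 1 :: real)"
      by (rule sum.cong) (use that in \<open>auto simp: case_prod_beta\<close>)
    then show ?thesis by simp
  qed
  have "e \<in> temporal_edges (network f) \<tau> \<longleftrightarrow> (\<exists>T j u v. e = (f u, f v, g T + real j, 1) \<and>
      T \<in> set tags \<and> j < length (route T) \<and> route T ! j = (u, v))" for e
  proof
    assume "e \<in> temporal_edges (network f) \<tau>"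
    then obtain i j where ij: "i < length tags" "j < length (route (tags ! i))"
      "e = (tail (map ?h (route (tags ! i)) ! j), head (map ?h (route (tags ! i)) ! j),
         \<tau> i + (\<Sum>l<j. weight (map ?h (route (tags ! i)) ! l)), weight
           (map ?h (route (tags ! i)) ! j))"
      unfolding temporal_edges_def network_def by auto
    obtain u v where uv: "route (tags ! i) ! j = (u, v)" by fastforce
    have "e = (f u, f v, g (tags ! i) + real j, 1)"
      unfolding ij(3) w[OF ij(2)] using ij(1,2) uv g by simp
    then show "\<exists>T j u v. e = (f u, f v, g T + real j, 1) \<and>
      T \<in> set tags \<and> j < length (route T) \<and> route T ! j = (u, v)"
      using ij(1,2) uv nth_mem by blast
  next
    assume "\<exists>T j u v. e = (f u, f v, g T + real j, 1) \<and>
      T \<in> set tags \<and> j < length (route T) \<and> route T ! j = (u, v)"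
    then obtain T j u v where *: "e = (f u, f v, g T + real j, 1)" "T \<in> set tags"
      "j < length (route T)" "route T ! j = (u, v)" by blast
    then obtain i where i: "i < length tags" "T = tags ! i" by (metis in_set_conv_nth)
    have "e = (tail (map ?h (route (tags ! i)) ! j), head (map ?h (route (tags ! i)) ! j),
         \<tau> i + (\<Sum>l<j. weight (map ?h (route (tags ! i)) ! l)), weight
           (map ?h (route (tags ! i)) ! j))"
      using * i g w[of j "tags ! i"] by simp
    then show "e \<in> temporal_edges (network f) \<tau>"
      unfolding temporal_edges_def mem_Collect_eq
      by (intro exI[of _ i] exI[of _ j] exI[of _ "map ?h (route (tags ! i))"])
        (use * i in \<open>auto simp: network_def\<close>)
  qed
  then show ?thesis by blast
qed

text \<open>Temporal edges mention only the names given by \<open>f\<close>, so injectivity is what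
  identifies the end of one edge with the start of the next. Paths are taken apart at their last
  edge because \<open>arr\<close> extends at the end.\<close>

lemma reachable_network:
  assumes f: "inj_on f (set all_nodes)" and g: "\<And>i. i < length tags \<Longrightarrow> \<tau> i = g (tags ! i)"
    and u: "u \<in> set all_nodes" "v \<in> set all_nodes"
  shows "reachable (network f) \<tau> (f u) (f v) \<longleftrightarrow> u = v \<or> (\<exists>\<theta>. arr g u v \<theta>)"
proof -
  let ?A = "temporal_edges (network f) \<tau>"
  have A: "?A = {(f u, f v, g T + real j, 1) | T j u v.
      T \<in> set tags \<and> j < length (route T) \<and> route T ! j = (u, v)}"
    by (rule temporal_edges_network) (rule g)
  have 1: "\<exists>v\<in>set all_nodes. x = f v \<and> arr g u v (fst (snd (snd (last P))) + 1)"
    if "temporal_path ?A (f u) P x" for P x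
    using that
  proof (induction P arbitrary: x rule: rev_induct)
    case (snoc e P)
    have "e \<in> ?A" using snoc.prems by (auto simp: temporal_path_def)
    then obtain T j a b where e: "e = (f a, f b, g T + real j, 1)" "T \<in> set tags"
      "j < length (route T)"
      "route T ! j = (a, b)" unfolding A by blast
    have ab: "a \<in> set all_nodes" "b \<in> set all_nodes" using e route_nodes nth_mem by metis+
    have x: "x = f b" using snoc.prems by (simp add: temporal_path_def e)
    show ?case
    proof (cases "P = []")
      case True
      then have "f a = f u" using snoc.prems by (simp add: temporal_path_def e)
      then have "a = u" using f u ab by (auto dest: inj_onD)
      then show ?thesis using arr_base[of T j u b g] e ab x True by auto
    next
      case False
      obtain a' b' t d where l: "last P = (a', b', t, d)" by (rule prod_cases4)
      have "last P \<in> ?A" using snoc.prems False by (auto simp: temporal_path_def)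
      then have d: "d = 1" unfolding A l by auto
      have "temporal_path ?A (f u) P b'"
        using snoc.prems False by (auto simp: temporal_path_def successively_append_iff l)
      from snoc.IH[OF this] obtain w where w: "w \<in> set all_nodes" "b' = f w" "arr g u w (t + 1)"
        by (auto simp: l)
      have "b' = f a" "t + d \<le> g T + real j"
        using snoc.prems False by (auto simp: temporal_path_def successively_append_iff l e)
      then have "w = a" using f w ab by (auto dest: inj_onD)
      then show ?thesis using arr_step[OF w(3), of T j b] e ab x \<open>t + d \<le> _\<close> d by auto
    qed
  qed (simp add: temporal_path_def)
  have 2: "\<exists>P. temporal_path ?A (f u) P (f v) \<and> fst (snd (snd (last P))) + 1 = \<theta> \<and>
      snd (snd (snd (last P))) = 1" if "arr g u v \<theta>" for v \<theta>
    using that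
  proof (induction rule: arr.induct)
    case (arr_base T j u v)
    let ?e = "(f u, f v, g T + real j, 1 :: real)"
    have "?e \<in> ?A" unfolding A using arr_base by blast
    then show ?case by (intro exI[of _ "[?e]"]) (auto simp: temporal_path_def)
  next
    case (arr_step u w \<theta> T j v)
    then obtain P where P: "temporal_path ?A (f u) P (f w)" "fst (snd (snd (last P))) + 1 = \<theta>"
      "snd (snd (snd (last P))) = 1" by blast
    let ?e = "(f w, f v, g T + real j, 1 :: real)"
    have "?e \<in> ?A" unfolding A using arr_step by blast
    moreover obtain a' b' t d where l: "last P = (a', b', t, d)" by (rule prod_cases4)
    ultimately have "temporal_path ?A (f u) (P @ [?e]) (f v)"
      using P arr_step.hyps by (auto simp: temporal_path_def successively_append_iff)
    then show ?case by (intro exI[of _ "P @ [?e]"]) auto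
  qed
  show ?thesis
  proof
    assume "reachable (network f) \<tau> (f u) (f v)"
    then consider "f u = f v" | P where "temporal_path ?A (f u) P (f v)"
      by (auto simp: reachable_def)
    then show "u = v \<or> (\<exists>\<theta>. arr g u v \<theta>)"
    proof cases
      case 1
      then show ?thesis using f u by (auto dest: inj_onD)
    next
      case 2
      from 1[OF this] obtain w where "w \<in> set all_nodes" "f v = f w" "\<exists>\<theta>. arr g u w \<theta>" by blast
      then show ?thesis using f u by (metis inj_onD)
    qed
  next
    assume "u = v \<or> (\<exists>\<theta>. arr g u v \<theta>)"
    then show "reachable (network f) \<tau> (f u) (f v)" using 2 by (auto simp: reachable_def)
  qed
qed

lemma trip_network_network: "trip_network (network f)"
proof -
  let ?h = "\<lambda>(u, v). (f u, f v, 1 :: real)"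
  have "successively (\<lambda>e e'. head e = tail e') (map ?h (route T))" for T
    unfolding successively_map using route_walk[of T] by (rule successively_mono) auto
  moreover have "x \<in> set all_nodes \<Longrightarrow> \<exists>T\<in>set tags. \<exists>e\<in>set (map ?h (route T)). f x = tail e \<or> f x =
    head e" for x
    by (rule bexI[of _ "TRet x"]) auto
  ultimately show ?thesis
    unfolding trip_network_def network_def walk_def using route_ne route_nodes
    by (auto simp: case_prod_beta)
qed

end

context core
begin

subsection \<open>Temporalisations that do not solve the choice problem\<close>

definition choice :: "(nat \<Rightarrow> nat) \<Rightarrow> nat \<Rightarrow> bool" where
  "choice s i \<longleftrightarrow> (\<forall>l<i. s l < C \<and> lay (s l) = l) \<and> (\<forall>l<i. \<forall>l'<i. l < l' \<longrightarrow> \<not> conf (s l) (s l'))"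

text \<open>For an option of one of the first \<open>B\<close> layers the lock must be open in its
  direction. This ties a choice to the order of starting times.\<close>

definition bit_ok :: "(tag \<Rightarrow> real) \<Rightarrow> nat \<Rightarrow> bool" where
  "bit_ok g a \<longleftrightarrow> (\<forall>j<B. (a = 2 * j \<longrightarrow> g (TY j) + 3 \<le> g (TZ j)) \<and> (a = 2 * j + 1 \<longrightarrow>
    g (TZ j) + 3 \<le> g (TY j)))"

text \<open>The record of a path that stands before layer \<open>i\<close> at time \<theta>:
  \<open>s\<close> is the choice made so far, and each trip that a chosen option shares with a
  conflicting later one has ended, so the chain of the later one can no longer be crossed.\<close>

definition progress :: "(tag \<Rightarrow> real) \<Rightarrow> (nat \<Rightarrow> nat) \<Rightarrow> nat \<Rightarrow> real \<Rightarrow> bool" where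
  "progress g s i \<theta> \<longleftrightarrow> choice s i \<and> (\<forall>l<i. bit_ok g (s l)) \<and>
     (\<forall>l<i. \<forall>b<C. clash (s l) b \<longrightarrow> g (TW (s l) b) + 3 \<le> \<theta>)"

text \<open>The record for a chain crossed up to position \<open>p\<close>. At \<open>p = C\<close>
  it is what \<open>progress\<close> demands of one more chosen option.\<close>

definition fresh :: "(tag \<Rightarrow> real) \<Rightarrow> (nat \<Rightarrow> nat) \<Rightarrow> nat \<Rightarrow> nat \<Rightarrow> real \<Rightarrow> bool" where
  "fresh g s a p \<theta> \<longleftrightarrow> bit_ok g a \<and> (\<forall>b<p. clash b a \<longrightarrow> s (lay b) \<noteq> b) \<and>
     (\<forall>b<p. clash a b \<longrightarrow> g (TW a b) + 3 \<le> \<theta>)"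

text \<open>\<open>TF\<close> has completed its \<open>m + 2\<close> edges. From then on its first
  edge is gone, and what happens in the layers need not be recorded any more.\<close>

definition post :: "(tag \<Rightarrow> real) \<Rightarrow> real \<Rightarrow> bool" where
  "post g \<theta> \<longleftrightarrow> g TF + real m + 2 \<le> \<theta>"

text \<open>All locks below \<open>j\<close> open onwards to the next \<open>V\<close>. Opening to
  the hub requires the opposite order of the two trips.\<close>

definition passed :: "(tag \<Rightarrow> real) \<Rightarrow> nat \<Rightarrow> bool" where
  "passed g j \<longleftrightarrow> (\<forall>i<j. g (TI i) + 3 \<le> g (TH i))"

text \<open>
  A ride on \<open>TW a b\<close> from the chain of \<open>b\<close> back into the middle of the chain of \<open>a\<close> is harmless,
  since the layer of \<open>a\<close> has already been crossed.
\<close>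

fun inv :: "(tag \<Rightarrow> real) \<Rightarrow> node \<Rightarrow> real \<Rightarrow> bool" where
  "inv g Src \<theta> \<longleftrightarrow> True"
| "inv g (V j) \<theta> \<longleftrightarrow> post g \<theta> \<and> passed g j"
| "inv g (HY j) \<theta> \<longleftrightarrow> post g \<theta> \<and> passed g j \<and> g (TH j) + 3 \<le> \<theta>"
| "inv g (HZ j) \<theta> \<longleftrightarrow> post g \<theta> \<and> passed g j \<and> g (TI j) + 3 \<le> \<theta>"
| "inv g (K j) \<theta> \<longleftrightarrow> post g \<theta> \<and> passed g j \<and> g (TH j) + 3 \<le> g (TI j)"
| "inv g (Lf j i) \<theta> \<longleftrightarrow> passed g j \<and> g (TH j) + 3 \<le> g (TI j)"
| "inv g (U i) \<theta> \<longleftrightarrow> post g \<theta> \<or> (\<exists>s. progress g s i \<theta>)"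
| "inv g (LY j) \<theta> \<longleftrightarrow> post g \<theta> \<or> (\<exists>s. progress g s j \<theta>) \<and> g (TY j) + 3 \<le> \<theta>"
| "inv g (LZ j) \<theta> \<longleftrightarrow> post g \<theta> \<or> (\<exists>s. progress g s j \<theta>) \<and> g (TZ j) + 3 \<le> \<theta>"
| "inv g (X a p) \<theta> \<longleftrightarrow> post g \<theta> \<or> (\<exists>s. progress g s (Suc (lay a)) \<theta>) \<or>
     (\<exists>s. progress g s (lay a) \<theta> \<and> fresh g s a p \<theta>)"

lemma progress_mono: "progress g s i \<theta> \<Longrightarrow> i' \<le> i \<Longrightarrow> \<theta> \<le> \<theta>' \<Longrightarrow> progress g s i' \<theta>'"
  unfolding progress_def choice_def by (meson less_le_trans order_trans)

lemma progress_mono': "(\<exists>s. progress g s i \<theta>) \<Longrightarrow> i' \<le> i \<Longrightarrow> \<theta> \<le> \<theta>' \<Longrightarrow> \<exists>s. progress g s i' \<theta>'"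
  using progress_mono by blast

lemma post_mono: "post g \<theta> \<Longrightarrow> \<theta> \<le> \<theta>' \<Longrightarrow> post g \<theta>'"
  by (simp add: post_def)

lemma passed_mono: "passed g j \<Longrightarrow> i \<le> j \<Longrightarrow> passed g i"
  by (auto simp: passed_def)

lemma fresh_mono: "fresh g s a p \<theta> \<Longrightarrow> \<theta> \<le> \<theta>' \<Longrightarrow> fresh g s a p \<theta>'"
  unfolding fresh_def by (meson order_trans)

text \<open>Position \<open>b\<close> of the chain of \<open>a\<close> accounts for the pair
  \<open>a\<close>, \<open>b\<close>. If \<open>b\<close> is in conflict with \<open>a\<close> and
  belongs to an earlier layer, crossing this position was possible only because \<open>b\<close> was
  not chosen.\<close>

lemma progress_Suc:
  assumes "progress g s (lay a) \<theta>" "fresh g s a C \<theta>" "a < C"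
  shows "progress g (s(lay a := a)) (Suc (lay a)) \<theta>"
proof -
  let ?s = "s(lay a := a)"
  have "\<not> conf (s l) a" if "l < lay a" for l
  proof
    assume "conf (s l) a"
    moreover have "s l < C" "lay (s l) = l" using assms(1) that
      by (auto simp: progress_def choice_def)
    ultimately have "clash (s l) a" using that by (simp add: clash_def)
    then show False using assms(2) \<open>s l < C\<close> \<open>lay (s l) = l\<close> by (auto simp: fresh_def)
  qed
  then have "choice ?s (Suc (lay a))"
    using assms by (auto simp: progress_def choice_def less_Suc_eq)
  then show ?thesis using assms by (auto simp: progress_def fresh_def less_Suc_eq)
qed

text \<open>Some trips lead back to the entrance of a layer or into an earlier layer. This only
  shortens the record, and a prefix of a valid record is valid.\<close>

lemma inv_X_U:
  assumes "inv g (X a p) \<theta>" "\<theta> \<le> \<theta>'" "i \<le> lay a"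
  shows "inv g (U i) \<theta>'"
proof -
  consider "post g \<theta>" | s where "progress g s (Suc (lay a)) \<theta>" | s where "progress g s (lay a) \<theta>"
    using assms(1) by auto
  then show ?thesis
  proof cases
    case 1
    then show ?thesis using post_mono assms(2) by auto
  next
    case (2 s)
    then show ?thesis using progress_mono[of g s _ \<theta> i \<theta>'] assms(2,3) by fastforce
  next
    case (3 s)
    then show ?thesis using progress_mono[of g s _ \<theta> i \<theta>'] assms(2,3) by fastforce
  qed
qed

lemma inv_X_Suc:
  assumes i: "inv g (X a p) \<theta>" and le: "\<theta> \<le> \<theta>'"
    and 1: "\<And>s. progress g s (lay a) \<theta> \<Longrightarrow> clash p a \<Longrightarrow> s (lay p) \<noteq> p"
    and 2: "clash a p \<Longrightarrow> g (TW a p) + 3 \<le> \<theta>'"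
  shows "inv g (X a (Suc p)) \<theta>'"
proof -
  consider "post g \<theta>" | "\<exists>s. progress g s (Suc (lay a)) \<theta>" | s
    where "progress g s (lay a) \<theta>" "fresh g s a p \<theta>"
    using i by auto
  then show ?thesis
  proof cases
    case 3
    then have "fresh g s a (Suc p) \<theta>'"
      using fresh_mono[OF 3(2) le] 1[OF 3(1)] 2 by (auto simp: fresh_def less_Suc_eq)
    then show ?thesis using progress_mono[OF 3(1) order_refl le] by auto
  qed (use le post_mono progress_mono' in auto)
qed

text \<open>The argument hinges on two edges. The first edge of \<open>TF\<close> would need a
  complete choice that agrees with the locks, and the first edge of \<open>TW a b\<close> has left
  before any path that chose \<open>a\<close> comes to the chain of \<open>b\<close>.\<close>

lemma inv_step:
  assumes no: "\<not> (\<exists>s. choice s N \<and> (\<forall>l<N. bit_ok g (s l)))"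
    and w: "inv g w \<theta>" and T: "T \<in> set tags" "j < length (route T)" "route T ! j = (w, v)"
      "\<theta> \<le> g T + real j"
  shows "inv g v (g T + real j + 1)"
proof -
  let ?\<theta>' = "g T + real j + 1"
  have le: "\<theta> \<le> ?\<theta>'" using T(4) by simp
  have mono: "post g \<theta> \<Longrightarrow> post g ?\<theta>'" "progress g s i \<theta> \<Longrightarrow> progress g s i ?\<theta>'" for s i
    using post_mono progress_mono le by blast+
  have bit0: "bit_ok g (2 * k)" if "g (TY k) + 3 \<le> g (TZ k)" for k
    using that unfolding bit_ok_def by (metis even_Suc even_mult_iff even_numeral mult_left_cancel
        Suc_eq_plus1 zero_neq_numeral)
  have bit1: "bit_ok g (2 * k + 1)" if "g (TZ k) + 3 \<le> g (TY k)" for k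
    using that unfolding bit_ok_def by (metis add_right_cancel even_Suc even_mult_iff even_numeral
        mult_left_cancel Suc_eq_plus1 zero_neq_numeral)
  show ?thesis
  proof (cases T)
    case (TY k)
    then have k: "k < B" "lay (2 * k + 1) = k" using T(1) lay_bit by auto
    have "j < 3" using T(2) TY by simp
    then consider "j = 0" | "j = 1" | "j = 2" by linarith
    then show ?thesis
    proof cases
      case 1
      have wv: "w = LZ k" "v = X (2 * k + 1) 0" using T(3) TY 1 by auto
      consider "post g \<theta>" | s where "progress g s k \<theta>" "g (TZ k) + 3 \<le> \<theta>" using w wv by auto
      then show ?thesis
      proof cases
        case 2
        then have "fresh g s (2 * k + 1) 0 ?\<theta>'"
          using T(4) TY 1 bit1[of k] by (auto simp: fresh_def)
        then show ?thesis unfolding wv using progress_mono[OF 2(1) order_refl le] k(2) by auto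
      qed (use wv mono in auto)
    next
      case 2
      then have "w = X (2 * k + 1) 0" "v = U k" using T(3) TY by auto
      then show ?thesis using inv_X_U[of g "2 * k + 1" 0 \<theta> ?\<theta>' k] w le k by simp
    next
      case 3
      then have "w = U k" "v = LY k" using T(3) TY by auto
      then show ?thesis using w TY 3 mono by auto
    qed
  next
    case (TZ k)
    then have k: "k < B" "lay (2 * k) = k" using T(1) lay_bit by auto
    have "j < 3" using T(2) TZ by simp
    then consider "j = 0" | "j = 1" | "j = 2" by linarith
    then show ?thesis
    proof cases
      case 1
      have wv: "w = LY k" "v = X (2 * k) 0" using T(3) TZ 1 by auto
      consider "post g \<theta>" | s where "progress g s k \<theta>" "g (TY k) + 3 \<le> \<theta>" using w wv by auto
      then show ?thesis
      proof cases
        case 2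
        then have "fresh g s (2 * k) 0 ?\<theta>'"
          using T(4) TZ 1 bit0[of k] by (auto simp: fresh_def)
        then show ?thesis unfolding wv using progress_mono[OF 2(1) order_refl le] k(2) by auto
      qed (use wv mono in auto)
    next
      case 2
      then have "w = X (2 * k) 0" "v = U k" using T(3) TZ by auto
      then show ?thesis using inv_X_U[of g "2 * k" 0 \<theta> ?\<theta>' k] w le k by simp
    next
      case 3
      then have "w = U k" "v = LZ k" using T(3) TZ by auto
      then show ?thesis using w TZ 3 mono by auto
    qed
  next
    case (TH k)
    have "j < 3" using T(2) TH by simp
    then consider "j = 0" | "j = 1" | "j = 2" by linarith
    then show ?thesis
    proof cases
      case 1
      then have wv: "w = HZ k" "v = V (Suc k)" using T(3) TH by auto
      then have "passed g (Suc k)" using w T(4) TH 1 by (auto simp: passed_def less_Suc_eq)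
      then show ?thesis using w wv mono by auto
    next
      case 2
      then have "w = V (Suc k)" "v = V k" using T(3) TH by auto
      then show ?thesis using w mono passed_mono[of g "Suc k" k] by auto
    next
      case 3
      then have "w = V k" "v = HY k" using T(3) TH by auto
      then show ?thesis using w mono TH 3 by auto
    qed
  next
    case (TI k)
    have "j < 3" using T(2) TI by simp
    then consider "j = 0" | "j = 1" | "j = 2" by linarith
    then show ?thesis
    proof cases
      case 1
      then have wv: "w = HY k" "v = K k" using T(3) TI by auto
      then show ?thesis using w mono T(4) TI 1 by auto
    next
      case 2
      then have "w = K k" "v = V k" using T(3) TI by auto
      then show ?thesis using w mono by auto
    next
      case 3
      then have "w = V k" "v = HZ k" using T(3) TI by auto
      then show ?thesis using w mono TI 3 by auto
    qed
  next
    case TF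
    show ?thesis
    proof (rule TF_cases[OF T(2,3)[unfolded TF]])
      assume j: "j = 0" "w = U N" "v = K 0"
      \<comment> \<open>After \<open>TF\<close> has ended its first edge cannot be caught; before
        that, the record at \<open>U N\<close> is a complete choice in agreement with the locks,
        which is excluded.\<close>
      have False
      proof (cases "post g \<theta>")
        case True
        then show False using T(4) TF j by (simp add: post_def)
      next
        case False
        then obtain s where "progress g s N \<theta>" using w j by auto
        then show False using no by (auto simp: progress_def)
      qed
      then show ?thesis ..
    next
      assume j: "0 < j" "j < m" "w = K (j - 1)" "v = K j"
      then show ?thesis using w T(4) TF by (simp add: post_def)
    next
      assume "j = Suc m" "w = Src" "v = V 0"
      then show ?thesis using TF by (simp add: post_def passed_def)
    qed auto
  next
    case (TW a b)
    then have ab: "a < C" "b < C" "clash a b" using T(1) by auto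
    have nc: "\<not> clash b a" using ab(3) by (auto simp: clash_def)
    have "j < 3" using T(2) TW by simp
    then consider "j = 0" | "j = 1" | "j = 2" by linarith
    then show ?thesis
    proof cases
      case 1
      then have wv: "w = X b a" "v = X b (Suc a)" using T(3) TW by auto
      \<comment> \<open>If \<open>a\<close> had been chosen, this trip would have ended by time
        \<theta>, yet it is boarded at its first edge.\<close>
      have "s (lay a) \<noteq> a" if "progress g s (lay b) \<theta>" for s
      proof
        assume "s (lay a) = a"
        moreover have "lay a < lay b" using ab by (simp add: clash_def)
        ultimately have "g (TW a b) + 3 \<le> \<theta>" using that ab unfolding progress_def by metis
        then show False using T(4) TW 1 by simp
      qed
      then show ?thesis unfolding wv using w[unfolded wv] nc le by (intro inv_X_Suc) auto
    next
      case 2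
      then have wv: "w = X b (Suc a)" "v = X a b" using T(3) TW by auto
      have "Suc (lay a) \<le> lay b" using ab by (simp add: clash_def)
      from inv_X_U[OF w[unfolded wv] le this] show ?thesis unfolding wv by auto
    next
      case 3
      then have wv: "w = X a b" "v = X a (Suc b)" using T(3) TW by auto
      show ?thesis unfolding wv using w[unfolded wv] nc le TW 3 by (intro inv_X_Suc) auto
    qed
  next
    case TIni
    then have "v = U 0" using T(2,3) by auto
    moreover have "progress g (\<lambda>_. 0) 0 ?\<theta>'" by (simp add: progress_def choice_def)
    ultimately show ?thesis by auto
  next
    case (TEnt a)
    then have wv: "w = U (lay a)" "v = X a 0" using T(2,3) by auto
    \<comment> \<open>An option with a trip \<open>TEnt\<close> is at least \<open>2 * B\<close>, so
      no lock concerns it.\<close>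
    have "bit_ok g a" using T(1) TEnt by (auto simp: bit_ok_def)
    then have fr: "fresh g s a 0 ?\<theta>'" for s by (simp add: fresh_def)
    consider "post g \<theta>" | s where "progress g s (lay a) \<theta>" using w unfolding wv by auto
    then show ?thesis
    proof cases
      case 1
      then show ?thesis unfolding wv using mono(1) by simp
    next
      case (2 s)
      then show ?thesis unfolding wv using mono(2)[OF 2] fr by auto
    qed
  next
    case (TExt a)
    then have wv: "w = X a C" "v = U (Suc (lay a))" and a: "a < C" using T by auto
    consider "post g \<theta>" | "\<exists>s. progress g s (Suc (lay a)) \<theta>" | s
      where "progress g s (lay a) \<theta>" "fresh g s a C \<theta>"
      using w wv by auto
    then have "inv g v \<theta>"
      unfolding wv by cases (use progress_Suc[OF _ _ a] in auto)
    then show ?thesis using mono unfolding wv by auto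
  next
    case (TCh a b)
    then have wv: "w = X a b" "v = X a (Suc b)" and nc: "\<not> clash a b" "\<not> clash b a" using T by auto
    show ?thesis unfolding wv using w[unfolded wv] nc le by (intro inv_X_Suc) auto
  next
    case (TLf k i)
    then show ?thesis using w T(2,3) by auto
  next
    case (TBy x)
    then have "w = V 0" "v = x" "x \<in> set core_nodes" using T by auto
    moreover have "post g ?\<theta>'" using w mono calculation by auto
    ultimately show ?thesis by (cases x) auto
  next
    case (TRet x)
    then show ?thesis using T(2,3) by auto
  qed
qed

text \<open>Every path from a leaf begins with a ride to the source, where the invariant imposes
  nothing. Hence it holds along the whole path.\<close>

lemma route_from_leaf:
  assumes "j < length (route T)" "route T ! j = (Lf a b, v)"
  shows "v = Src"
proof (cases T)
  case TF
  then show ?thesis by (cases rule: TF_cases[OF assms[unfolded TF]]) simp_all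
qed (use assms in \<open>auto simp: nth_Cons' split: if_splits\<close>)

lemma arr_leaf_inv:
  assumes no: "\<not> (\<exists>s. choice s N \<and> (\<forall>l<N. bit_ok g (s l)))"
    and "arr g u v \<theta>" "u = Lf a b"
  shows "inv g v \<theta>"
  using assms(2,3)
proof (induction rule: arr.induct)
  case (arr_base T j u v)
  then show ?case using route_from_leaf[of j T a b v] by simp
next
  case (arr_step u w \<theta> T j v)
  then show ?case by (intro inv_step[OF no]) auto
qed

text \<open>For \<open>j < j'\<close>, leaves of hub \<open>j'\<close> need lock \<open>j\<close> to
  open onwards, while leaves of hub \<open>j\<close> need the opposite order. These conditions do
  not depend on the path or its times, so one hub \<open>h\<close> serves for all paths.\<close>

lemma few_leaves_reached:
  assumes no: "\<not> (\<exists>s. choice s N \<and> (\<forall>l<N. bit_ok g (s l)))"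
  obtains h where "\<And>a b j i \<theta>. arr g (Lf a b) (Lf j i) \<theta> \<Longrightarrow> j = h"
proof -
  have uniq: "j = j'" if "inv g (Lf j i) \<theta>" "inv g (Lf j' i') \<theta>'" for j j' i i' \<theta> \<theta>'
    using that by (cases j j' rule: linorder_cases) (fastforce simp: passed_def)+
  show ?thesis
  proof (cases "\<exists>a b j i \<theta>. arr g (Lf a b) (Lf j i) \<theta>")
    case True
    then obtain a b h i \<theta> where "arr g (Lf a b) (Lf h i) \<theta>" by blast
    then have "inv g (Lf h i) \<theta>" using arr_leaf_inv[OF no] by blast
    then show ?thesis using arr_leaf_inv[OF no] uniq by (intro that[of h]) blast
  qed (use that in blast)
qed

text \<open>From a leaf a path leads to inner nodes or to the \<open>m\<close> leaves of a single
  hub, besides the leaf itself. The pairs that start in an inner node are few and counted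
  wholesale.\<close>

lemma reachability_le:
  assumes f: "inj_on f (set all_nodes)" and g: "\<And>i. i < length tags \<Longrightarrow> \<tau> i = g (tags ! i)"
    and no: "\<not> (\<exists>s. choice s N \<and> (\<forall>l<N. bit_ok g (s l)))"
  shows "reachability (network f) \<tau> \<le>
    m * m * (length inner_nodes + 1 + m) + length inner_nodes * (length inner_nodes + m * m)"
proof -
  let ?R = "{(u, v). u \<in> set all_nodes \<and> v \<in> set all_nodes \<and> (u = v \<or> (\<exists>\<theta>. arr g u v \<theta>))}"
  let ?I = "set inner_nodes" and ?L = "set leaves"
  have cI: "card ?I = length inner_nodes" and cL: "card ?L = m * m"
    using distinct_all_nodes length_leaves by (auto simp: all_nodes_def distinct_card)
  obtain h where h: "\<And>a b j i \<theta>. arr g (Lf a b) (Lf j i) \<theta> \<Longrightarrow> j = h"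
    by (rule few_leaves_reached[OF no], rule that)
  let ?H = "Lf h ` {..<m}"
  have "?R \<subseteq> ?I \<times> set all_nodes \<union> (SIGMA u : ?L. ?I \<union> ?H \<union> {u})"
    using h by (auto simp: set_all_nodes set_leaves)
  then have "card ?R \<le> card (?I \<times> set all_nodes \<union> (SIGMA u : ?L. ?I \<union> ?H \<union> {u}))"
    by (intro card_mono) auto
  also have "\<dots> \<le> card (?I \<times> set all_nodes) + card (SIGMA u : ?L. ?I \<union> ?H \<union> {u})"
    by (rule card_Un_le)
  also have "card (?I \<times> set all_nodes) = length inner_nodes * (length inner_nodes + m * m)"
    using distinct_card[OF distinct_all_nodes] length_leaves
      by (simp add: card_cartesian_product cI all_nodes_def)
  also have "card (SIGMA u : ?L. ?I \<union> ?H \<union> {u}) = (\<Sum>u\<in>?L. card (?I \<union> ?H \<union> {u}))"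
    by (rule card_SigmaI) auto
  also have "\<dots> \<le> (\<Sum>u\<in>?L. length inner_nodes + m + 1)"
  proof (rule sum_mono)
    fix u
    have "card (?I \<union> ?H \<union> {u}) \<le> card ?I + card ?H + card {u}"
      using card_Un_le[of "?I \<union> ?H" "{u}"] card_Un_le[of ?I ?H] by linarith
    then show "card (?I \<union> ?H \<union> {u}) \<le> length inner_nodes + m + 1"
      using card_image_le[of "{..<m}" "Lf h"] by (simp add: cI)
  qed
  also have "\<dots> = m * m * (length inner_nodes + 1 + m)" by (simp add: cL)
  finally have "card ?R \<le> m * m * (length inner_nodes + 1 + m) + length inner_nodes *
    (length inner_nodes + m * m)"
    by simp
  moreover have "reachability (network f) \<tau> = card ?R"
  proof -
    have "{(x, y). x \<in> nodes (network f) \<and> y \<in> nodes (network f) \<and> reachable (network f) \<tau> x y} =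
      map_prod f f ` ?R"
    proof -
      have "reachable (network f) \<tau> (f u) (f v) \<longleftrightarrow> u = v \<or> (\<exists>\<theta>. arr g u v \<theta>)"
        if "u \<in> set all_nodes" "v \<in> set all_nodes" for u v
        by (rule reachable_network[OF f _ that]) (rule g)
      then show ?thesis by (force simp: network_def)
    qed
    moreover have "inj_on (map_prod f f) ?R" using f by (auto simp: inj_on_def)
    ultimately show ?thesis unfolding reachability_def by (simp add: card_image)
  qed
  ultimately show ?thesis by simp
qed


subsection \<open>Temporalisations from choices\<close>

definition early :: "(tag \<Rightarrow> real) \<Rightarrow> node \<Rightarrow> node \<Rightarrow> real \<Rightarrow> bool" where
  "early g u v \<theta> \<longleftrightarrow> (\<exists>t\<le>\<theta>. arr g u v t)"

lemma early_step:
  assumes "early g u w \<theta>" "T \<in> set tags" "j < length (route T)" "route T ! j = (w, v)"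
    "\<theta> \<le> g T + real j"
    "g T + real j + 1 \<le> \<theta>'"
  shows "early g u v \<theta>'"
  using assms arr_step[of g u w _ T j v] unfolding early_def by (meson order_trans)

lemma choice_bit:
  assumes "choice s N" "l < B"
  shows "s l = 2 * l \<or> s l = 2 * l + 1"
proof -
  have s: "s l < C" "lay (s l) = l" using assms BN by (auto simp: choice_def)
  have "s l < 2 * B" using lay_rest[OF s(1)] s(2) assms(2) by (metis not_le)
  then have "s l div 2 < B" by auto
  from lay_bit[OF this] have "lay (s l) = s l div 2"
    by (metis even_two_times_div_two odd_two_times_div_two_succ)
  then show ?thesis using s(2) by auto
qed

text \<open>A timetable in which layer \<open>l\<close> is entered at time \<open>l * D\<close>. The
  whole way is common to all leaves, since every leaf is at the source by time -1.\<close>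

lemma choice_reaches_leaves:
  assumes s: "choice s N"
  obtains g where "\<And>a b j i. a < m \<Longrightarrow> b < m \<Longrightarrow> j < m \<Longrightarrow> i < m \<Longrightarrow> \<exists>\<theta>. arr g (Lf a b) (Lf j i) \<theta>"
proof -
  \<comment> \<open>Per layer, 4 time units lead into the chain, \<open>C\<close> along it and 1 out
    of it; the remainder of \<open>D\<close> is slack.\<close>
  define D where "D = real C + 10"
  define L where "L a = real (lay a) * D" for a
  \<comment> \<open>A trip \<open>TW a b\<close> is timed for its last edge if \<open>a\<close> is
    chosen and for its first edge, on the chain of \<open>b\<close>, otherwise. Both are never
    wanted, as no two chosen options conflict. The two trips of a bit lock are 3 apart, in the order
    that the choice dictates.\<close>
  define g where "g T = (case T of
      TY j \<Rightarrow> if s j = 2 * j then real j * D else real j * D + 3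
    | TZ j \<Rightarrow> if s j = 2 * j then real j * D + 3 else real j * D
    | TF \<Rightarrow> real N * D | TIni \<Rightarrow> - 1 | TEnt a \<Rightarrow> L a + 3 | TCh a b \<Rightarrow> L a + 4 + real b | TExt a \<Rightarrow> L a
      + 4 + real C
    | TW a b \<Rightarrow> if s (lay a) = a then L a + 2 + real b else L b + 4 + real a
    | TLf j i \<Rightarrow> real N * D + real m + 10 | TRet v \<Rightarrow> - 2 | _ \<Rightarrow> 0)" for T
  have sl: "s l < C" "lay (s l) = l" if "l < N" for l using s that by (auto simp: choice_def)
  have nc: "\<not> conf (s l) (s l')" if "l < l'" "l' < N" for l l' using s that
    by (auto simp: choice_def)
  have leaf: "early g (Lf a b) (Lf j i) (real N * D + real m + 11)"
    if ab: "a < m" "b < m" and ji: "j < m" "i < m" for a b j i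
  proof -
    let ?e = "early g (Lf a b)"
    have "arr g (Lf a b) Src (g (TRet (Lf a b)) + real 0 + 1)"
      by (rule arr_base) (use ab in auto)
    then have src: "?e Src (- 1)" by (auto simp: early_def g_def)
    have "?e (U l) (real l * D)" if "l \<le> N" for l
      using that
    proof (induction l)
      case 0
      show ?case by (rule early_step[OF src, of TIni 0]) (auto simp: g_def)
    next
      case (Suc l)
      then have l: "l < N" and u: "?e (U l) (real l * D)" by auto
      let ?a = "s l"
      have La: "L ?a = real l * D" using sl[OF l] by (simp add: L_def)
      have ent: "?e (X ?a 0) (L ?a + 4)"
      proof (cases "?a < 2 * B")
        case True
        then have lB: "l < B" using lay_rest sl[OF l] lay_bit
          by (metis (no_types, opaque_lifting) even_two_times_div_two less_mult_imp_div_less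
            mult.commute
              odd_two_times_div_two_succ)
        consider "?a = 2 * l" | "?a = 2 * l + 1" using choice_bit[OF s lB] by blast
        then show ?thesis
        proof cases
          case 1
          have "?e (LY l) (real l * D + 3)"
            by (rule early_step[OF u, of "TY l" 2]) (use 1 lB in \<open>auto simp: g_def\<close>)
          then show ?thesis
            by (rule early_step[of _ _ _ _ "TZ l" 0]) (use 1 lB La in \<open>auto simp: g_def\<close>)
        next
          case 2
          have "?e (LZ l) (real l * D + 3)"
            by (rule early_step[OF u, of "TZ l" 2]) (use 2 lB in \<open>auto simp: g_def\<close>)
          then show ?thesis
            by (rule early_step[of _ _ _ _ "TY l" 0]) (use 2 lB La in \<open>auto simp: g_def\<close>)
        qed
      next
        case False
        show ?thesis
          by (rule early_step[OF u, of "TEnt ?a" 0]) (use False sl[OF l] La in \<open>auto simp: g_def\<close>)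
      qed
      have "?e (X ?a p) (L ?a + 4 + real p)" if "p \<le> C" for p
        using that
      proof (induction p)
        case 0
        then show ?case using ent by simp
      next
        case (Suc p)
        then have p: "p < C" and x: "?e (X ?a p) (L ?a + 4 + real p)" by auto
        consider "clash ?a p" | "clash p ?a" | "\<not> clash ?a p" "\<not> clash p ?a" by blast
        then show ?case
        proof cases
          case 1
          show ?thesis
            by (rule early_step[OF x, of "TW ?a p" 2]) (use 1 p sl[OF l] in \<open>auto simp: g_def\<close>)
        next
          case 2
          then have "s (lay p) \<noteq> p" using nc[of "lay p" l] sl[OF l] l by (auto simp: clash_def)
          then show ?thesis
            by (intro early_step[OF x, of "TW p ?a" 0]) (use 2 p sl[OF l] in \<open>auto simp: g_def\<close>)
        next
          case 3
          then show ?thesis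
            by (intro early_step[OF x, of "TCh ?a p" 0]) (use p sl[OF l] in \<open>auto simp: g_def\<close>)
        qed
      qed
      from this[OF order_refl] show ?case
        by (rule early_step[of _ _ _ _ "TExt ?a" 0])
          (use sl[OF l] La in \<open>auto simp: g_def D_def algebra_simps\<close>)
    qed
    from this[OF order_refl] have un: "?e (U N) (real N * D)" .
    have "?e (K j) (real N * D + real j + 1)" if "j < m" for j
      using that
    proof (induction j)
      case 0
      show ?case by (rule early_step[OF un, of TF 0])
        (use length_TF nth_TF in \<open>auto simp: g_def simp del: route.simps\<close>)
    next
      case (Suc j)
      then have "?e (K j) (real N * D + real j + 1)" by simp
      then show ?case
        by (rule early_step[of _ _ _ _ TF "Suc j"])
          (use Suc.prems length_TF nth_TF in \<open>auto simp: g_def simp del: route.simps\<close>)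
    qed
    from this[OF ji(1)] show ?thesis
      by (rule early_step[of _ _ _ _ "TLf j i" 0]) (use ji in \<open>auto simp: g_def\<close>)
  qed
  show ?thesis
  proof (rule that[of g])
    show "\<exists>\<theta>. arr g (Lf a b) (Lf j i) \<theta>" if "a < m" "b < m" "j < m" "i < m" for a b j i
      using leaf[OF that] by (auto simp: early_def)
  qed
qed

lemma max_reachability_ge:
  assumes f: "inj_on f (set all_nodes)" and s: "choice s N"
  shows "(m * m) * (m * m) \<le> max_reachability (network f)"
proof -
  obtain g where g: "\<And>a b j i. a < m \<Longrightarrow> b < m \<Longrightarrow> j < m \<Longrightarrow> i < m \<Longrightarrow> \<exists>\<theta>. arr g (Lf a b) (Lf j i) \<theta>"
    by (rule choice_reaches_leaves[OF s], rule that)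
  let ?\<tau> = "\<lambda>i. g (tags ! i)"
  have "map_prod f f ` (set leaves \<times> set leaves) \<subseteq>
    {(x, y). x \<in> nodes (network f) \<and> y \<in> nodes (network f) \<and> reachable (network f) ?\<tau> x y}"
  proof -
    have "reachable (network f) ?\<tau> (f u) (f v)" if "u \<in> set leaves" "v \<in> set leaves" for u v
    proof -
      have "u \<in> set all_nodes" "v \<in> set all_nodes" using that by (auto simp: set_all_nodes)
      moreover have "\<exists>\<theta>. arr g u v \<theta>" using that g by (auto simp: set_leaves)
      ultimately show ?thesis using reachable_network[OF f, of ?\<tau> g u v] by blast
    qed
    then show ?thesis by (auto simp: network_def set_all_nodes)
  qed
  then have "card (map_prod f f ` (set leaves \<times> set leaves)) \<le> reachability (network f) ?\<tau>"
    unfolding reachability_def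
    by (rule card_mono[rotated]) (rule finite_subset[of _ "nodes (network f) \<times> nodes (network f)"],
        auto simp: network_def)
  moreover have "card (map_prod f f ` (set leaves \<times> set leaves)) = (m * m) * (m * m)"
  proof -
    have "inj_on (map_prod f f) (set leaves \<times> set leaves)"
      using f by (auto simp: inj_on_def set_all_nodes)
    moreover have "card (set leaves) = m * m"
      using distinct_all_nodes length_leaves by (auto simp: all_nodes_def distinct_card)
    ultimately show ?thesis by (simp add: card_image card_cartesian_product)
  qed
  moreover have "reachability (network f) ?\<tau> \<le> max_reachability (network f)"
    unfolding max_reachability_def
    by (rule Max_ge[OF finite_range_reachability]) (auto simp: network_def)
  ultimately show ?thesis by linarith
qed

text \<open>Every node returns to the source, and the last edge of \<open>TF\<close> goes on to
  \<open>V 0\<close>. The locks below \<open>k\<close> are set to lead onwards and the others to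
  their hubs, so a suitable \<open>k\<close> exists for each target; the nodes of the layers are
  served by \<open>TBy\<close>.\<close>

lemma strongly_temporalisable_network:
  assumes f: "inj_on f (set all_nodes)"
  shows "strongly_temporalisable (network f)"
proof -
  \<comment> \<open>\<open>TF\<close> starts so early that it leaves the source at time 0, when
    every node has arrived there. Lock \<open>i\<close> operates from time \<open>10 * i\<close>
    on.\<close>
  define g where "g k T = (case T of
      TH i \<Rightarrow> if i < k then 10 * real i + 3 else 10 * real i
    | TI i \<Rightarrow> if i < k then 10 * real i else 10 * real i + 3
    | TF \<Rightarrow> - real m - 1 | TBy v \<Rightarrow> 1 | TLf j i \<Rightarrow> 10 * real m + 10 | TRet v \<Rightarrow> - 1 | _ \<Rightarrow> 0)" for k T
  have main: "\<exists>k \<theta>. early (g k) u v \<theta>" if u: "u \<in> set all_nodes" and v: "v \<in> set all_nodes" for u v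
  proof -
    have src: "early (g k) u Src 0" for k
      using arr_base[of "TRet u" 0 u Src "g k"] u by (auto simp: early_def g_def)
    have v0: "early (g k) u (V 0) 2" for k
      by (rule early_step[OF src, of TF "Suc m"])
        (use length_TF nth_TF in \<open>auto simp: g_def simp del: route.simps\<close>)
    have vj: "early (g k) u (V j) (10 * real j + 2)" if "j \<le> k" "j \<le> m" for j k
      using that
    proof (induction j)
      case 0
      then show ?case using v0 by simp
    next
      case (Suc j)
      then have "early (g k) u (V j) (10 * real j + 2)" by simp
      then have "early (g k) u (HZ j) (10 * real j + 3)"
        by (rule early_step[of _ _ _ _ "TI j" 2]) (use Suc.prems in \<open>auto simp: g_def\<close>)
      then show ?case
        by (rule early_step[of _ _ _ _ "TH j" 0]) (use Suc.prems in \<open>auto simp: g_def\<close>)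
    qed
    have hy: "early (g j) u (HY j) (10 * real j + 3)" if "j < m" for j
      by (rule early_step[OF vj[of j j], of "TH j" 2]) (use that in \<open>auto simp: g_def\<close>)
    have kj: "early (g j) u (K j) (10 * real j + 4)" if "j < m" for j
      by (rule early_step[OF hy[OF that], of "TI j" 0]) (use that in \<open>auto simp: g_def\<close>)
    have byp: "early (g 0) u v 2" if "v \<in> set core_nodes"
      using early_step[OF src[of 0], of TF "Suc m" "V 0" 1] length_TF nth_TF
        early_step[of "g 0" u "V 0" 1 "TBy v" 0 v 2] that
      by (auto simp: g_def simp del: route.simps(5))
    show ?thesis
    proof (cases v)
      case Src
      then show ?thesis using src by blast
    next
      case (V j)
      then show ?thesis using vj[of j j] v by auto
    next
      case (HZ j)
      then have "early (g (Suc j)) u (HZ j) (10 * real j + 3)"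
        by (intro early_step[OF vj[of j "Suc j"], of "TI j" 2]) (use v in \<open>auto simp: g_def\<close>)
      then show ?thesis using HZ by blast
    next
      case (Lf j i)
      then have j: "j < m" "i < m" using v by auto
      have "early (g j) u (Lf j i) (10 * real m + 11)"
        by (rule early_step[OF kj[OF j(1)], of "TLf j i" 0]) (use j in \<open>auto simp: g_def\<close>)
      then show ?thesis using Lf by blast
    qed (use hy kj byp v in auto)
  qed
  show ?thesis unfolding strongly_temporalisable_def
  proof (intro ballI)
    fix x y assume "x \<in> nodes (network f)" "y \<in> nodes (network f)"
    then obtain u v where uv: "u \<in> set all_nodes" "v \<in> set all_nodes" "x = f u" "y = f v"
      by (auto simp: network_def)
    from main[OF uv(1,2)] obtain k \<theta> where "arr (g k) u v \<theta>" by (auto simp: early_def)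
    then show "\<exists>\<tau>. reachable (network f) \<tau> x y"
      unfolding uv(3,4) using reachable_network[OF f _ uv(1,2), of "\<lambda>i. g k (tags ! i)" "g k"]
        by blast
  qed
qed

lemma approximation_yields_choice:
  fixes \<rho> :: real
  assumes f: "inj_on f (set all_nodes)" and g: "\<And>i. i < length tags \<Longrightarrow> \<tau> i = g (tags ! i)"
    and m_def: "m = 100 * (N + C * (C + 1) + 2 * B + 3)"
    and s: "choice s N" and \<rho>: "1 \<le> \<rho>" "\<rho> < sqrt (real (card (nodes (network f)))) / 12"
    and r: "1 / \<rho> * real (max_reachability (network f)) \<le> real (reachability (network f) \<tau>)"
  shows "\<exists>s. choice s N \<and> (\<forall>l<N. bit_ok g (s l))"
proof (rule ccontr)
  assume no: "\<not> (\<exists>s. choice s N \<and> (\<forall>l<N. bit_ok g (s l)))"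
  define M where "M = real m"
  have M: "300 \<le> M" using m_def by (simp add: M_def)
  \<comment> \<open>By its definition \<open>m\<close> is 100 times the part of the inner nodes that
    does not grow with \<open>m\<close>; this part adds 0.01 to the factor 4 from the nodes around
    the hubs.\<close>
  have q: "real (length inner_nodes) = 4.01 * M"
    unfolding M_def length_inner_nodes using arg_cong[OF m_def, of real] by simp
  have "card (nodes (network f)) = length inner_nodes + m * m"
    using card_image[OF f] distinct_card[OF distinct_all_nodes] length_leaves
    by (simp add: network_def all_nodes_def)
  then have n: "real (card (nodes (network f))) = M * M + 4.01 * M" using q by (simp add: M_def)
  have "sqrt (M * M + 4.01 * M) \<le> M + 3"
    using M by (intro real_le_lsqrt) (auto simp: power2_eq_square algebra_simps)
  then have "sqrt (M * M + 4.01 * M) / 12 \<le> (M + 3) / 12" by (rule divide_right_mono) simp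
  from order.strict_trans2[OF \<rho>(2)[unfolded n] this] have \<rho>': "\<rho> \<le> (M + 3) / 12"
    by (rule less_imp_le)
  have "real (reachability (network f) \<tau>) \<le> M * M * (4.01 * M + 1 + M) + 4.01 * M *
    (4.01 * M + M * M)"
  proof -
    have "reachability (network f) \<tau> \<le> m * m * (length inner_nodes + 1 + m) + length inner_nodes *
      (length inner_nodes + m * m)"
      by (rule reachability_le[OF f _ no]) (rule g)
    then have "real (reachability (network f) \<tau>) \<le>
      real (m * m * (length inner_nodes + 1 + m) + length inner_nodes *
        (length inner_nodes + m * m))"
      by (simp only: of_nat_le_iff)
    then show ?thesis unfolding of_nat_add of_nat_mult q M_def[symmetric] by simp
  qed
  also have "\<dots> = (M * M) * (9.02 * M + 17.0801)" by (simp add: algebra_simps)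
  \<comment> \<open>\<open>300 \<le> M\<close> absorbs the lower-order terms, here and in
    \<open>M + 3 \<le> 1.1 * M\<close> below. The product of 9.1 and 1.1 stays under 12.\<close>
  also have "\<dots> \<le> (M * M) * (9.1 * M)" using M by (intro mult_left_mono) auto
  finally have R: "real (reachability (network f) \<tau>) \<le> (M * M) * (9.1 * M)" .
  have "(M * M) * (M * M) \<le> real (max_reachability (network f))"
    using max_reachability_ge[OF f s] unfolding M_def by (metis of_nat_le_iff of_nat_mult)
  also have "\<dots> \<le> \<rho> * real (reachability (network f) \<tau>)" using r \<rho>(1) by (simp add: field_simps)
  also have "\<dots> \<le> ((M + 3) / 12) * ((M * M) * (9.1 * M))"
    using \<rho>' R \<rho>(1) M by (intro mult_mono) auto
  also have "\<dots> \<le> (1.1 * M / 12) * ((M * M) * (9.1 * M))"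
    using M by (intro mult_right_mono) auto
  also have "\<dots> = (M * M) * (M * M) * (10.01 / 12)" by simp
  finally have "(M * M) * (M * M) \<le> (M * M) * (M * M) * (10.01 / 12)" .
  moreover have "0 < (M * M) * (M * M)" using M by simp
  ultimately show False by simp
qed

end

section \<open>Computations as layered choices\<close>

text \<open>
  For each time \<open>t\<close>, the state and for each tape the position of the head, the scanned symbol and the
  time of the last visit of the scanned cell are guessed. With the time of the last visit at hand,
  consistency is a property of pairs of guesses. Positions are shifted by \<open>T + 1\<close>, the visit time
  \<open>t\<close> is represented by \<open>t + 1\<close>, and 0 stands for a cell that has not been visited before.
\<close>

type_synonym opt = "nat \<times> nat \<times> (nat \<times> nat \<times> nat) list"

text \<open>Indexing through \<open>drop\<close> and \<open>hd\<close>, for which closure rules are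
  at hand.\<close>

definition elem :: "'a list \<Rightarrow> nat \<Rightarrow> 'a" where "elem xs n = hd (drop n xs)"

lemma elem_nth: "n < length xs \<Longrightarrow> elem xs n = xs ! n"
  by (simp add: elem_def hd_drop_conv_nth)

text \<open>Displacements are shifted by 1 to become natural numbers. In the halting state the
  machine idles, so every configuration has a successor of the same form.\<close>

definition act_of :: "tm \<Rightarrow> nat \<Rightarrow> nat list \<Rightarrow> nat \<times> (nat \<times> nat) list" where
  "act_of M q ss = (if q = num_states M then (q, map (\<lambda>s. (s, 1)) ss)
     else (fst (delta M q ss), map (\<lambda>(a, d). (a, nat (d + 1))) (snd (delta M q ss))))"

text \<open>The transition function as a finite table. It depends on the machine only, so it is a
  constant of the reduction and is merely searched.\<close>

definition act_table :: "tm \<Rightarrow> ((nat \<times> nat list) \<times> nat \<times> (nat \<times> nat) list) list" where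
  "act_table M = concat (map (\<lambda>q. map (\<lambda>ss. ((q, ss), act_of M q ss))
     (List.n_lists (num_tapes M) [0..<num_symbols M])) [0..<Suc (num_states M)])"

definition table_lookup :: "('a \<times> 'b) list \<Rightarrow> 'a \<Rightarrow> 'b" where
  "table_lookup D key = snd (hd (filter (\<lambda>e. fst e = key) D))"

definition cell_list :: "nat \<Rightarrow> nat \<Rightarrow> (nat \<times> nat \<times> nat) list" where
  "cell_list A T = concat (map (\<lambda>h. concat (map (\<lambda>s. map (\<lambda>l. (h, s, l)) [0..<T + 2]) [0..<A]))
    [0..<2 * T + 3])"

text \<open>Conditions on a single guess. Layer \<open>T + 1\<close> is no configuration but a
  probe: all heads are put on cell 0, and the symbol found on the first tape must represent
  \<open>True\<close>. A cell without earlier visit shows the input; the cells of the witness are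
  left open here and are tied to the bit layers by \<open>fits\<close>.\<close>

definition legal :: "nat \<Rightarrow> nat \<Rightarrow> bool list \<Rightarrow> opt \<Rightarrow> bool" where
  "legal B T ew a \<longleftrightarrow> (let t = fst a - B; q = fst (snd a); cs = snd (snd a); c = hd cs in
     (t = 0 \<longrightarrow> q = 0 \<and> (\<forall>c\<in>set cs. fst c = T + 1)) \<and>
     (t = T + 1 \<longrightarrow> (\<forall>c\<in>set cs. fst c = T + 1) \<and> fst (snd c) = 2) \<and>
     (\<forall>c\<in>set cs. snd (snd c) \<le> t) \<and>
     (\<forall>c\<in>set (tl cs). snd (snd c) = 0 \<longrightarrow> fst (snd c) = 0) \<and>
     (snd (snd c) = 0 \<longrightarrow>
       (if fst c < T + 1 \<or> T + 1 + length ew + B \<le> fst c then fst (snd c) = 0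
        else if fst c < T + 1 + length ew then fst (snd c) = (if elem ew (fst c - (T + 1)) then 2
          else 1)
        else True)))"

text \<open>The bit options come first, so that the options of bit layer \<open>j\<close> have the
  indices \<open>2 * j\<close> and \<open>2 * j + 1\<close>; time \<open>t\<close> becomes layer
  \<open>B + t\<close>.\<close>

definition opts :: "nat \<Rightarrow> nat \<Rightarrow> nat \<Rightarrow> nat \<Rightarrow> nat \<Rightarrow> bool list \<Rightarrow> opt list" where
  "opts k Q A B T ew = concat (map (\<lambda>j. [(j, 0, []), (j, 1, [])]) [0..<B]) @
     filter (legal B T ew) (concat (map (\<lambda>t. concat (map (\<lambda>q. map (\<lambda>cs. (B + t, q, cs))
       (List.n_lists k (cell_list A T))) [0..<Suc Q])) [0..<T + 2]))"

text \<open>Conditions on a guess \<open>a\<close> and a guess \<open>b\<close> of a later layer. An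
  unvisited witness cell must show its bit; consecutive times are linked by a step, except into the
  probe. The last visit claimed by \<open>b\<close> must be true: at that time the head stood on the
  cell and wrote the symbol seen now, and at no later time it stood there.\<close>

definition fits :: "((nat \<times> nat list) \<times> nat \<times> (nat \<times> nat) list) list \<Rightarrow> nat \<Rightarrow> nat \<Rightarrow> nat \<Rightarrow> nat \<Rightarrow> opt
  \<Rightarrow> opt \<Rightarrow> bool" where
  "fits D k B T E a b \<longleftrightarrow>
     (if fst b < B then True
      else if fst a < B then
        (let c = hd (snd (snd b)) in snd (snd c) = 0 \<and> fst c = T + 1 + E + fst a \<longrightarrow>
          fst (snd c) = fst (snd a) + 1)
      else
        (let cs = snd (snd a); cs' = snd (snd b);
           act = table_lookup D (fst (snd a), map (\<lambda>c. fst (snd c)) cs); t = Suc (fst a - B) in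
         (fst b = Suc (fst a) \<and> fst b \<noteq> B + T + 1 \<longrightarrow> fst (snd b) = fst act \<and>
            (\<forall>n\<in>set [0..<k]. fst (elem cs' n) + 1 = fst (elem cs n) + snd (elem (snd act) n))) \<and>
         (\<forall>n\<in>set [0..<k].
            (snd (snd (elem cs' n)) = t \<longrightarrow> fst (elem cs n) = fst (elem cs' n) \<and>
              fst (snd (elem cs' n)) = fst (elem (snd act) n)) \<and>
            (snd (snd (elem cs' n)) < t \<longrightarrow> fst (elem cs n) \<noteq> fst (elem cs' n)))))"

lemma set_cell_list: "c \<in> set (cell_list A T) \<longleftrightarrow>
  fst c < 2 * T + 3 \<and> fst (snd c) < A \<and> snd (snd c) < T + 2"
  unfolding cell_list_def by (cases c) (auto simp: image_iff simp del: upt_Suc)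

lemma table_lookup_act_table:
  assumes "q \<le> num_states M" "length ss = num_tapes M" "set ss \<subseteq> {..<num_symbols M}"
  shows "table_lookup (act_table M) (q, ss) = act_of M q ss"
proof -
  let ?F = "filter (\<lambda>e. fst e = (q, ss)) (act_table M)"
  have "((q, ss), act_of M q ss) \<in> set ?F"
    using assms unfolding act_table_def
    by (auto simp: set_n_lists less_Suc_eq_le lessThan_atLeast0 simp del: upt_Suc)
  moreover have "e = ((q, ss), act_of M q ss)" if "e \<in> set ?F" for e
    using that unfolding act_table_def by auto
  ultimately show ?thesis unfolding table_lookup_def
    by (metis hd_in_set length_greater_0_conv length_pos_if_in_set snd_conv)
qed

section \<open>Runs of a machine as solutions of the choice problem\<close>

locale computation =
  fixes M :: tm and x y :: "bool list" and B T :: nat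
  assumes M: "turing_machine M" and y: "length y = B"
begin

definition ew :: "bool list" where "ew = enc_word x"
definition k :: nat where "k = num_tapes M"
definition q :: "nat \<Rightarrow> nat" where "q t = fst ((step M ^^ t) (initial M (enc_pair x y)))"
definition ts :: "nat \<Rightarrow> tape list" where "ts t = snd ((step M ^^ t) (initial M (enc_pair x y)))"
definition pos :: "nat \<Rightarrow> nat \<Rightarrow> int" where "pos t n = fst (ts t ! n)"
definition con :: "nat \<Rightarrow> nat \<Rightarrow> int \<Rightarrow> nat" where "con t n = snd (ts t ! n)"
text \<open>The actual head positions, except for the probe in layer \<open>T + 1\<close>, which
  looks at cell 0.\<close>

definition hp :: "nat \<Rightarrow> nat \<Rightarrow> int" where "hp t n = (if t \<le> T then pos t n else 0)"
definition ss :: "nat \<Rightarrow> nat list" where "ss t = map (\<lambda>n. con t n (pos t n)) [0..<k]"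
definition wr :: "nat \<Rightarrow> nat \<Rightarrow> nat" where "wr t n = fst (snd (act_of M (q t) (ss t)) ! n)"

abbreviation "all_opts \<equiv> opts k (num_states M) (num_symbols M) B T ew"
abbreviation "ok \<equiv> fits (act_table M) k B T (length ew)"

definition solution :: "(nat \<Rightarrow> opt) \<Rightarrow> bool" where
  "solution z \<longleftrightarrow> (\<forall>i<B + T + 2. z i \<in> set all_opts \<and> fst (z i) = i) \<and>
     (\<forall>i i'. i < i' \<longrightarrow> i' < B + T + 2 \<longrightarrow> ok (z i) (z i')) \<and>
     (\<forall>j<B. z j = (j, if y ! j then 1 else 0, []))"

lemma k_pos: "0 < k"
  using M by (simp add: k_def turing_machine_def)

lemma valid: "q t \<le> num_states M" "length (ts t) = k" "n < k \<Longrightarrow> con t n p < num_symbols M"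
  using tm_config_valid[OF M, of t "enc_pair x y"] unfolding q_def ts_def con_def k_def by auto

lemma ss: "ss t = map (\<lambda>(h, c). c h) (ts t)"
  by (rule nth_equalityI) (auto simp: ss_def valid pos_def con_def case_prod_beta)

lemma ss_valid: "length (ss t) = k" "set (ss t) \<subseteq> {..<num_symbols M}"
  using valid by (auto simp: ss_def)

lemma lookup: "table_lookup (act_table M) (q t, ss t) = act_of M (q t) (ss t)"
  using table_lookup_act_table valid ss_valid by (simp add: k_def)

lemma evolve:
  shows "q (Suc t) = fst (act_of M (q t) (ss t))"
    and "n < k \<Longrightarrow> pos (Suc t) n + 1 = pos t n + int (snd (snd (act_of M (q t) (ss t)) ! n))"
    and "n < k \<Longrightarrow> con (Suc t) n = (con t n)(pos t n := wr t n)"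
    and "n < k \<Longrightarrow> n < length (snd (act_of M (q t) (ss t)))"
proof -
  have c: "(step M ^^ t) (initial M (enc_pair x y)) = (q t, ts t)" by (simp add: q_def ts_def)
  have "q (Suc t) = fst (act_of M (q t) (ss t)) \<and>
    (n < k \<longrightarrow> pos (Suc t) n + 1 = pos t n + int (snd (snd (act_of M (q t) (ss t)) ! n)) \<and>
      con (Suc t) n = (con t n)(pos t n := wr t n) \<and> n < length (snd (act_of M (q t) (ss t))))"
  proof (cases "q t = num_states M")
    case True
    then have "(step M ^^ Suc t) (initial M (enc_pair x y)) = (q t, ts t)" using c by simp
    then have "q (Suc t) = q t" "ts (Suc t) = ts t" unfolding q_def ts_def by simp_all
    then show ?thesis using True ss_valid(1)
      by (auto simp: act_of_def pos_def con_def wr_def ss_def)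
  next
    case False
    note s = step_nth[OF M c False ss]
    have dv: "snd (snd (delta M (q t) (ss t)) ! n) \<in> {-1, 0, 1}" if "n < k"
      using delta_valid(4)[OF M s(1,3,2)] that by (simp add: k_def)
    have len: "length (snd (delta M (q t) (ss t))) = k" using delta_valid(2)[OF M s(1,3,2)]
      by (simp add: k_def)
    have "q (Suc t) = fst (delta M (q t) (ss t))" using s(4) by (simp only: q_def)
    moreover have "ts (Suc t) ! n = (fst (ts t ! n) + snd (snd (delta M (q t) (ss t)) ! n),
        (snd (ts t ! n))(fst (ts t ! n) := fst (snd (delta M (q t) (ss t)) ! n)))" if "n < k"
      using s(5)[of n] that by (simp only: ts_def k_def)
    ultimately show ?thesis using False dv len
      by (auto simp: act_of_def pos_def con_def wr_def case_prod_beta)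
  qed
  then show "q (Suc t) = fst (act_of M (q t) (ss t))"
    "n < k \<Longrightarrow> pos (Suc t) n + 1 = pos t n + int (snd (snd (act_of M (q t) (ss t)) ! n))"
    "n < k \<Longrightarrow> con (Suc t) n = (con t n)(pos t n := wr t n)"
    "n < k \<Longrightarrow> n < length (snd (act_of M (q t) (ss t)))" by auto
qed

lemma act_displacement: "n < k \<Longrightarrow> snd (snd (act_of M (q t) (ss t)) ! n) \<le> 2"
proof -
  assume n: "n < k"
  show ?thesis
  proof (cases "q t = num_states M")
    case True
    then show ?thesis using ss_valid(1)[of t] n by (simp add: act_of_def)
  next
    case False
    then have "q t < num_states M" using valid(1)[of t] by simp
    note D = delta_valid[OF M this, of "ss t"]
    have "snd (snd (delta M (q t) (ss t)) ! n) \<in> {-1, 0, 1}"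
      "n < length (snd (delta M (q t) (ss t)))"
      using D(2,4) ss_valid n by (auto simp: k_def)
    then show ?thesis using False by (auto simp: act_of_def case_prod_beta)
  qed
qed

lemma pos_bound: "n < k \<Longrightarrow> \<bar>pos t n\<bar> \<le> int t"
proof (induction t)
  case 0
  then show ?case by (cases n) (auto simp: pos_def ts_def initial_def k_def)
next
  case (Suc t)
  then show ?case using evolve(2)[of n t] act_displacement[of n t] by linarith
qed

lemma unvisited:
  assumes "n < k" "i \<le> t" "\<forall>j. i \<le> j \<longrightarrow> j < t \<longrightarrow> pos j n \<noteq> p"
  shows "con t n p = con i n p"
  using assms(2,3)
proof (induction rule: dec_induct)
  case (step r)
  then show ?case using evolve(3)[OF assms(1), of r] by auto
qed simp

lemma last_visit:
  assumes "n < k" "i < t" "pos i n = p" "\<forall>j. i < j \<longrightarrow> j < t \<longrightarrow> pos j n \<noteq> p"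
  shows "con t n p = wr i n"
  using unvisited[OF assms(1), of "Suc i" t p] assms evolve(3)[OF assms(1), of i]
    by (simp add: Suc_le_eq)

lemma con_0: "n < k \<Longrightarrow> con 0 n p = (if n = 0 then word_tape (ew @ y) p else 0)"
  by (cases n) (auto simp: con_def ts_def initial_def k_def ew_def enc_pair_def)

lemma con_0_cases:
  "p < 0 \<or> int (length ew + B) \<le> p \<Longrightarrow> con 0 0 p = 0"
  "0 \<le> p \<Longrightarrow> p < int (length ew) \<Longrightarrow> con 0 0 p = (if ew ! nat p then 2 else 1)"
  "j < B \<Longrightarrow> con 0 0 (int (length ew + j)) = (if y ! j then 2 else 1)"
  using k_pos y by (auto simp: con_0 word_tape_def nth_append nat_less_iff nat_int_add)

lemma set_opts:
  assumes "B \<le> i"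
  shows "(i, r, cs) \<in> set all_opts \<longleftrightarrow> i < B + T + 2 \<and> r \<le> num_states M \<and> length cs = k \<and>
    set cs \<subseteq> set (cell_list (num_symbols M) T) \<and> legal B T ew (i, r, cs)"
proof -
  have "(\<exists>t. i = B + t \<and> t < T + 2) \<longleftrightarrow> i < B + T + 2" using assms by (auto intro!: exI[of _ "i - B"])
  then show ?thesis using assms unfolding opts_def
    by (auto simp: set_n_lists image_iff less_Suc_eq_le simp del: upt_Suc)
qed

text \<open>By strong induction over time the guesses coincide with the run. States and positions
  follow from the preceding layer, symbols from the layer of the last visit or, if there is none,
  from the initial tape.\<close>

lemma solution_accepts:
  assumes z: "solution z"
  shows "con (T + 1) 0 0 = 2"
proof -
  have zs: "z i \<in> set all_opts" "fst (z i) = i" if "i < B + T + 2" for i using z that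
    by (auto simp: solution_def)
  have zok: "ok (z i) (z i')" if "i < i'" "i' < B + T + 2" for i i' using z that
    by (auto simp: solution_def)
  have zb: "z j = (j, if y ! j then 1 else 0, [])" if "j < B" for j using z that
    by (auto simp: solution_def)
  define Q where "Q t = fst (snd (z (B + t)))" for t
  define cs where "cs t = snd (snd (z (B + t)))" for t
  have zt: "z (B + t) = (B + t, Q t, cs t)" if "t \<le> T + 1" for t
    using zs(2)[of "B + t"] that by (simp add: Q_def cs_def prod_eq_iff)
  have op: "length (cs t) = k" "legal B T ew (B + t, Q t, cs t)" if "t \<le> T + 1" for t
    using zs(1)[of "B + t"] that zt[OF that] set_opts[of "B + t" "Q t" "cs t"] by auto
  have main: "(t \<le> T \<longrightarrow> Q t = q t) \<and> (\<forall>n<k. int (fst (cs t ! n)) = hp t n + int T + 1 \<and>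
      fst (snd (cs t ! n)) = con t n (hp t n))" if "t \<le> T + 1" for t
    using that
  proof (induction t rule: less_induct)
    case (less t)
    have IH: "Q i = q i" "n < k \<Longrightarrow> int (fst (cs i ! n)) = pos i n + int T + 1"
      "n < k \<Longrightarrow> fst (snd (cs i ! n)) = con i n (pos i n)" if "i < t" for i n
      using less.IH[OF that] less.prems that by (auto simp: hp_def)
    have lk: "table_lookup (act_table M) (Q i, map (\<lambda>c. fst (snd c)) (cs i)) =
      act_of M (q i) (ss i)" if "i < t" for i
    proof -
      have "map (\<lambda>c. fst (snd c)) (cs i) = ss i"
        by (rule nth_equalityI) (use op(1)[of i] less.prems that IH(3)[OF that] in \<open>auto simp:
          ss_def\<close>)
      then show ?thesis using IH(1)[OF that] lookup by simp
    qed
    have okt: "(t = Suc i \<and> t \<noteq> T + 1 \<longrightarrow> Q t = fst (act_of M (q i) (ss i)) \<and>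
          (\<forall>n<k. fst (cs t ! n) + 1 = fst (cs i ! n) + snd (snd (act_of M (q i) (ss i)) ! n))) \<and>
        (\<forall>n<k. (snd (snd (cs t ! n)) = Suc i \<longrightarrow>
          fst (cs i ! n) = fst (cs t ! n) \<and> fst (snd (cs t ! n)) = wr i n) \<and>
            (snd (snd (cs t ! n)) < Suc i \<longrightarrow> fst (cs i ! n) \<noteq> fst (cs t ! n)))" if "i < t" for i
    proof -
      have i: "i \<le> T + 1" using that less.prems by simp
      have a: "j \<le> T + 1 \<Longrightarrow> elem (cs j) n = cs j ! n"
        "elem (snd (act_of M (q i) (ss i))) n = snd (act_of M (q i) (ss i)) ! n" if "n < k" for n j
        using that op(1)[of j] evolve(4)[of n i] by (auto intro!: elem_nth)
      show ?thesis using zok[of "B + i" "B + t"] that less.prems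
        unfolding zt[OF i] zt[OF less.prems] fits_def
        using i by (auto simp add: lk[OF that] Let_def a wr_def)
    qed
    have lg: "legal B T ew (B + t, Q t, cs t)" and len: "length (cs t) = k"
      using op[OF less.prems] by auto
    have mem: "cs t ! n \<in> set (cs t)" if "n < k" for n using len that by simp
    have l_le: "snd (snd (cs t ! n)) \<le> t" if "n < k" for n
      using lg mem[OF that] by (auto simp: legal_def Let_def)
    have hd_cs: "hd (cs t) = cs t ! 0" using len k_pos by (intro hd_conv_nth) auto
    have h: "(t \<le> T \<longrightarrow> Q t = q t) \<and> (\<forall>n<k. int (fst (cs t ! n)) = hp t n + int T + 1)"
    proof (cases t)
      case 0
      have "pos 0 n = 0" if "n < k" for n
        using that by (cases n) (auto simp: pos_def ts_def initial_def k_def)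
      moreover have "Q 0 = 0" "\<forall>c\<in>set (cs 0). fst c = T + 1" using lg 0
        by (auto simp: legal_def Let_def)
      ultimately show ?thesis using 0 mem by (auto simp: hp_def q_def initial_def)
    next
      case (Suc i)
      show ?thesis
      proof (cases "t = T + 1")
        case True
        then have "\<forall>c\<in>set (cs t). fst c = T + 1" using lg by (auto simp: legal_def Let_def)
        then show ?thesis using True mem by (auto simp: hp_def)
      next
        case False
        then have t: "t \<le> T" using less.prems by simp
        have *: "Q t = fst (act_of M (q i) (ss i))"
          "\<And>n. n < k \<Longrightarrow> fst (cs t ! n) + 1 = fst (cs i ! n) + snd (snd (act_of M (q i) (ss i)) ! n)"
          using okt[of i] Suc False by auto
        have "int (fst (cs t ! n)) = hp t n + int T + 1" if "n < k" for n
          using *(2)[OF that] IH(2)[of i n] that evolve(2)[OF that, of i] Suc t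
            by (simp add: hp_def)
        then show ?thesis using * evolve(1)[of i] Suc by simp
      qed
    qed
    have "fst (snd (cs t ! n)) = con t n (hp t n)" if n: "n < k" for n
    proof (cases "snd (snd (cs t ! n))")
      case 0
      have "pos j n \<noteq> hp t n" if "j < t" for j
      proof -
        have "fst (cs j ! n) \<noteq> fst (cs t ! n)" using okt[OF that] n 0 by auto
        moreover have "int (fst (cs t ! n)) = hp t n + int T + 1" using h n by blast
        ultimately show ?thesis using IH(2)[OF that n] by auto
      qed
      then have c: "con t n (hp t n) = con 0 n (hp t n)" using unvisited[OF n, of 0 t] by simp
      show ?thesis
      proof (cases "n = 0")
        case False
        then have "cs t ! n \<in> set (tl (cs t))"
          using n len nth_mem[of "n - 1" "tl (cs t)"] by (simp add: nth_tl)
        then have "fst (snd (cs t ! n)) = 0" using lg 0 by (auto simp: legal_def Let_def)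
        then show ?thesis using c con_0[OF n] False by simp
      next
        case True
        define p where "p = hp t 0"
        have f: "int (fst (cs t ! 0)) = p + int T + 1" using h k_pos by (simp add: p_def)
        have lg': "if fst (cs t ! 0) < T + 1 \<or> T + 1 + length ew + B \<le> fst (cs t ! 0) then
          fst (snd (cs t ! 0)) = 0
        else if fst (cs t ! 0) < T + 1 + length ew then fst (snd (cs t ! 0)) =
          (if elem ew (fst (cs t ! 0) - (T + 1)) then 2 else 1)
        else True" using conjunct2[OF conjunct2[OF conjunct2[OF conjunct2[OF
            lg[unfolded legal_def Let_def fst_conv snd_conv]]]]] 0 unfolding hd_cs True by (rule mp)
        consider "p < 0 \<or> int (length ew + B) \<le> p" | "0 \<le> p" "p < int (length ew)"
          | j where "j < B" "p = int (length ew + j)"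
        proof -
          have "\<exists>j. j < B \<and> p = int (length ew + j)"
            if "int (length ew) \<le> p" "p < int (length ew + B)"
            using that by (intro exI[of _ "nat p - length ew"]) linarith
          then show ?thesis using that by (meson not_le)
        qed
        then have "fst (snd (cs t ! 0)) = con 0 0 p"
        proof cases
          case 1
          then have "fst (cs t ! 0) < T + 1 \<or> T + 1 + length ew + B \<le> fst (cs t ! 0)" using f
            by linarith
          then show ?thesis using lg' con_0_cases(1)[OF 1] by presburger
        next
          case 2
          then have *: "\<not> (fst (cs t ! 0) < T + 1 \<or> T + 1 + length ew + B \<le> fst (cs t ! 0))"
            "fst (cs t ! 0) < T + 1 + length ew" "fst (cs t ! 0) - (T + 1) = nat p" using f
              by linarith+
          have "fst (snd (cs t ! 0)) = (if elem ew (nat p) then 2 else 1)"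
            using lg' unfolding *(3) using *(1,2) by presburger
          moreover have "elem ew (nat p) = ew ! nat p" using 2 by (intro elem_nth) linarith
          ultimately show ?thesis using con_0_cases(2)[OF 2] by simp
        next
          case (3 j)
          \<comment> \<open>A cell of the witness, whose symbol is forced by compatibility with bit
            layer \<open>j\<close>.\<close>
          have "fst (cs t ! 0) = T + 1 + length ew + j" using f 3(2) by linarith
          then have "fst (snd (cs t ! 0)) = (if y ! j then 1 else 0) + 1"
            using zok[of j "B + t"] 3(1) less.prems 0 True
            unfolding zt[OF less.prems] zb[OF 3(1)] fits_def Let_def hd_cs[symmetric]
              by (simp add: hd_cs)
          then show ?thesis using con_0_cases(3)[OF 3(1)] 3(2) by simp
        qed
        then show ?thesis using c True by (simp add: p_def)
      qed
    next
      case (Suc i)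
      then have i: "i < t" using l_le[OF n] by simp
      have h': "int (fst (cs t ! n)) = hp t n + int T + 1" using h n by blast
      have o: "fst (cs i ! n) = fst (cs t ! n)" "fst (snd (cs t ! n)) = wr i n"
        using okt[OF i] n Suc by auto
      have "pos j n \<noteq> hp t n" if "i < j" "j < t" for j
      proof -
        have "fst (cs j ! n) \<noteq> fst (cs t ! n)" using okt[OF that(2)] n Suc that(1) by auto
        then show ?thesis using IH(2)[OF that(2) n] h' by auto
      qed
      moreover have "pos i n = hp t n" using IH(2)[OF i n] h' o(1) by simp
      ultimately show ?thesis using last_visit[OF n i] o(2) by simp
    qed
    then show ?case using h by blast
  qed
  have "fst (snd (hd (cs (T + 1)))) = 2" using op(2)[of "T + 1"] by (auto simp: legal_def Let_def)
  moreover have "hd (cs (T + 1)) = cs (T + 1) ! 0" using op(1)[of "T + 1"] k_pos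
    by (intro hd_conv_nth) auto
  ultimately show ?thesis using main[of "T + 1"] k_pos by (simp add: hp_def)
qed

text \<open>The run supplies the guesses; \<open>lv t n\<close> is one more than the latest earlier
  time at which head \<open>n\<close> stood on its present cell, and 0 if there is no such
  time.\<close>

lemma accepts_solution:
  assumes acc: "con (T + 1) 0 0 = 2"
  shows "\<exists>z. solution z"
proof -
  define vis where "vis t n = {i. i < t \<and> pos i n = hp t n}" for t n
  define lv where "lv t n = (if vis t n = {} then 0 else Suc (Max (vis t n)))" for t n
  define cs where "cs t = map (\<lambda>n. (nat (hp t n + int T + 1), con t n (hp t n), lv t n)) [0..<k]"
    for t
  define z where "z i = (if i < B then (i, if y ! i then 1 else 0, [])
    else (i, q (i - B), cs (i - B)))" for i
  have hb: "\<bar>hp t n\<bar> \<le> int T" if "n < k" for t n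
    using pos_bound[OF that, of t] by (auto simp: hp_def)
  have len: "length (cs t) = k" for t by (simp add: cs_def)
  have nth: "cs t ! n = (nat (hp t n + int T + 1), con t n (hp t n), lv t n)" if "n < k" for t n
    using that by (simp add: cs_def)
  have hd_cs: "hd (cs t) = cs t ! 0" for t using len[of t] k_pos by (intro hd_conv_nth) auto
  have fin: "finite (vis t n)" for t n by (simp add: vis_def)
  have lv_le: "lv t n \<le> t" for t n
    using Max_in[OF fin, of t n] by (auto simp: lv_def vis_def Suc_le_eq)
  have lv_0: "pos i n \<noteq> hp t n" if "lv t n = 0" "i < t" for t n i
    using that by (auto simp: lv_def vis_def split: if_splits)
  have lv_Suc: "i < t" "pos i n = hp t n" "\<And>j. i < j \<Longrightarrow> j < t \<Longrightarrow> pos j n \<noteq> hp t n"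
    if "lv t n = Suc i" for t n i
  proof -
    have ne: "vis t n \<noteq> {}" and i: "i = Max (vis t n)" using that
      by (auto simp: lv_def split: if_splits)
    have "i \<in> vis t n" using Max_in[OF fin ne] i by simp
    then show "i < t" "pos i n = hp t n" by (auto simp: vis_def)
    show "pos j n \<noteq> hp t n" if "i < j" "j < t" for j
    proof
      assume "pos j n = hp t n"
      then have "j \<le> i" using i Max_ge[OF fin, of j t n] that(2) by (simp add: vis_def)
      then show False using that(1) by simp
    qed
  qed
  have lv_less: "pos i n \<noteq> hp t n" if "lv t n < Suc i" "i < t" for t n i
  proof (cases "lv t n")
    case 0
    then show ?thesis using lv_0 that by simp
  next
    case (Suc j)
    then show ?thesis using lv_Suc(3)[OF Suc, of i] that by simp
  qed
  have hp0: "hp 0 n = 0" if "n < k" for n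
    using that by (cases n) (auto simp: hp_def pos_def ts_def initial_def k_def)
  have leg: "legal B T ew (B + t, q t, cs t)" if t: "t \<le> T + 1" for t
  proof -
    have 1: "t = 0 \<Longrightarrow> q t = 0 \<and> (\<forall>c\<in>set (cs t). fst c = T + 1)"
      using hp0 by (auto simp: q_def initial_def cs_def nat_add_distrib)
    have 2: "t = T + 1 \<Longrightarrow> (\<forall>c\<in>set (cs t). fst c = T + 1) \<and> fst (snd (hd (cs t))) = 2"
      using acc k_pos unfolding hd_cs by (auto simp: nth hp_def)
        (auto simp: cs_def hp_def nat_add_distrib)
    have 3: "\<forall>c\<in>set (cs t). snd (snd c) \<le> t" using lv_le by (auto simp: cs_def)
    have c0: "con t n (hp t n) = con 0 n (hp t n)" if "lv t n = 0" "n < k" for n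
      using unvisited[OF that(2), of 0 t] lv_0[OF that(1)] by simp
    have 4: "fst (snd c) = 0" if c: "c \<in> set (tl (cs t))" "snd (snd c) = 0" for c
    proof -
      obtain n where "n < length (tl (cs t))" "tl (cs t) ! n = c"
        using c(1) unfolding in_set_conv_nth by blast
      then have n: "n < k - 1" "c = cs t ! Suc n" using len[of t] by (auto simp: nth_tl)
      then show ?thesis using c(2) c0[of "Suc n"] con_0[of "Suc n"] by (simp add: nth)
    qed
    have 5: "if fst (hd (cs t)) < T + 1 \<or> T + 1 + length ew + B \<le> fst (hd (cs t)) then
      fst (snd (hd (cs t))) = 0
        else if fst (hd (cs t)) < T + 1 + length ew then fst (snd (hd (cs t))) =
          (if elem ew (fst (hd (cs t)) - (T + 1)) then 2 else 1)
        else True" if l0: "snd (snd (hd (cs t))) = 0"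
    proof -
      define p where "p = hp t 0"
      have s: "fst (snd (hd (cs t))) = con 0 0 p" using c0[of 0] l0 k_pos unfolding hd_cs
        by (simp add: nth p_def)
      have f: "int (fst (hd (cs t))) = p + int T + 1"
        using hb[OF k_pos, of t] k_pos unfolding hd_cs by (simp add: nth p_def)
      have a: "elem ew (fst (hd (cs t)) - (T + 1)) = ew ! nat p" if "0 \<le> p" "p < int (length ew)"
      proof -
        have "fst (hd (cs t)) - (T + 1) = nat p" using f that by linarith
        then show ?thesis using that elem_nth[of "nat p" ew] by simp
      qed
      show ?thesis
      proof (cases "p < 0 \<or> int (length ew + B) \<le> p")
        case True
        then have "fst (hd (cs t)) < T + 1 \<or> T + 1 + length ew + B \<le> fst (hd (cs t))" using f
          by linarith
        then show ?thesis using s con_0_cases(1)[OF True] by simp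
      next
        case False
        then have *: "\<not> (fst (hd (cs t)) < T + 1 \<or> T + 1 + length ew + B \<le> fst (hd (cs t)))"
          using f by linarith
        show ?thesis
        proof (cases "p < int (length ew)")
          case True
          then show ?thesis using * s con_0_cases(2)[of p] a False by simp
        next
          case False
          then have "\<not> fst (hd (cs t)) < T + 1 + length ew" using f by linarith
          then show ?thesis using * by simp
        qed
      qed
    qed
    show ?thesis unfolding legal_def Let_def using 1 2 3 4 5 by simp
  qed
  have mem: "z i \<in> set all_opts" if "i < B + T + 2" for i
  proof (cases "i < B")
    case True
    then have "z i \<in> set (concat (map (\<lambda>j. [(j, 0, []), (j, 1, [])]) [0..<B]))"
      by (auto simp: z_def)
    then show ?thesis unfolding opts_def by simp
  next
    case False
    then have t: "i - B \<le> T + 1" using that by simp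
    have "c \<in> set (cell_list (num_symbols M) T)" if c: "c \<in> set (cs (i - B))" for c
    proof -
      obtain n where n: "n < k" "c = cs (i - B) ! n" using c len by (auto simp: in_set_conv_nth)
      then show ?thesis using hb[OF n(1), of "i - B"] lv_le[of "i - B" n] t valid(3)[OF n(1)]
        unfolding set_cell_list n(2) nth[OF n(1)] by (auto simp: nat_less_iff)
    qed
    then show ?thesis using False that leg[OF t] valid(1)[of "i - B"] len
      by (auto simp: z_def set_opts)
  qed
  have ok: "ok (z i) (z i')" if "i < i'" "i' < B + T + 2" for i i'
  proof -
    consider "i' < B" | "i < B" "B \<le> i'" | "B \<le> i" using that by linarith
    then show ?thesis
    proof cases
      case 1
      then show ?thesis by (simp add: fits_def z_def)
    next
      case 2
      let ?t = "i' - B"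
      have "fst (snd (hd (cs ?t))) = (if y ! i then 1 else 0) + 1"
        if l: "snd (snd (hd (cs ?t))) = 0" and h: "fst (hd (cs ?t)) = T + 1 + length ew + i"
      proof -
        have "hp ?t 0 = int (length ew + i)" using h hb[OF k_pos, of ?t] k_pos unfolding hd_cs
          by (simp add: nth)
        moreover have "con ?t 0 (hp ?t 0) = con 0 0 (hp ?t 0)"
          using unvisited[OF k_pos, of 0 ?t] lv_0[of ?t 0] l k_pos unfolding hd_cs
            by (simp add: nth)
        ultimately show ?thesis using con_0_cases(3)[OF 2(1)] k_pos unfolding hd_cs
          by (simp add: nth)
      qed
      then show ?thesis using 2 by (auto simp: fits_def z_def Let_def)
    next
      case 3
      define t t' where "t = i - B" and "t' = i' - B"
      have i: "i = B + t" "i' = B + t'" "t < t'" "t' \<le> T + 1" using that 3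
        by (auto simp: t_def t'_def)
      have hpt: "hp t n = pos t n" for n using i by (simp add: hp_def)
      have "map (\<lambda>c. fst (snd c)) (cs t) = ss t" by (auto simp: cs_def ss_def hpt)
      then have lk: "table_lookup (act_table M) (q t, map (\<lambda>c. fst (snd c)) (cs t)) =
        act_of M (q t) (ss t)"
        using lookup by simp
      have a: "elem (cs j) n = cs j ! n"
        "elem (snd (act_of M (q t) (ss t))) n = snd (act_of M (q t) (ss t)) ! n" if "n < k" for n j
        using that len evolve(4)[of n t] by (auto intro!: elem_nth)
      have 1: "q t' = fst (act_of M (q t) (ss t)) \<and>
          (\<forall>n<k. fst (cs t' ! n) + 1 = fst (cs t ! n) + snd (snd (act_of M (q t) (ss t)) ! n))"
        if "t' = Suc t" "t' \<noteq> T + 1"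
      proof -
        have "hp t' n = pos t' n" for n using that i by (simp add: hp_def)
        then have "fst (cs t' ! n) + 1 = fst (cs t ! n) + snd (snd (act_of M (q t) (ss t)) ! n)"
          if "n < k" for n
          using evolve(2)[OF that, of t] hb[OF that, of t] hb[OF that, of t'] \<open>t' = Suc t\<close>
          unfolding nth[OF that] by (simp add: hpt)
        then show ?thesis using evolve(1)[of t] that by simp
      qed
      have 2: "(snd (snd (cs t' ! n)) = Suc t \<longrightarrow>
        fst (cs t ! n) = fst (cs t' ! n) \<and> fst (snd (cs t' ! n)) = wr t n) \<and>
            (snd (snd (cs t' ! n)) < Suc t \<longrightarrow> fst (cs t ! n) \<noteq> fst (cs t' ! n))" if n: "n < k" for n
      proof (intro conjI impI)
        assume "snd (snd (cs t' ! n)) = Suc t"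
        then have l: "lv t' n = Suc t" by (simp add: nth n)
        show "fst (cs t ! n) = fst (cs t' ! n)" using lv_Suc(2)[OF l] by (simp add: nth n hpt)
        show "fst (snd (cs t' ! n)) = wr t n"
          using last_visit[OF n lv_Suc(1,2)[OF l]] lv_Suc(3)[OF l] by (simp add: nth n)
      next
        assume "snd (snd (cs t' ! n)) < Suc t"
        then have "pos t n \<noteq> hp t' n" using lv_less[of t' n t] i by (simp add: nth n)
        then show "fst (cs t ! n) \<noteq> fst (cs t' ! n)"
          using hb[OF n, of t] hb[OF n, of t'] by (simp add: nth n hpt)
      qed
      show ?thesis using 1 2 unfolding fits_def
        by (auto simp: i z_def lk Let_def a wr_def)
    qed
  qed
  have "solution z" unfolding solution_def using mem ok by (auto simp: z_def)
  then show ?thesis by blast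
qed

end

section \<open>The reduction is computable in polynomial time\<close>

text \<open>Reinterpreting a value in another type with the same code costs nothing; this provides
  the constructors of \<open>node\<close>.\<close>

lemma polytime_subst: "polytime f \<Longrightarrow> (\<And>x. encode (f x) = encode (h x)) \<Longrightarrow> polytime h"
  by (erule polytime_word[OF _ computes_id]) simp

fun node_code :: "node \<Rightarrow> nat \<times> nat \<times> nat" where
  "node_code Src = (0, 0, 0)"
| "node_code (V j) = (1, j, 0)"
| "node_code (U i) = (2, i, 0)"
| "node_code (X a p) = (3, a, p)"
| "node_code (LY j) = (4, j, 0)"
| "node_code (LZ j) = (5, j, 0)"
| "node_code (K j) = (6, j, 0)"
| "node_code (HY j) = (7, j, 0)"
| "node_code (HZ j) = (8, j, 0)"
| "node_code (Lf j i) = (9, j, i)"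

instantiation node :: enc
begin
definition "encode v = encode (node_code v)"
instance
proof
  fix v w :: node
  assume "encode v = encode w"
  then have "node_code v = node_code w" unfolding encode_node_def by (rule encode_inj)
  then show "v = w" by (cases v; cases w) auto
qed
end

lemma polytime_node1 [pt]:
  assumes "polytime f"
  shows "polytime (\<lambda>x. V (f x))"
    "polytime (\<lambda>x. U (f x))"
    "polytime (\<lambda>x. LY (f x))"
    "polytime (\<lambda>x. LZ (f x))"
    "polytime (\<lambda>x. K (f x))"
    "polytime (\<lambda>x. HY (f x))"
    "polytime (\<lambda>x. HZ (f x))"
proof -
  have p: "polytime (\<lambda>x. (c :: nat, f x, 0 :: nat))" for c by (intro pt assms)
  show "polytime (\<lambda>x. V (f x))" by (rule polytime_subst[OF p[of 1]]) (simp add: encode_node_def)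
  show "polytime (\<lambda>x. U (f x))" by (rule polytime_subst[OF p[of 2]]) (simp add: encode_node_def)
  show "polytime (\<lambda>x. LY (f x))" by (rule polytime_subst[OF p[of 4]]) (simp add: encode_node_def)
  show "polytime (\<lambda>x. LZ (f x))" by (rule polytime_subst[OF p[of 5]]) (simp add: encode_node_def)
  show "polytime (\<lambda>x. K (f x))" by (rule polytime_subst[OF p[of 6]]) (simp add: encode_node_def)
  show "polytime (\<lambda>x. HY (f x))" by (rule polytime_subst[OF p[of 7]]) (simp add: encode_node_def)
  show "polytime (\<lambda>x. HZ (f x))" by (rule polytime_subst[OF p[of 8]]) (simp add: encode_node_def)
qed

lemma polytime_node2 [pt]:
  assumes "polytime f" "polytime g"
  shows "polytime (\<lambda>x. X (f x) (g x))" "polytime (\<lambda>x. Lf (f x) (g x))"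
proof -
  have p: "polytime (\<lambda>x. (c :: nat, f x, g x))" for c by (intro pt assms)
  show "polytime (\<lambda>x. X (f x) (g x))" by (rule polytime_subst[OF p[of 3]])
    (simp add: encode_node_def)
  show "polytime (\<lambda>x. Lf (f x) (g x))" by (rule polytime_subst[OF p[of 9]])
    (simp add: encode_node_def)
qed

lemma polytime_elem [pt]: "polytime f \<Longrightarrow> polytime g \<Longrightarrow> polytime (\<lambda>x. elem (f x) (g x))"
  unfolding elem_def by (intro pt)

text \<open>The length \<open>k\<close> is fixed, in the application it is the number of tapes, so
  the number of lists is a fixed power of the number of elements.\<close>

lemma polytime_n_lists [pt]:
  assumes "polytime f"
  shows "polytime (\<lambda>x. List.n_lists k (f x))"
proof (induction k)
  case (Suc k)
  have "polytime (\<lambda>p. f (fst p))" by (rule polytime_comp[OF assms]) (intro pt)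
  then show ?case unfolding n_lists.simps by (intro pt Suc)
qed (simp add: pt)

lemma polytime_table_lookup [pt]:
  assumes "polytime f"
  shows "polytime (\<lambda>x. table_lookup D (f x))"
proof -
  have "polytime (\<lambda>p. f (fst p))" by (rule polytime_comp[OF assms]) (intro pt)
  then show ?thesis unfolding table_lookup_def by (intro pt)
qed

lemma polytime_opts:
  "polytime (\<lambda>p :: nat \<times> nat \<times> bool list. opts k Q A (fst p) (fst (snd p)) (snd (snd p)))"
  unfolding opts_def legal_def cell_list_def Let_def by (intro pt)

lemma polytime_fits:
  "polytime (\<lambda>p :: (nat \<times> nat \<times> nat) \<times> opt \<times> opt.
     fits D k (fst (fst p)) (fst (snd (fst p))) (snd (snd (fst p))) (fst (snd p)) (snd (snd p)))"
  unfolding fits_def Let_def by (intro pt)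

text \<open>Numbers the nodes by their place in the node list, so that the node set becomes an
  initial segment of the naturals as inputs require.\<close>

definition position :: "'a list \<Rightarrow> 'a \<Rightarrow> nat" where
  "position xs v = hd (filter (\<lambda>i. elem xs i = v) [0..<length xs])"

lemma position_nth:
  assumes "distinct xs" "i < length xs"
  shows "position xs (xs ! i) = i"
proof -
  have "filter (\<lambda>j. elem xs j = xs ! i) [0..<length xs] = filter (\<lambda>j. j = i) [0..<length xs]"
    using assms by (intro filter_cong) (auto simp: elem_nth nth_eq_iff_index_eq)
  moreover have "filter (\<lambda>j. j = i) [0..<length xs] \<noteq> []" using assms(2)
    by (auto simp: filter_empty_conv)
  then have "hd (filter (\<lambda>j. j = i) [0..<length xs]) \<in> set (filter (\<lambda>j. j = i) [0..<length xs])"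
    by (rule hd_in_set)
  ultimately show ?thesis by (simp add: position_def)
qed

lemma position_inj: "distinct xs \<Longrightarrow> inj_on (position xs) (set xs)"
  by (rule inj_on_inverseI[of _ "\<lambda>i. xs ! i"]) (auto simp: in_set_conv_nth position_nth)

lemma position_image: "distinct xs \<Longrightarrow> position xs ` set xs = {..<length xs}"
  by (force simp: in_set_conv_nth position_nth image_iff)

lemma polytime_position [pt]:
  assumes "polytime f" "polytime g"
  shows "polytime (\<lambda>x. position (f x) (g x))"
proof -
  have "polytime (\<lambda>p. f (fst p))" "polytime (\<lambda>p. g (fst p))"
    by (rule polytime_comp[OF assms(1)] polytime_comp[OF assms(2)]; intro pt)+
  then show ?thesis unfolding position_def by (intro pt assms)
qed

text \<open>The routes written out without going through tags, in a form to which the closure rules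
  apply directly.\<close>

definition route_list :: "nat \<Rightarrow> nat \<Rightarrow> nat \<Rightarrow> nat \<Rightarrow> (nat \<Rightarrow> nat) \<Rightarrow> (nat \<Rightarrow> nat \<Rightarrow> bool) \<Rightarrow> (node \<times> node)
  list list" where
  "route_list N B C m lay conf =
     concat (map (\<lambda>j. [[(LZ j, X (2 * j + 1) 0), (X (2 * j + 1) 0, U j), (U j, LY j)],
       [(LY j, X (2 * j) 0), (X (2 * j) 0, U j), (U j, LZ j)]]) [0..<B]) @
     concat (map (\<lambda>j. [[(HZ j, V (Suc j)), (V (Suc j), V j), (V j, HY j)],
       [(HY j, K j), (K j, V j), (V j, HZ j)]]) [0..<m]) @
     [(U N, K 0) # map (\<lambda>j. (K j, K (Suc j))) [0..<m - 1] @
       [(K (m - 1), Src), (Src, V 0)], [(Src, U 0)]] @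
     concat (map (\<lambda>a. map (\<lambda>b. [(X b a, X b (Suc a)), (X b (Suc a), X a b), (X a b, X a (Suc b))])
       (filter (\<lambda>b. lay a < lay b \<and> conf a b) [0..<C])) [0..<C]) @
     map (\<lambda>a. [(U (lay a), X a 0)]) (filter (\<lambda>a. 2 * B \<le> a) [0..<C]) @
     map (\<lambda>a. [(X a C, U (Suc (lay a)))]) [0..<C] @
     concat (map (\<lambda>a. map (\<lambda>b. [(X a b, X a (Suc b))])
       (filter (\<lambda>b. \<not> (lay a < lay b \<and> conf a b) \<and>
         \<not> (lay b < lay a \<and> conf b a)) [0..<C])) [0..<C]) @
     concat (map (\<lambda>j. map (\<lambda>i. [(K j, Lf j i)]) [0..<m]) [0..<m]) @
     map (\<lambda>v. [(V 0, v)]) (net.core_nodes N B C) @ map (\<lambda>v. [(v, Src)]) (net.all_nodes N B C m)"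

lemma route_list_eq: "route_list N B C m lay conf =
  map (net.route N C m lay) (net.tags N B C m lay conf)"
  unfolding route_list_def net.tags_def
  by (simp add: map_concat comp_def net.route.simps net.clash_def[abs_def] del: upt_Suc)

lemma polytime_core_nodes [pt]:
  assumes "polytime N" "polytime B" "polytime C"
  shows "polytime (\<lambda>x. net.core_nodes (N x) (B x) (C x))"
proof -
  have c: "polytime (\<lambda>p. C (fst p))" by (rule polytime_comp[OF assms(3)]) (intro pt)
  show ?thesis unfolding net.core_nodes_def by (intro pt assms c)
qed

lemma polytime_all_nodes [pt]:
  assumes "polytime N" "polytime B" "polytime C" "polytime m"
  shows "polytime (\<lambda>x. net.all_nodes (N x) (B x) (C x) (m x))"
proof -
  have mm: "polytime (\<lambda>p. m (fst p))" by (rule polytime_comp[OF assms(4)]) (intro pt)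
  show ?thesis
    unfolding net.all_nodes_def net.inner_nodes_def net.leaves_def by (intro pt assms mm)
qed

text \<open>Everything in the instance that depends on the input word, as one encodable value. The
  transition table and the number of tapes depend on the machine only and remain constants.\<close>

type_synonym params = "(nat \<times> nat \<times> nat \<times> nat) \<times> (nat \<times> nat \<times> nat) \<times> opt list"

definition prm_lay :: "params \<Rightarrow> nat \<Rightarrow> nat" where
  "prm_lay c a = fst (elem (snd (snd c)) a)"

definition prm_conf :: "((nat \<times> nat list) \<times> nat \<times> (nat \<times> nat) list) list \<Rightarrow> nat \<Rightarrow> params \<Rightarrow> nat \<Rightarrow>
  nat \<Rightarrow> bool" where
  "prm_conf D k c a b \<longleftrightarrow> \<not> fits D k (fst (fst (snd c))) (fst (snd (fst (snd c))))
    (snd (snd (fst (snd c))))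
     (elem (snd (snd c)) a) (elem (snd (snd c)) b)"

lemma polytime_prm_lay [pt]: "polytime f \<Longrightarrow> polytime g \<Longrightarrow> polytime (\<lambda>x. prm_lay (f x) (g x))"
  unfolding prm_lay_def by (intro pt)

lemma polytime_prm_conf [pt]:
  assumes "polytime f" "polytime g" "polytime h"
  shows "polytime (\<lambda>x. prm_conf D k (f x) (g x) (h x))"
proof -
  have "polytime (\<lambda>x. (fst (snd (f x)), elem (snd (snd (f x))) (g x), elem (snd (snd (f x)))
    (h x)))"
    by (intro pt assms)
  from polytime_Not[OF polytime_comp[OF polytime_fits[of D k] this]] show ?thesis
    unfolding prm_conf_def by simp
qed

definition prm_routes :: "((nat \<times> nat list) \<times> nat \<times> (nat \<times> nat) list) list \<Rightarrow> nat \<Rightarrow> params \<Rightarrow>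
  (node \<times> node) list list" where
  "prm_routes D k c = route_list (fst (fst c)) (fst (snd (fst c))) (fst (snd (snd (fst c))))
    (snd (snd (snd (fst c))))
     (prm_lay c) (prm_conf D k c)"

lemma polytime_prm_routes: "polytime (prm_routes D k)"
  unfolding prm_routes_def route_list_def by (intro pt)

definition prm_nodes :: "params \<Rightarrow> node list" where
  "prm_nodes c = net.all_nodes (fst (fst c)) (fst (snd (fst c))) (fst (snd (snd (fst c))))
    (snd (snd (snd (fst c))))"

lemma polytime_prm_nodes: "polytime prm_nodes"
  unfolding prm_nodes_def by (intro pt)

definition prm_trips :: "((nat \<times> nat list) \<times> nat \<times> (nat \<times> nat) list) list \<Rightarrow> nat \<Rightarrow> params \<Rightarrow>
  (nat \<times> nat \<times> rat) list list" where
  "prm_trips D k c = map (map (\<lambda>(u, v). (position (prm_nodes c) u, position (prm_nodes c) v, 1)))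
    (prm_routes D k c)"

definition prm_input :: "((nat \<times> nat list) \<times> nat \<times> (nat \<times> nat) list) list \<Rightarrow> nat \<Rightarrow> params \<Rightarrow>
  mrtt_input" where
  "prm_input D k c = (length (prm_nodes c), concat (prm_trips D k c), prm_trips D k c)"


subsection \<open>Binary numbers\<close>

text \<open>Ripple of a carry through a number with the least significant bit first; with carry
  \<open>True\<close> this is the binary increment.\<close>

fun carry :: "bool \<Rightarrow> bool list \<Rightarrow> bool list" where
  "carry c [] = (if c then [True] else [])"
| "carry c (b # w) = (c \<noteq> b) # carry (c \<and> b) w"

lemma carry_False: "carry False w = w"
  by (induction w) auto

lemma binary_Suc: "binary (Suc n) = carry True (binary n)"
proof (induction n rule: less_induct)
  case (less n)
  show ?case
  proof (cases "n = 0")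
    case True
    then show ?thesis by (simp add: binary.simps)
  next
    case False
    then have b: "binary n = odd n # binary (n div 2)" by (subst binary.simps) simp
    have bs: "binary (Suc n) = even n # binary (Suc n div 2)" by (subst binary.simps) simp
    show ?thesis
    proof (cases "even n")
      case True
      then have "Suc n div 2 = n div 2" by simp
      then show ?thesis using True by (simp add: b bs carry_False)
    next
      case odd: False
      then have "Suc n div 2 = Suc (n div 2)" by simp
      then show ?thesis using odd False less.IH[of "n div 2"] by (simp add: b bs)
    qed
  qed
qed

lemma foldl_carry:
  "(let r = foldl (\<lambda>a b. (fst a \<and> b, (fst a \<noteq> b) # snd a)) (c, u) w in
    rev (snd r) @ (if fst r then [True] else []))
   = rev u @ carry c w"
  by (induction w arbitrary: c u) (auto simp: Let_def)

lemma length_carry: "length (carry c w) \<le> Suc (length w)"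
  by (induction c w rule: carry.induct) auto

lemma esize_bits: "esize (w :: bool list) = 4 * length w + 1"
  by (induction w) auto

lemma polytime_carry: "polytime (\<lambda>w. carry True w)"
proof -
  let ?r = "\<lambda>w. foldl (\<lambda>a b. (fst a \<and> b, (fst a \<noteq> b) # snd a)) (True, []) w"
  have "polytime ?r"
  proof (rule polytime_foldl)
    show "pb (\<lambda>n. 4 * n + 10)" by (intro pb_intros)
    fix x :: "bool list" and k assume "k \<le> length x"
    have "length (snd (foldl (\<lambda>a b. (fst a \<and> b, (fst a \<noteq> b) # snd a)) (c, u) w)) =
      length u + length w"
      for c u and w :: "bool list"
      by (induction w arbitrary: c u) auto
    then have "esize (?r (take k x)) = 3 + (4 * length (take k x) + 1)"
      by (simp add: encode_prod_def length_enc_pair esize_bits encode_bool_def)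
    then show "esize (?r (take k x)) \<le> 4 * esize x + 10" by (simp add: esize_bits)
  qed (intro pt)+
  then have "polytime (\<lambda>w. rev (snd (?r w)) @ (if fst (?r w) then [True] else []))" by (intro pt)
  then show ?thesis using foldl_carry[of True "[]"] by (simp add: Let_def)
qed

text \<open>The increment is applied \<open>f x\<close> times to the empty word, which is affordable
  because \<open>f x\<close> is measured in unary.\<close>

lemma polytime_binary [pt]:
  assumes "polytime f"
  shows "polytime (\<lambda>x. binary (f x))"
proof -
  obtain l where l: "\<And>x. esize (f x) \<le> poly l (esize x)"
    by (rule polytime_esize[OF assms], rule that)
  have pow: "(carry True ^^ n) [] = binary n" for n
    by (induction n) (simp_all add: binary_Suc, simp add: binary.simps)
  have len: "length (binary n) \<le> n" for n
    by (induction n) (use length_carry le_trans in \<open>fastforce simp: binary_Suc binary.simps[of 0]\<close>)+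
  have "polytime (\<lambda>x. (carry True ^^ f x) [])"
  proof (rule polytime_funpow_nat)
    show "pb (\<lambda>n. 4 * poly l n + 1)" by (intro pb_intros)
    show "polytime (\<lambda>p. carry True (snd p))" by (rule polytime_comp[OF polytime_carry]) (intro pt)
    fix x k assume "k \<le> f x"
    then show "esize ((carry True ^^ k) []) \<le> 4 * poly l (esize x) + 1"
      using l[of x] len[of k] unfolding pow by (simp add: esize_bits)
  qed (intro pt assms)+
  then show ?thesis by (simp add: pow)
qed

lemma polytime_enc_list [pt]:
  assumes "polytime (\<lambda>p. e (fst p) (snd p))" "polytime f"
  shows "polytime (\<lambda>x. enc_list (e x) (f x))"
  unfolding enc_list_def by (intro pt assms)

lemma polytime_enc_nat [pt]: "polytime f \<Longrightarrow> polytime (\<lambda>x. enc_nat (f x))"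
  unfolding enc_nat_def enc_word_def by (intro pt)

text \<open>All weights of the instance are 1, so the code of the weight is a constant and rational
  numbers stay out of the computation of the instance.\<close>

definition enc_arc :: "nat \<times> nat \<Rightarrow> bool list" where
  "enc_arc e = enc_nat (fst e) @ enc_nat (snd e) @ enc_rat 1"

lemma polytime_enc_arc [pt]: "polytime f \<Longrightarrow> polytime (\<lambda>x. enc_arc (f x))"
  unfolding enc_arc_def by (intro pt)

lemma polytime_prm_input: "polytime (\<lambda>c. enc_input (prm_input D k c))"
proof -
  let ?ts = "\<lambda>c. map (map (\<lambda>e. (position (prm_nodes c) (fst e), position (prm_nodes c) (snd e))))
    (prm_routes D k c)"
  have nodes: "polytime (\<lambda>x. prm_nodes (f x))" if "polytime f" for f :: "'b :: enc \<Rightarrow> params"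
    by (rule polytime_comp[OF polytime_prm_nodes that])
  have t: "polytime ?ts" by (intro pt polytime_prm_routes nodes)
  have "enc_list enc_edge (map (\<lambda>(u, v). (p u, p v, 1)) es) =
      enc_list enc_arc (map (\<lambda>e. (p (fst e), p (snd e))) es)" for p :: "node \<Rightarrow> nat" and es
    by (simp add: enc_list_def enc_arc_def case_prod_beta comp_def)
  moreover have "concat (map (map h) ess) = map h (concat ess)"
    for h :: "node \<times> node \<Rightarrow> nat \<times> nat \<times> rat" and ess
    by (simp add: map_concat)
  moreover have "concat (map (map h) ess) = map h (concat ess)" for h :: "node \<times> node \<Rightarrow> nat \<times> nat"
    and ess
    by (simp add: map_concat)
  ultimately have "enc_input (prm_input D k c) = enc_nat (length (prm_nodes c)) @
      enc_list enc_arc (concat (?ts c)) @ enc_list (\<lambda>es. enc_list enc_arc es) (?ts c)" for c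
    by (simp add: prm_input_def prm_trips_def enc_list_def[of "enc_list enc_edge"]
        enc_list_def[of "\<lambda>es. enc_list enc_arc es"] comp_def)
  moreover have "polytime (\<lambda>c. enc_nat (length (prm_nodes c)) @
      enc_list enc_arc (concat (?ts c)) @ enc_list (\<lambda>es. enc_list enc_arc es) (?ts c))"
    by (intro pt t nodes)
  ultimately show ?thesis by simp
qed

subsection \<open>Comparison of rational numbers\<close>

fun val :: "bool list \<Rightarrow> nat" where
  "val [] = 0"
| "val (b # w) = of_bool b + 2 * val w"

lemma val_binary [simp]: "val (binary n) = n"
proof (induction n rule: binary.induct)
  case (1 n)
  show ?case by (subst binary.simps) (use 1 in auto)
qed

text \<open>An exhausted word reads as zeros, so numbers of different lengths can be processed side
  by side.\<close>

definition bit :: "bool list \<Rightarrow> bool" where "bit w \<longleftrightarrow> w \<noteq> [] \<and> hd w"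

lemma val_append: "val (u @ v) = val u + 2 ^ length u * val v"
  by (induction u) (auto simp: algebra_simps)

lemma val_take_Suc: "val (take (Suc n) w) = val (take n w) + 2 ^ n * of_bool (bit (drop n w))"
proof (cases "n < length w")
  case True
  then show ?thesis by (simp add: take_Suc_conv_app_nth val_append bit_def hd_drop_conv_nth)
qed (simp add: bit_def)

lemma val_take_less: "val (take n w) < 2 ^ n"
proof (induction n)
  case (Suc n)
  then show ?case by (cases "bit (drop n w)") (auto simp: val_take_Suc)
qed simp

definition add_step :: "bool \<times> bool list \<times> bool list \<times> bool list \<Rightarrow> bool \<times> bool list \<times> bool list \<times>
  bool list" where
  "add_step a = (let c = fst a; b = bit (fst (snd a)); b' = bit (fst (snd (snd a))) in
     (c \<and> b \<or> c \<and> b' \<or> b \<and> b', tl (fst (snd a)), tl (fst (snd (snd a))),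
      (c \<noteq> (b \<noteq> b')) # snd (snd (snd a))))"

text \<open>The number of rounds is the maximum of the two lengths, expressed by truncated
  subtraction.\<close>

definition add_bits :: "bool list \<Rightarrow> bool list \<Rightarrow> bool list" where
  "add_bits u v = (let r = (add_step ^^ (length u + (length v - length u))) (False, u, v, []) in
     rev (snd (snd (snd r))) @ [fst r])"

lemma add_step_funpow:
  obtains c r where "(add_step ^^ n) (False, u, v, []) = (c, drop n u, drop n v, r)" "length r = n"
    "val (rev r) + 2 ^ n * of_bool c = val (take n u) + val (take n v)"
proof -
  have "\<exists>c r. (add_step ^^ n) (False, u, v, []) = (c, drop n u, drop n v, r) \<and> length r = n \<and>
    val (rev r) + 2 ^ n * of_bool c = val (take n u) + val (take n v)"
  proof (induction n)
    case 0
    show ?case by (intro exI[of _ False]) simp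
  next
    case (Suc n)
    then obtain c r where *: "(add_step ^^ n) (False, u, v, []) = (c, drop n u, drop n v, r)"
      "length r = n"
      "val (rev r) + 2 ^ n * of_bool c = val (take n u) + val (take n v)" by blast
    let ?b = "bit (drop n u)" and ?b' = "bit (drop n v)"
    have "(add_step ^^ Suc n) (False, u, v, []) =
       (c \<and> ?b \<or> c \<and> ?b' \<or> ?b \<and> ?b', drop (Suc n) u, drop (Suc n) v, (c \<noteq> (?b \<noteq> ?b')) # r)"
      using * by (simp add: add_step_def Let_def drop_Suc tl_drop)
    moreover have "val (rev ((c \<noteq> (?b \<noteq> ?b')) # r)) + 2 ^ Suc n * of_bool (c \<and> ?b \<or> c \<and> ?b' \<or> ?b \<and>
      ?b') =
        val (take (Suc n) u) + val (take (Suc n) v)"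
      using * by (cases c; cases ?b; cases ?b') (auto simp: val_append val_take_Suc)
    ultimately show ?case using *(2) by auto
  qed
  then show ?thesis using that by blast
qed

lemma val_add_bits: "val (add_bits u v) = val u + val v"
proof -
  let ?n = "length u + (length v - length u)"
  obtain c r where "(add_step ^^ ?n) (False, u, v, []) = (c, drop ?n u, drop ?n v, r)"
    "length r = ?n"
    "val (rev r) + 2 ^ ?n * of_bool c = val (take ?n u) + val (take ?n v)" by (rule add_step_funpow)
  then show ?thesis by (simp add: add_bits_def val_append)
qed

lemma length_add_bits: "length (add_bits u v) = Suc (length u + (length v - length u))"
proof -
  let ?n = "length u + (length v - length u)"
  obtain c r where "(add_step ^^ ?n) (False, u, v, []) = (c, drop ?n u, drop ?n v, r)"
    "length r = ?n"
    by (rule add_step_funpow)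
  then show ?thesis by (simp add: add_bits_def)
qed

lemma polytime_bit [pt]: "polytime f \<Longrightarrow> polytime (\<lambda>x. bit (f x))"
  unfolding bit_def by (intro pt)

lemma polytime_add_bits [pt]:
  assumes "polytime f" "polytime g"
  shows "polytime (\<lambda>x. add_bits (f x) (g x))"
proof -
  obtain l where l: "\<And>x. esize (f x) \<le> poly l (esize x)"
    by (rule polytime_esize[OF assms(1)], rule that)
  obtain m where m: "\<And>x. esize (g x) \<le> poly m (esize x)"
    by (rule polytime_esize[OF assms(2)], rule that)
  have s: "polytime add_step" unfolding add_step_def Let_def by (intro pt)
  have "polytime (\<lambda>x. (add_step ^^ (length (f x) + (length (g x) - length (f x))))
    (False, f x, g x, []))"
  proof (rule polytime_funpow_nat)
    show "pb (\<lambda>n. 10 + 3 * poly l n + 3 * poly m n)" by (intro pb_intros)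
    show "polytime (\<lambda>p. add_step (snd p))" by (rule polytime_comp[OF s]) (intro pt)
    fix x k assume k: "k \<le> length (f x) + (length (g x) - length (f x))"
    obtain c r where "(add_step ^^ k) (False, f x, g x, []) = (c, drop k (f x), drop k (g x), r)"
      "length r = k"
      by (rule add_step_funpow)
    then show "esize ((add_step ^^ k) (False, f x, g x, [])) \<le>
      10 + 3 * poly l (esize x) + 3 * poly m (esize x)"
      using k l[of x] m[of x] by (simp add: esize_bits)
  qed (intro pt assms)+
  then show ?thesis unfolding add_bits_def Let_def by (intro pt)
qed

text \<open>Horner's scheme from the most significant bit of \<open>v\<close>: prepending
  \<open>False\<close> doubles the intermediate result.\<close>

definition mult_bits :: "bool list \<Rightarrow> bool list \<Rightarrow> bool list" where
  "mult_bits u v = foldl (\<lambda>a b. add_bits (False # a) (if b then u else [])) [] (rev v)"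

lemma foldl_mult_bits:
  "val (foldl (\<lambda>a b. add_bits (False # a) (if b then u else [])) a w) =
    val a * 2 ^ length w + val u * val (rev w)"
proof (induction w arbitrary: a)
  case (Cons b w)
  then show ?case by (cases b) (auto simp: val_add_bits val_append algebra_simps)
qed simp

lemma val_mult_bits: "val (mult_bits u v) = val u * val v"
  by (simp add: mult_bits_def foldl_mult_bits)

lemma polytime_mult_bits [pt]:
  assumes "polytime f" "polytime g"
  shows "polytime (\<lambda>x. mult_bits (f x) (g x))"
proof -
  obtain l where l: "\<And>x. esize (f x) \<le> poly l (esize x)"
    by (rule polytime_esize[OF assms(1)], rule that)
  obtain m where m: "\<And>x. esize (g x) \<le> poly m (esize x)"
    by (rule polytime_esize[OF assms(2)], rule that)
  have f: "polytime (\<lambda>p. f (fst p))" by (rule polytime_comp[OF assms(1)]) (intro pt)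
  have len: "length (foldl (\<lambda>a b. add_bits (False # a) (if b then u else [])) [] w) \<le>
    length u + 2 * length w" for u w
    by (induction w rule: rev_induct) (auto simp: length_add_bits)
  show ?thesis unfolding mult_bits_def
  proof (rule polytime_foldl)
    show "pb (\<lambda>n. 1 + 2 * poly l n + 8 * poly m n)" by (intro pb_intros)
    fix x k assume k: "k \<le> length (rev (g x))"
    have "length (foldl (\<lambda>a b. add_bits (False # a) (if b then f x
      else [])) [] (take k (rev (g x)))) \<le> length (f x) + 2 * k"
      using len[of "f x" "take k (rev (g x))"] k by simp
    then show "esize (foldl (\<lambda>a b. add_bits (False # a) (if b then f x
      else [])) [] (take k (rev (g x)))) \<le>
        1 + 2 * poly l (esize x) + 8 * poly m (esize x)"
      using l[of x] m[of x] k by (simp add: esize_bits)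
  qed (intro pt assms f)+
qed

text \<open>The scan goes up from the least significant bits, so the last difference met decides and
  overrides earlier ones.\<close>

definition less_step :: "bool \<times> bool list \<times> bool list \<Rightarrow> bool \<times> bool list \<times> bool list" where
  "less_step a = (if bit (fst (snd a)) = bit (snd (snd a)) then fst a else bit (snd (snd a)),
     tl (fst (snd a)), tl (snd (snd a)))"

definition less_bits :: "bool list \<Rightarrow> bool list \<Rightarrow> bool" where
  "less_bits u v = fst ((less_step ^^ (length u + length v)) (False, u, v))"

lemma less_step_funpow:
  "(less_step ^^ n) (False, u, v) = (val (take n u) < val (take n v), drop n u, drop n v)"
proof (induction n)
  case (Suc n)
  then show ?case
    using val_take_less[of n u] val_take_less[of n v]
    by (cases "bit (drop n u)"; cases "bit (drop n v)")
      (auto simp: less_step_def val_take_Suc drop_Suc tl_drop)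
qed simp

lemma less_bits: "less_bits u v \<longleftrightarrow> val u < val v"
  by (simp add: less_bits_def less_step_funpow)

lemma polytime_less_bits [pt]:
  assumes "polytime f" "polytime g"
  shows "polytime (\<lambda>x. less_bits (f x) (g x))"
proof -
  obtain l where l: "\<And>x. esize (f x) \<le> poly l (esize x)"
    by (rule polytime_esize[OF assms(1)], rule that)
  obtain m where m: "\<And>x. esize (g x) \<le> poly m (esize x)"
    by (rule polytime_esize[OF assms(2)], rule that)
  have s: "polytime less_step" unfolding less_step_def by (intro pt)
  have "polytime (\<lambda>x. (less_step ^^ (length (f x) + length (g x))) (False, f x, g x))"
  proof (rule polytime_funpow_nat)
    show "pb (\<lambda>n. 5 + 2 * poly l n + poly m n)" by (intro pb_intros)
    show "polytime (\<lambda>p. less_step (snd p))" by (rule polytime_comp[OF s]) (intro pt)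
    fix x k
    show "esize ((less_step ^^ k) (False, f x, g x)) \<le> 5 + 2 * poly l (esize x) + poly m (esize x)"
      unfolding less_step_funpow using l[of x] m[of x] by (simp add: esize_bits)
  qed (intro pt assms)+
  then show ?thesis unfolding less_bits_def by (intro pt)
qed

text \<open>Cross-multiplication of sign and absolute value; between two negative numbers the
  comparison is reversed. Denominators of reduced fractions are positive.\<close>

definition less_rat :: "(bool \<times> bool list) \<times> bool list \<Rightarrow> (bool \<times> bool list) \<times> bool list \<Rightarrow> bool"
  where
  "less_rat p p' = (let X = mult_bits (snd (fst p)) (snd p'); Y =
    mult_bits (snd (fst p')) (snd p) in
     if fst (fst p) then (if fst (fst p') then less_bits Y X else True)
     else (if fst (fst p') then False else less_bits X Y))"

definition rat_bits :: "rat \<Rightarrow> (bool \<times> bool list) \<times> bool list" where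
  "rat_bits r = ((fst (quotient_of r) < 0, binary (nat \<bar>fst (quotient_of r)\<bar>)), binary
    (nat \<bar>snd (quotient_of r)\<bar>))"

lemma less_rat: "less_rat (rat_bits r) (rat_bits s) \<longleftrightarrow> r < s"
proof -
  obtain a b where r: "quotient_of r = (a, b)" by fastforce
  obtain c d where s: "quotient_of s = (c, d)" by fastforce
  have b: "0 < b" and d: "0 < d" using quotient_of_denom_pos r s by auto
  have rs: "r = of_int a / of_int b" "s = of_int c / of_int d" using quotient_of_div r s by auto
  have "r < s \<longleftrightarrow> of_int a * of_int d < (of_int c * of_int b :: rat)"
    unfolding rs using b d by (simp add: field_simps)
  also have "\<dots> \<longleftrightarrow> a * d < c * b" by (metis of_int_less_iff of_int_mult)
  also have "\<dots> \<longleftrightarrow> less_rat (rat_bits r) (rat_bits s)"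
  proof -
    have v: "nat \<bar>a\<bar> * nat \<bar>d\<bar> = nat (\<bar>a\<bar> * d)" "nat \<bar>c\<bar> * nat \<bar>b\<bar> = nat (\<bar>c\<bar> * b)"
      using b d by (simp_all add: nat_mult_distrib)
    have nn: "0 \<le> \<bar>a\<bar> * d" "0 \<le> \<bar>c\<bar> * b" using b d by simp_all
    have sg: "a < 0 \<Longrightarrow> a * d < 0" "\<not> a < 0 \<Longrightarrow> 0 \<le> a * d" "c < 0 \<Longrightarrow> c * b < 0" "\<not> c < 0 \<Longrightarrow> 0 \<le> c * b"
      using b d by (auto simp: mult_neg_pos)
    show ?thesis
      unfolding less_rat_def rat_bits_def r s Let_def less_bits val_mult_bits fst_conv snd_conv
        val_binary v
      using nn sg by (cases "a < 0"; cases "c < 0") (auto simp: nat_less_eq_zless)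
  qed
  finally show ?thesis by simp
qed

lemma polytime_less_rat [pt]: "polytime f \<Longrightarrow> polytime g \<Longrightarrow> polytime (\<lambda>x. less_rat (f x) (g x))"
  unfolding less_rat_def Let_def by (intro pt)


subsection \<open>Reading a witness off a temporalisation\<close>

text \<open>Behind its sign bit, an encoded integer followed by \<open>z\<close> is
  \<open>enc_pair\<close> of its binary form and \<open>z\<close>. The projections of pairs thus
  serve as parser.\<close>

definition rat_parse :: "raw \<Rightarrow> ((bool \<times> bool list) \<times> bool list) \<times> raw" where
  "rat_parse r = (let r' = rsecond (rtl r) in
     (((rhd r, unraw (rfirst (rtl r))), unraw (rfirst (rtl r'))), rsecond (rtl r')))"

lemma rat_parse: "rat_parse (Raw (enc_rat q @ z)) = (rat_bits q, Raw z)"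
proof -
  obtain a b where q: "quotient_of q = (a, b)" by fastforce
  have "enc_rat q @ z = (a < 0) # enc_pair (binary (nat \<bar>a\<bar>)) ((b < 0) #
    enc_pair (binary (nat \<bar>b\<bar>)) z)"
    by (simp add: enc_rat_def q enc_int_def enc_nat_def enc_pair_def)
  then show ?thesis by (simp add: rat_parse_def Let_def raw_defs rat_bits_def q)
qed

text \<open>Consumes the starting times of \<open>TY j\<close> and \<open>TZ j\<close>, each behind
  its list marker. The bit is \<open>True\<close> unless \<open>TY j\<close> starts first, that is,
  unless the lock can be open for option \<open>2 * j\<close>.\<close>

definition witness_step :: "raw \<times> bool list \<Rightarrow> raw \<times> bool list" where
  "witness_step a = (let p = rat_parse (rtl (fst a)); p' = rat_parse (rtl (snd p)) in
     (snd p', (\<not> less_rat (fst p) (fst p')) # snd a))"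

text \<open>Defined for every word and always \<open>n\<close> bits long, even if the word is no
  valid answer.\<close>

definition witness :: "nat \<Rightarrow> raw \<Rightarrow> bool list" where
  "witness n r = rev (snd ((witness_step ^^ n) (r, [])))"

lemma length_rat_parse: "length (unraw (snd (rat_parse r))) \<le> length (unraw r)"
proof -
  have "length (second w) \<le> length w" for w using length_unpair by blast
  from this[of "tl (second (tl (unraw r)))"] this[of "tl (unraw r)"] show ?thesis
    unfolding rat_parse_def Let_def raw_defs by simp
qed

lemma witness_step_length:
  "length (snd ((witness_step ^^ n) (r, []))) = n \<and>
    length (unraw (fst ((witness_step ^^ n) (r, [])))) \<le> length (unraw r)"
proof (induction n)
  case (Suc n)
  have t: "length (unraw (rtl r)) \<le> length (unraw r)" for r by (simp add: raw_defs)
  have 1: "length (unraw (fst (witness_step a))) \<le> length (unraw (fst a))" for a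
    unfolding witness_step_def Let_def fst_conv using length_rat_parse t by (meson le_trans)
  have 2: "length (snd (witness_step a)) = Suc (length (snd a))" for a
    by (simp add: witness_step_def Let_def)
  show ?case using Suc 1[of "(witness_step ^^ n) (r, [])"] 2[of "(witness_step ^^ n) (r, [])"]
    by simp
qed simp

lemma length_witness: "length (witness n r) = n"
  using witness_step_length by (simp add: witness_def)

lemma polytime_witness:
  assumes "polytime f" "polytime g"
  shows "polytime (\<lambda>x. witness (f x) (g x))"
proof -
  obtain l where l: "\<And>x. esize (f x) \<le> poly l (esize x)"
    by (rule polytime_esize[OF assms(1)], rule that)
  obtain m where m: "\<And>x. esize (g x) \<le> poly m (esize x)"
    by (rule polytime_esize[OF assms(2)], rule that)
  have s: "polytime witness_step" unfolding witness_step_def rat_parse_def Let_def by (intro pt)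
  have "polytime (\<lambda>x. (witness_step ^^ f x) (g x, []))"
  proof (rule polytime_funpow_nat)
    show "pb (\<lambda>n. 2 + 2 * poly m n + 4 * poly l n)" by (intro pb_intros)
    show "polytime (\<lambda>p. witness_step (snd p))" by (rule polytime_comp[OF s]) (intro pt)
    fix x k assume k: "k \<le> f x"
    obtain r w where rw: "(witness_step ^^ k) (g x, []) = (r, w)" by fastforce
    then have "length w = k" "length (unraw r) \<le> length (unraw (g x))"
      using witness_step_length[of k "g x"] by auto
    then show "esize ((witness_step ^^ k) (g x, [])) \<le>
      2 + 2 * poly m (esize x) + 4 * poly l (esize x)"
      unfolding rw using k l[of x] m[of x] by (simp add: esize_bits encode_raw_def)
  qed (intro pt assms)+
  then show ?thesis unfolding witness_def by (intro pt)
qed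

lemma witness_nth:
  assumes "2 * n \<le> length ts" "j < n"
  shows "witness n (Raw (enc_output ts)) ! j \<longleftrightarrow> \<not> ts ! (2 * j) < ts ! (2 * j + 1)"
proof -
  have "(witness_step ^^ k) (Raw (enc_output ts), []) =
      (Raw (enc_output (drop (2 * k) ts)), rev
        (map (\<lambda>j. \<not> ts ! (2 * j) < ts ! (2 * j + 1)) [0..<k]))"
    if "2 * k \<le> length ts" for k
    using that
  proof (induction k)
    case (Suc k)
    let ?r = "ts ! (2 * k)" and ?s = "ts ! (2 * k + 1)"
    have d: "drop (2 * k) ts = ?r # ?s # drop (2 * Suc k) ts"
      using Suc.prems Cons_nth_drop_Suc[of "2 * k" ts] Cons_nth_drop_Suc[of "2 * k + 1" ts] by simp
    have e: "enc_output (q # qs) = True # enc_rat q @ enc_output qs" for q qs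
      by (simp add: enc_output_def enc_list_def)
    have "witness_step (Raw (enc_output (drop (2 * k) ts)), w) =
        (Raw (enc_output (drop (2 * Suc k) ts)), (\<not> ?r < ?s) # w)" for w
      unfolding d e witness_step_def Let_def
      by (simp add: rtl_def rat_parse less_rat e)
    then show ?case using Suc by simp
  qed simp
  from this[OF assms(1)] show ?thesis using assms(2) by (simp add: witness_def)
qed

section \<open>The hardness result\<close>

lemma concat_pairs:
  "length (concat (map (\<lambda>j. [f j, h j]) [0..<n])) = 2 * n"
  "j < n \<Longrightarrow> concat (map (\<lambda>j. [f j, h j]) [0..<n]) ! (2 * j) = f j"
  "j < n \<Longrightarrow> concat (map (\<lambda>j. [f j, h j]) [0..<n]) ! (2 * j + 1) = h j"
proof -
  show l: "length (concat (map (\<lambda>j. [f j, h j]) [0..<n])) = 2 * n" for n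
    by (induction n) auto
  show "j < n \<Longrightarrow> concat (map (\<lambda>j. [f j, h j]) [0..<n]) ! (2 * j) = f j"
    by (induction n) (auto simp: nth_append l less_Suc_eq)
  show "j < n \<Longrightarrow> concat (map (\<lambda>j. [f j, h j]) [0..<n]) ! (2 * j + 1) = h j"
    by (induction n) (auto simp: nth_append l less_Suc_eq nth_Cons', presburger+)
qed

lemma polytime_enc_word [pt]: "polytime f \<Longrightarrow> polytime (\<lambda>x. enc_word (f x))"
  unfolding enc_word_def by (intro pt)

lemma polytime_opts' [pt]:
  assumes "polytime b" "polytime t" "polytime e"
  shows "polytime (\<lambda>x. opts k Q A (b x) (t x) (e x))"
proof -
  have "polytime (\<lambda>x. (b x, t x, e x))" by (intro pt assms)
  from polytime_comp[OF polytime_opts[of k Q A] this] show ?thesis by simp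
qed

section \<open>The instance of a word for a given verifier\<close>

locale verifier =
  fixes M :: tm and W :: "bool list set" and pw pm :: "nat poly"
  assumes M: "turing_machine M"
    and decides: "\<And>w. \<exists>t \<le> poly pm (length w). halts_with M w t [w \<in> W]"
begin

definition wlen :: "bool list \<Rightarrow> nat" where "wlen x = poly pw (length x)"
text \<open>A running time that suffices for \<open>x\<close> paired with any witness of length
  \<open>wlen x\<close>, so one instance covers all witnesses.\<close>

definition time :: "bool list \<Rightarrow> nat" where "time x = poly pm (length (enc_word x) + wlen x)"
definition os :: "bool list \<Rightarrow> opt list" where
  "os x = opts (num_tapes M) (num_states M) (num_symbols M) (wlen x) (time x) (enc_word x)"
definition layers :: "bool list \<Rightarrow> nat" where "layers x = wlen x + time x + 2"
definition hubs :: "bool list \<Rightarrow> nat" where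
  "hubs x = 100 * (layers x + length (os x) * (length (os x) + 1) + 2 * wlen x + 3)"
definition prm :: "bool list \<Rightarrow> params" where
  "prm x = ((layers x, wlen x, length (os x), hubs x), (wlen x, time x, length (enc_word x)), os x)"
definition inst :: "bool list \<Rightarrow> mrtt_input" where
  "inst x = prm_input (act_table M) (num_tapes M) (prm x)"

lemma polytime_inst: "polytime (\<lambda>r. Raw (enc_input (inst (unraw r))))"
proof -
  have "polytime (\<lambda>r. prm (unraw r))"
    unfolding prm_def hubs_def layers_def os_def time_def wlen_def by (intro pt)
  from polytime_comp[OF polytime_prm_input this] show ?thesis
    unfolding inst_def by (intro pt)
qed

text \<open>The verifier has halted by \<open>time x\<close> and its tapes do not change afterwards,
  so the probe of cell 0 sees the verdict.\<close>

lemma computation_accepts: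
  assumes "length y = wlen x"
  shows "computation.con M x y (time x + 1) 0 0 = 2 \<longleftrightarrow> enc_pair x y \<in> W"
proof -
  interpret computation M x y "wlen x" "time x" using M assms by unfold_locales
  let ?c = "\<lambda>n. (step M ^^ n) (initial M (enc_pair x y))"
  have "length (enc_pair x y) = length (enc_word x) + wlen x"
    using assms by (simp add: enc_pair_def)
  with decides[of "enc_pair x y"] obtain t
    where t: "t \<le> time x" "halts_with M (enc_pair x y) t [enc_pair x y \<in> W]"
    unfolding time_def by metis
  have h: "fst (?c t) = num_states M"
    "\<forall>i\<in>{0..1}. snd (hd (snd (?c t))) i = word_tape [enc_pair x y \<in> W] i"
    using t(2) unfolding halts_with_def case_prod_beta length_Cons list.size(3)
      One_nat_def[symmetric] add_0 of_nat_1 by (rule conjunct1, rule conjunct2)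
  have h2: "snd (hd (snd (?c t))) 0 = (if enc_pair x y \<in> W then 2 else 1)"
    using h(2)[rule_format, of 0] by (simp add: word_tape_def)
  have "?c (time x + 1) = ?c t" by (rule steps_halted[OF h(1)]) (use t(1) in linarith)
  moreover have "hd (ts (time x + 1)) = ts (time x + 1) ! 0"
    using valid(2)[of "time x + 1"] k_pos by (intro hd_conv_nth) auto
  ultimately have "con (time x + 1) 0 0 = (if enc_pair x y \<in> W then 2 else 1)"
    using h2 unfolding con_def ts_def by metis
  then show ?thesis by simp
qed

lemma os_bits:
  "2 * wlen x \<le> length (os x)"
  "j < wlen x \<Longrightarrow> os x ! (2 * j) = (j, 0, [])" "j < wlen x \<Longrightarrow> os x ! (2 * j + 1) = (j, 1, [])"
  "a < length (os x) \<Longrightarrow> 2 * wlen x \<le> a \<Longrightarrow> wlen x \<le> fst (os x ! a) \<and> fst (os x ! a) < layers x"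
proof -
  let ?b = "concat (map (\<lambda>j. [(j, 0, []), (j, 1, [])]) [0..<wlen x]) :: opt list"
  define r where "r = filter (legal (wlen x) (time x) (enc_word x))
    (concat (map (\<lambda>t. concat (map (\<lambda>q.
    map (\<lambda>cs. (wlen x + t, q, cs)) (List.n_lists (num_tapes M)
      (cell_list (num_symbols M) (time x))))
      [0..<Suc (num_states M)])) [0..<time x + 2]))"
  have r: "os x = ?b @ r" "\<forall>a\<in>set r. wlen x \<le> fst a \<and> fst a < layers x"
    unfolding os_def opts_def r_def layers_def by (simp, fastforce simp del: upt_Suc)
  note l = concat_pairs[where f = "\<lambda>j. (j, 0, []) :: opt" and h = "\<lambda>j. (j, 1, []) :: opt"
    and n = "wlen x"]
  show "2 * wlen x \<le> length (os x)" unfolding r(1) length_append l(1) by simp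
  show "j < wlen x \<Longrightarrow> os x ! (2 * j) = (j, 0, [])" "j < wlen x \<Longrightarrow> os x ! (2 * j + 1) = (j, 1, [])"
    unfolding r(1) nth_append l(1) using l(2,3)[of j] by auto
  show "a < length (os x) \<Longrightarrow> 2 * wlen x \<le> a \<Longrightarrow> wlen x \<le> fst (os x ! a) \<and> fst (os x ! a) < layers x"
    using r(2) nth_mem[of "a - 2 * wlen x" r] unfolding r(1) nth_append length_append l(1) by auto
qed

lemma lay_eq: "a < length (os x) \<Longrightarrow> prm_lay (prm x) a = fst (os x ! a)"
  by (simp add: prm_lay_def prm_def elem_nth)

lemma conf_eq: "a < length (os x) \<Longrightarrow> b < length (os x) \<Longrightarrow>
  prm_conf (act_table M) (num_tapes M) (prm x) a b \<longleftrightarrow>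
    \<not> fits (act_table M) (num_tapes M) (wlen x) (time x) (length (enc_word x)) (os x ! a)
      (os x ! b)"
  by (simp add: prm_conf_def prm_def elem_nth)

lemma core: "core (layers x) (wlen x) (length (os x)) (hubs x) (prm_lay (prm x))"
proof
  show "0 < hubs x" by (simp add: hubs_def)
  show "wlen x \<le> layers x" by (simp add: layers_def)
  show "2 * wlen x \<le> length (os x)" by (rule os_bits)
  show b: "prm_lay (prm x) (2 * j) = j \<and> prm_lay (prm x) (2 * j + 1) = j" if "j < wlen x" for j
    using os_bits(1)[of x] os_bits(2,3)[OF that] lay_eq that by simp
  show "wlen x \<le> prm_lay (prm x) a" if "a < length (os x)" "2 * wlen x \<le> a" for a
    using os_bits(4)[OF that] lay_eq[OF that(1)] by simp
  show "prm_lay (prm x) a < layers x" if "a < length (os x)" for a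
  proof (cases "2 * wlen x \<le> a")
    case True
    then show ?thesis using os_bits(4)[OF that] lay_eq[OF that] by simp
  next
    case False
    then have "a div 2 < wlen x" by auto
    from b[OF this] have "prm_lay (prm x) a = a div 2"
      by (metis even_two_times_div_two odd_two_times_div_two_succ)
    then show ?thesis using \<open>a div 2 < wlen x\<close> by (simp add: layers_def)
  qed
qed

context
  fixes x :: "bool list"
begin

interpretation core "layers x" "wlen x" "length (os x)" "hubs x" "prm_lay (prm x)"
  "prm_conf (act_table M) (num_tapes M) (prm x)"
  by (rule core)

lemma prm_nodes: "prm_nodes (prm x) = all_nodes"
  by (simp add: prm_nodes_def prm_def)

lemma network_inst: "network_of (inst x) = network (position all_nodes)"
proof -
  have r: "prm_routes (act_table M) (num_tapes M) (prm x) = map route tags"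
    unfolding prm_routes_def route_list_eq by (simp add: prm_def)
  have e: "real_edge (case e of (u, v) \<Rightarrow> (p u, p v, 1)) = (case e of (u, v) \<Rightarrow> (p u, p v, 1))"
    for e and p :: "node \<Rightarrow> nat" by (cases e) simp
  show ?thesis
    using position_image[OF distinct_all_nodes]
    by (simp add: inst_def prm_input_def prm_trips_def network_def r prm_nodes map_concat comp_def
      e)
qed

lemma inst_valid: "trip_network (network_of (inst x))"
  "strongly_temporalisable (network_of (inst x))"
  unfolding network_inst
  using trip_network_network strongly_temporalisable_network position_inj[OF distinct_all_nodes]
    by auto

text \<open>The options selected by \<open>s\<close> form a solution whose bits spell
  \<open>y\<close>, and solutions are accepting runs.\<close>

lemma choice_solution:
  assumes s: "choice s (layers x)" and y: "length y = wlen x"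
    "\<And>j. j < wlen x \<Longrightarrow> y ! j \<longleftrightarrow> s j = 2 * j + 1"
  shows "enc_pair x y \<in> W"
proof -
  interpret c: computation M x y "wlen x" "time x" using M y(1) by unfold_locales
  have sl: "s l < length (os x)" "fst (os x ! s l) = l" if "l < layers x" for l
    using s that lay_eq by (auto simp: choice_def)
  have "c.solution (\<lambda>l. os x ! s l)"
    unfolding c.solution_def c.ew_def c.k_def os_def[symmetric]
  proof (intro conjI allI impI)
    fix i assume i: "i < wlen x + time x + 2"
    then show "os x ! s i \<in> set (os x)" "fst (os x ! s i) = i" using sl by (auto simp: layers_def)
  next
    fix i i' assume i: "i < i'" "i' < wlen x + time x + 2"
    then have "\<not> prm_conf (act_table M) (num_tapes M) (prm x) (s i) (s i')"
      using s by (auto simp: choice_def layers_def)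
    then show "fits (act_table M) (num_tapes M) (wlen x) (time x) (length (enc_word x))
      (os x ! s i) (os x ! s i')"
      using conf_eq sl i by (auto simp: layers_def)
  next
    fix j assume j: "j < wlen x"
    then have "s j = 2 * j \<or> s j = 2 * j + 1" using choice_bit[OF s] by blast
    then show "os x ! s j = (j, if y ! j then 1 else 0, [])" using y(2)[OF j] os_bits(2,3)[OF j]
      by auto
  qed
  from c.solution_accepts[OF this] computation_accepts[OF y(1)] show ?thesis by simp
qed

lemma solution_choice:
  assumes y: "length y = wlen x" and acc: "enc_pair x y \<in> W"
  shows "\<exists>s. choice s (layers x)"
proof -
  interpret c: computation M x y "wlen x" "time x" using M y by unfold_locales
  have "c.con (time x + 1) 0 0 = 2" using computation_accepts[OF y] acc by simp
  from c.accepts_solution[OF this] obtain z where "c.solution z" by blast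
  then have z: "\<And>i. i < layers x \<Longrightarrow> z i \<in> set (os x) \<and> fst (z i) = i"
    "\<And>i i'. i < i' \<Longrightarrow> i' < layers x \<Longrightarrow>
       fits (act_table M) (num_tapes M) (wlen x) (time x) (length (enc_word x)) (z i) (z i')"
    unfolding c.solution_def c.ew_def c.k_def os_def[symmetric] layers_def by blast+
  have "\<exists>s. \<forall>i<layers x. s i < length (os x) \<and> os x ! s i = z i"
  proof (intro exI[of _ "\<lambda>i. SOME a. a < length (os x) \<and> os x ! a = z i"] allI impI)
    fix i assume "i < layers x"
    then have "\<exists>a. a < length (os x) \<and> os x ! a = z i" using z(1) by (metis in_set_conv_nth)
    from someI_ex[OF this] show "(SOME a. a < length (os x) \<and> os x ! a = z i) < length (os x) \<and>
      os x ! (SOME a. a < length (os x) \<and> os x ! a = z i) = z i" .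
  qed
  then obtain s where s: "\<And>i. i < layers x \<Longrightarrow> s i < length (os x) \<and> os x ! s i = z i" by blast
  have "choice s (layers x)"
    unfolding choice_def using s z lay_eq conf_eq by simp
  then show ?thesis by blast
qed

lemma approximation_yields_witness:
  fixes \<rho> :: real and qs :: "rat list"
  assumes "length y = wlen x" "enc_pair x y \<in> W"
    and len: "length qs = length (trips (network_of (inst x)))"
    and \<rho>: "1 \<le> \<rho>" "sqrt (real (card (nodes (network_of (inst x))))) / 12 > 1 \<Longrightarrow>
      \<rho> < sqrt (real (card (nodes (network_of (inst x))))) / 12"
    and r: "1 / \<rho> * real (max_reachability (network_of (inst x))) \<le>
      real (reachability (network_of (inst x)) (\<lambda>i. real_of_rat (qs ! i)))"
  shows "enc_pair x (witness (wlen x) (Raw (enc_output qs))) \<in> W"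
proof -
  let ?f = "position all_nodes"
  have f: "inj_on ?f (set all_nodes)" by (rule position_inj[OF distinct_all_nodes])
  obtain s where s: "choice s (layers x)" using solution_choice[OF assms(1,2)] by blast
  define g where "g T = real_of_rat (qs ! position tags T)" for T
  have g: "real_of_rat (qs ! i) = g (tags ! i)" if "i < length tags" for i
    using position_nth[OF distinct_tags that] by (simp add: g_def)
  have n: "card (nodes (network ?f)) = length all_nodes"
    using card_image[OF f] distinct_card[OF distinct_all_nodes] by (simp add: network_def)
  \<comment> \<open>More than 144 = 12^2 nodes, so the square root exceeds 12 and the upper bound on
    \<rho> becomes available.\<close>
  have "145 \<le> length all_nodes"
    unfolding all_nodes_def length_append length_inner_nodes by (simp add: hubs_def)
  then have "sqrt (real (length all_nodes)) > 12"
    by (intro real_less_rsqrt) simp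
  then have "\<rho> < sqrt (real (card (nodes (network ?f)))) / 12"
    using \<rho>(2) unfolding network_inst n by simp
  then obtain s' where s': "choice s' (layers x)" "\<forall>l<layers x. bit_ok g (s' l)"
    using approximation_yields_choice[OF f _ hubs_def s \<rho>(1), of "\<lambda>i. real_of_rat (qs ! i)" g] g r
    unfolding network_inst by blast
  have lt: "2 * wlen x \<le> length tags" and
    tg: "tags ! (2 * j) = TY j" "tags ! (2 * j + 1) = TZ j" if "j < wlen x" for j
    using concat_pairs[where f = TY and h = TZ and n = "wlen x"] that unfolding tags_def
      by (auto simp: nth_append)
  have lq: "length qs = length tags" using len unfolding network_inst by (simp add: network_def)
  show ?thesis
  proof (rule choice_solution[OF s'(1) length_witness])
    fix j assume j: "j < wlen x"
    have w: "witness (wlen x) (Raw (enc_output qs)) ! j \<longleftrightarrow> \<not> qs ! (2 * j) < qs ! (2 * j + 1)"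
      by (rule witness_nth) (use lt[OF j] lq j in auto)
    have g: "g (TY j) = real_of_rat (qs ! (2 * j))" "g (TZ j) = real_of_rat (qs ! (2 * j + 1))"
      using g[of "2 * j"] g[of "2 * j + 1"] tg[OF j] lt[OF j] j concat_pairs(1)[where f = TY
        and h = TZ and n = "wlen x"]
      unfolding tags_def by (auto simp: nth_append)
    have "bit_ok g (s' j)" using s'(2) j by (simp add: layers_def)
    \<comment> \<open>The distance of 3 in \<open>bit_ok\<close> makes the two starting times
      distinct, so a single comparison recovers which of the two options was chosen.\<close>
    then have "s' j = 2 * j \<Longrightarrow> real_of_rat (qs ! (2 * j)) + 3 \<le> real_of_rat (qs ! (2 * j + 1))"
      "s' j = 2 * j + 1 \<Longrightarrow> real_of_rat (qs ! (2 * j + 1)) + 3 \<le> real_of_rat (qs ! (2 * j))"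
      using j by (auto simp: bit_ok_def g)
    then have "s' j = 2 * j \<Longrightarrow> qs ! (2 * j) < qs ! (2 * j + 1)"
      "s' j = 2 * j + 1 \<Longrightarrow> qs ! (2 * j + 1) < qs ! (2 * j)"
      by (smt (verit) of_rat_less)+
    then show "witness (wlen x) (Raw (enc_output qs)) ! j \<longleftrightarrow> s' j = 2 * j + 1"
      unfolding w using choice_bit[OF s'(1) j] by (auto dest: less_asym)
  qed
qed

end

end

section \<open>Functions on raw words and witnesses of exact length\<close>

lemma computes_polytime_raw: "polytime f \<Longrightarrow> computes UNIV (\<lambda>w. unraw (f (Raw w)))"
proof -
  assume f: "polytime f"
  obtain F where F: "computes (range (encode :: raw \<Rightarrow> _)) F" "\<And>x. F (encode x) = encode (f x)"
    by (rule polytimeE[OF f], rule that)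
  have "range (encode :: raw \<Rightarrow> _) = UNIV"
    by (auto simp: encode_raw_def intro: image_eqI[of _ _ "Raw w" for w])
  moreover have "F = (\<lambda>w. unraw (f (Raw w)))" using F(2) by (metis encode_raw_def raw.sel)
  ultimately show ?thesis using F(1) by simp
qed

lemma polytime_raw_pair:
  assumes "polytime f" "polytime g"
  shows "polytime (\<lambda>x. Raw (enc_pair (unraw (f x)) (unraw (g x))))"
  by (rule polytime_subst[OF polytime_Pair[OF assms]]) (simp add: encode_prod_def encode_raw_def)

definition unpad_step :: "raw \<Rightarrow> raw" where "unpad_step r = (if rnull r \<or> rhd r then r else rtl r)"
text \<open>Removes padding of the form of some letters \<open>False\<close> and one
  \<open>True\<close>.\<close>

definition unpad :: "raw \<Rightarrow> raw" where "unpad r = rtl ((unpad_step ^^ length (unraw r)) r)"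

lemma length_unpad_steps: "length (unraw ((unpad_step ^^ k) r)) \<le> length (unraw r)"
proof (induction k)
  case (Suc k)
  have "length (unraw (unpad_step r')) \<le> length (unraw r')" for r'
    by (simp add: raw_defs unpad_step_def)
  from this[of "(unpad_step ^^ k) r"] Suc show ?case by simp
qed simp

lemma polytime_unpad: "polytime unpad"
proof -
  have "polytime unpad_step" unfolding unpad_step_def by (intro pt)
  then have s: "polytime (\<lambda>p :: raw \<times> raw. unpad_step (snd p))" by (rule polytime_comp) (intro pt)
  have "polytime (\<lambda>r. (unpad_step ^^ esize r) r)"
    by (rule polytime_funpow[where s = "\<lambda>_. unpad_step", OF s _ _ pb_id], (intro pt)+)
      (simp add: encode_raw_def length_unpad_steps)
  then have "polytime (\<lambda>r. rtl ((unpad_step ^^ length (unraw r)) r))"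
    by (intro pt) (simp add: encode_raw_def)
  then show ?thesis unfolding unpad_def .
qed

lemma unpad_padded: "unpad (Raw (replicate n False @ True # y)) = Raw y"
proof -
  have stop: "(unpad_step ^^ k) (Raw (True # y)) = Raw (True # y)" for k
    by (induction k) (auto simp: raw_defs unpad_step_def)
  have go: "unpad_step (Raw (False # w)) = Raw w" for w by (simp add: raw_defs unpad_step_def)
  have "n \<le> k \<Longrightarrow> (unpad_step ^^ k) (Raw (replicate n False @ True # y)) = Raw (True # y)" for k
  proof (induction k arbitrary: n)
    case (Suc k)
    then show ?case
      by (cases n) (simp_all only: replicate.simps append.simps stop, simp_all only:
        funpow_Suc_right comp_apply go Suc_le_mono)
  qed simp
  from this[of "length (replicate n False @ True # y)"] show ?thesis
    by (simp add: unpad_def rtl_def)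
qed

lemma NP_exact_witness:
  assumes "L \<in> class_NP"
  obtains W p where "W \<in> class_P"
    "\<And>x. x \<in> L \<longleftrightarrow> (\<exists>y. length y = poly p (length x) \<and> enc_pair x y \<in> W)"
proof -
  obtain Ve p where V: "Ve \<in> class_P"
    "\<And>x. x \<in> L \<longleftrightarrow> (\<exists>y. length y \<le> poly p (length x) \<and> enc_pair x y \<in> Ve)"
    using assms unfolding class_NP_def by auto
  let ?f = "\<lambda>r. Raw (enc_pair (unraw (rfirst r)) (unraw (unpad (rsecond r))))"
  let ?F = "\<lambda>w. unraw (?f (Raw w))"
  have "polytime (\<lambda>r. unpad (rsecond r))" by (rule polytime_comp[OF polytime_unpad]) (intro pt)
  then have "polytime ?f" by (intro polytime_raw_pair pt)
  from class_P_vimage[OF V(1) computes_polytime_raw[OF this]] have W: "?F -` Ve \<in> class_P" .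
  have F: "?F (enc_pair x y) = enc_pair x (unraw (unpad (Raw y)))" for x y by (simp add: raw_defs)
  have le: "length (unraw (unpad (Raw y))) \<le> length y - 1" for y
    using length_unpad_steps[of "length y" "Raw y"] by (simp add: unpad_def rtl_def diff_le_mono)
  have "x \<in> L \<longleftrightarrow> (\<exists>y. length y = poly (p + 1) (length x) \<and> enc_pair x y \<in> ?F -` Ve)" for x
  proof
    assume "x \<in> L"
    then obtain y where y: "length y \<le> poly p (length x)" "enc_pair x y \<in> Ve" using V(2) by blast
    let ?y = "replicate (poly p (length x) - length y) False @ True # y"
    have "enc_pair x ?y \<in> ?F -` Ve" using y(2) unfolding vimage_def mem_Collect_eq F unpad_padded
      by simp
    moreover have "length ?y = poly (p + 1) (length x)" using y(1) by simp
    ultimately show "\<exists>y. length y = poly (p + 1) (length x) \<and> enc_pair x y \<in> ?F -` Ve" by blast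
  next
    assume "\<exists>y. length y = poly (p + 1) (length x) \<and> enc_pair x y \<in> ?F -` Ve"
    then obtain y where y: "length y = poly p (length x) + 1"
      "enc_pair x (unraw (unpad (Raw y))) \<in> Ve"
      using F by auto
    moreover have "length (unraw (unpad (Raw y))) \<le> poly p (length x)" using le[of y] y(1) by simp
    ultimately show "x \<in> L" using V(2) by blast
  qed
  then show ?thesis by (rule that[OF W])
qed

theorem theorem6:
  fixes \<rho> :: "nat \<Rightarrow> real"
  assumes "class_P \<noteq> class_NP"
    and "\<And>n. \<rho> n \<ge> 1"
    and "\<And>n. sqrt (real n) / 12 > 1 \<Longrightarrow> \<rho> n < sqrt (real n) / 12"
  shows "\<not> mrtt_approximable strongly_temporalisable \<rho>"
proof
  assume "mrtt_approximable strongly_temporalisable \<rho>"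
  then obtain A pa where A: "turing_machine A"
    "\<And>I. trip_network (network_of I) \<Longrightarrow> strongly_temporalisable (network_of I) \<Longrightarrow>
      \<exists>t y. t \<le> poly pa (length (enc_input I)) \<and> halts_with A (enc_input I) t y \<and>
        (\<exists>ts. y = enc_output ts \<and> length ts = length (trips (network_of I)) \<and>
          1 / \<rho> (card (nodes (network_of I))) * real (max_reachability (network_of I)) \<le>
          real (reachability (network_of I) (\<lambda>i. real_of_rat (ts ! i))))"
    unfolding mrtt_approximable_def poly_time_solvable_def Let_def by blast
  have "class_NP \<subseteq> class_P"
  proof
    fix L assume L: "L \<in> class_NP"
    obtain W pw where W: "W \<in> class_P"
      "\<And>x. x \<in> L \<longleftrightarrow> (\<exists>y. length y = poly pw (length x) \<and> enc_pair x y \<in> W)"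
      by (rule NP_exact_witness[OF L], rule that)
    obtain M pm where Mp: "turing_machine M" "\<And>w. \<exists>t \<le> poly pm (length w). halts_with M w t [w \<in> W]"
      using W(1) unfolding class_P_def poly_time_solvable_def by auto
    interpret verifier M W pw pm using Mp by unfold_locales
    define good where "good I y t \<longleftrightarrow> t \<le> poly pa (length (enc_input I)) \<and>
      halts_with A (enc_input I) t y \<and>
        (\<exists>ts. y = enc_output ts \<and> length ts = length (trips (network_of I)) \<and>
          1 / \<rho> (card (nodes (network_of I))) * real (max_reachability (network_of I)) \<le>
          real (reachability (network_of I) (\<lambda>i. real_of_rat (ts ! i))))" for I y t
    have ex: "\<exists>y t. good (inst x) y t" for x
      using A(2)[OF inst_valid] unfolding good_def by blast
    \<comment> \<open>The specification of the algorithm is a relation; selecting one admissible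
      answer per input turns it into a function.\<close>
    define Y where "Y I = (SOME y. \<exists>t. good I y t)" for I
    have Y: "\<exists>t. good (inst x) (Y (inst x)) t" for x
      using someI_ex[OF ex] unfolding Y_def .
    let ?G = "\<lambda>x. enc_input (inst x)"
    \<comment> \<open>Injectivity of the encoding makes the answer a function of the word that the
      machine reads.\<close>
    let ?F = "\<lambda>w. Y (inv enc_input w)"
    have F: "?F (?G x) = Y (inst x)" for x by (simp add: inv_f_f[OF inj_enc_input])
    have cF: "computes_on (range ?G) ?F"
    proof (rule computes_on_tm[OF A(1)])
      fix w assume "w \<in> range ?G"
      then obtain x where w: "w = ?G x" by blast
      from Y[of x] show "\<exists>t\<le>poly pa (length w). halts_with A w t (?F w)"
        unfolding w F good_def by blast
    qed
    have "computes UNIV ?G" using computes_polytime_raw[OF polytime_inst] by simp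
    from computes_on_comp[OF computes_on_computes[OF this] cF subset_refl]
    have "computes_on UNIV (\<lambda>x. ?F (?G x))" .
    then have 1: "computes_on UNIV (\<lambda>x. enc_pair x (Y (inst x)))"
      unfolding F by (rule computes_on_pair)
    \<comment> \<open>Replaces the answer in the pair of word and answer by the witness read off
      it.\<close>
    let ?e = "\<lambda>r. Raw (enc_pair (unraw (rfirst r))
      (unraw (Raw (witness (poly pw (length (unraw (rfirst r)))) (rsecond r)))))"
    have "polytime ?e"
      by (intro polytime_raw_pair pt polytime_witness)
    from computes_on_computes[OF computes_polytime_raw[OF this]]
    have 2: "computes_on UNIV (\<lambda>w. unraw (?e (Raw w)))" .
    have "computes_on UNIV (\<lambda>x. unraw (?e (Raw (enc_pair x (Y (inst x))))))"
      by (rule computes_on_comp[OF 1 2]) simp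
    then have 3: "computes_on UNIV (\<lambda>x. enc_pair x (witness (wlen x) (Raw (Y (inst x)))))"
      by (simp add: raw_defs wlen_def)
    have "computes_on UNIV (\<lambda>x. [enc_pair x (witness (wlen x) (Raw (Y (inst x)))) \<in> W])"
      using computes_on_comp[OF 3 W(1)[unfolded class_P_iff]] by simp
    \<comment> \<open>The approximation guarantee is used for words of the language only. Conversely
      an accepted witness proves membership, whatever the algorithm has returned.\<close>
    moreover have "enc_pair x (witness (wlen x) (Raw (Y (inst x)))) \<in> W \<longleftrightarrow> x \<in> L" for x
    proof
      assume "x \<in> L"
      then obtain y where y: "length y = wlen x" "enc_pair x y \<in> W" using W(2)
        by (auto simp: wlen_def)
      obtain ts where ts: "Y (inst x) = enc_output ts"
        "length ts = length (trips (network_of (inst x)))"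
          "1 / \<rho> (card (nodes (network_of (inst x)))) * real
            (max_reachability (network_of (inst x))) \<le>
          real (reachability (network_of (inst x)) (\<lambda>i. real_of_rat (ts ! i)))"
        using Y[of x] unfolding good_def by blast
      show "enc_pair x (witness (wlen x) (Raw (Y (inst x)))) \<in> W"
        unfolding ts(1) by (rule approximation_yields_witness[OF y ts(2) assms(2,3) ts(3)])
    next
      assume "enc_pair x (witness (wlen x) (Raw (Y (inst x)))) \<in> W"
      then show "x \<in> L" unfolding W(2) wlen_def using length_witness by blast
    qed
    ultimately show "L \<in> class_P" unfolding class_P_iff by simp
  qed
  then show False using assms(1) P_subset_NP by blast
qed

end
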